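(* Let $(\sigma^t)_{t\ge 0}$ be the zero-temperature stochastic homogeneous Ising ferromagnet on $\mathbf{Z}^2$ started from the symmetric Bernoulli product measure, and let $C_o(t)$ be the cluster at the origin at time $t$. Then at any (deterministic) time there is no percolation of clusters of spins of the same sign: $$P(|C_o(t)|=\infty)=0\quad\text{for all } t\ge 0.$$
   Context: Model. The state space is $\mathcal{S}=\{-1,+1\}^{\mathbf{Z}^2}$. The initial state $\sigma^0$ has law $\mu^0$, the product measure under which the spins $\sigma^0_x$ are i.i.d. and equal to $+1$ or $-1$ with probability $1/2$ each. The continuous-time dynamics are: to each site $x\in\mathbf{Z}^2$ is attached an independent rate-$1$ Poisson process of "clock rings", with an independent fair coin toss attached to each ring. When the clock at $x$ rings, let $k$ be the number of the $4$ nearest neighbors $y$ of $x$ (Euclidean distance $\|x-y\|=1$) with $\sigma_y\ne\sigma_x$: if $k\ge 3$ the spin at $x$ flips ($\sigma_x\to-\sigma_x$); if $k=2$ it flips with probability $1/2$, according to the coin toss; if $k\le 1$ it does not flip. $P=\mu^0\times P_{dyn}$ is the joint law of the initial configuration and the clock rings and coin tosses. The cluster $C_x(t)$ at site $x$ at time $t$ is the maximal subset of $\mathbf{Z}^2$ that contains $x$, is connected (through nearest-neighbor paths within the subset), and on which $\sigma^t$ is constant. $|C_x(t)|$ is its number of sites, and $o$ is the origin. *)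

theory Defs
  imports "HOL-Probability.Probability"
begin

type_synonym site = "int \<times> int"
type_synonym config = "site \<Rightarrow> int"

(* The product metric dist on real * real is the Euclidean distance. *)
definition neighbor :: "site \<Rightarrow> site \<Rightarrow> bool" where
  "neighbor x y \<longleftrightarrow>
     dist (real_of_int (fst x), real_of_int (snd x)) (real_of_int (fst y), real_of_int (snd y)) = 1"

lemma neighbor_iff:
  "neighbor (a, b) (c, d) \<longleftrightarrow> \<bar>a - c\<bar> + \<bar>b - d\<bar> = 1"
proof -
  have aux: "u\<^sup>2 + v\<^sup>2 = 1 \<longleftrightarrow> \<bar>u\<bar> + \<bar>v\<bar> = 1" for u v :: int
  proof
    assume h: "u\<^sup>2 + v\<^sup>2 = 1"
    have "u\<^sup>2 \<le> 1" "v\<^sup>2 \<le> 1" using h zero_le_power2[of u] zero_le_power2[of v] by linarith+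
    then have "\<bar>u\<bar> \<le> 1" "\<bar>v\<bar> \<le> 1" by (simp_all add: abs_square_le_1)
    then have "u \<in> {-1,0,1}" "v \<in> {-1,0,1}" by auto
    then show "\<bar>u\<bar> + \<bar>v\<bar> = 1" using h by auto
  next
    assume h: "\<bar>u\<bar> + \<bar>v\<bar> = 1"
    then have "u \<in> {-1,0,1}" "v \<in> {-1,0,1}" by auto
    then show "u\<^sup>2 + v\<^sup>2 = 1" using h by auto
  qed
  have "neighbor (a, b) (c, d) \<longleftrightarrow> sqrt (real_of_int ((a - c)\<^sup>2 + (b - d)\<^sup>2)) = 1"
    by (simp add: neighbor_def dist_Pair_Pair dist_real_def)
  also have "\<dots> \<longleftrightarrow> (a - c)\<^sup>2 + (b - d)\<^sup>2 = 1"
    by (metis of_int_eq_1_iff real_sqrt_eq_1_iff)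
  finally show ?thesis
    using aux[of "a - c" "b - d"] by simp
qed


(* The state space {-1,+1}^(Z^2) with its product sigma-algebra; the symmetric
   Bernoulli measure below lives on the same measurable space. *)
definition state_space :: "config measure" where
  "state_space = Pi\<^sub>M UNIV (\<lambda>_. count_space {-1, 1})"

definition bernoulli_initial :: "config measure" where
  "bernoulli_initial = Pi\<^sub>M UNIV (\<lambda>_. uniform_count_measure {-1, 1})"

lemma sets_bernoulli_initial: "sets bernoulli_initial = sets state_space"
  unfolding bernoulli_initial_def state_space_def
  by (rule sets_PiM_cong) (auto simp: sets_uniform_count_measure)

(* The rate-1 Poisson process at a site is given by its i.i.d. Exp(1) inter-ring times.
   The data w x n consist of the waiting time preceding the n-th ring (n = 0, 1, ...)
   at x and of the coin toss attached to this ring (True means heads). *)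
type_synonym clocks = "site \<Rightarrow> nat \<Rightarrow> real \<times> bool"

definition clock_measure :: "clocks measure" where
  "clock_measure =
     Pi\<^sub>M UNIV (\<lambda>x. Pi\<^sub>M UNIV (\<lambda>n.
       density lborel (exponential_density 1) \<Otimes>\<^sub>M uniform_count_measure UNIV))"

definition ising_measure :: "(config \<times> clocks) measure" where
  "ising_measure = bernoulli_initial \<Otimes>\<^sub>M clock_measure"

lemma prob_space_ising_measure: "prob_space ising_measure"
proof -
  interpret e: prob_space "density lborel (exponential_density 1)"
    by (rule prob_space_exponential_density) simp
  interpret c: prob_space "uniform_count_measure (UNIV :: bool set)"
    by (rule prob_space_uniform_count_measure) auto
  interpret s: prob_space "uniform_count_measure {-1, 1 :: int}"
    by (rule prob_space_uniform_count_measure) auto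
  interpret ec: pair_prob_space "density lborel (exponential_density 1)"
    "uniform_count_measure (UNIV :: bool set)" ..
  have 1: "prob_space bernoulli_initial"
    unfolding bernoulli_initial_def by (rule prob_space_PiM) unfold_locales
  have 2: "prob_space clock_measure"
    unfolding clock_measure_def by (intro prob_space_PiM) unfold_locales
  interpret pair_prob_space bernoulli_initial clock_measure
    using 1 2 by (simp add: pair_prob_space_def pair_sigma_finite_def prob_space_imp_sigma_finite)
  show ?thesis
    unfolding ising_measure_def by unfold_locales
qed

definition ring_time :: "clocks \<Rightarrow> site \<Rightarrow> nat \<Rightarrow> real" where
  "ring_time w x n = (\<Sum>k\<le>n. fst (w x k))"

definition coin :: "clocks \<Rightarrow> site \<Rightarrow> nat \<Rightarrow> bool" where
  "coin w x n = snd (w x n)"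


definition disagreements :: "config \<Rightarrow> site \<Rightarrow> nat" where
  "disagreements \<eta> x = card {y. neighbor x y \<and> \<eta> y \<noteq> \<eta> x}"

definition updated_spin :: "config \<Rightarrow> site \<Rightarrow> bool \<Rightarrow> int" where
  "updated_spin \<eta> x c =
     (if disagreements \<eta> x \<ge> 3 \<or> (disagreements \<eta> x = 2 \<and> c) then - \<eta> x else \<eta> x)"

(* A trajectory s obeys the clocks w if the spin at x only changes at rings of x and if, at
   each ring, it is updated according to the configuration just before the ring, i.e. the
   pointwise left limit of s. *)
definition obeys_clocks :: "clocks \<Rightarrow> (real \<Rightarrow> config) \<Rightarrow> bool" where
  "obeys_clocks w s \<longleftrightarrow>
     (\<forall>x a b. 0 \<le> a \<and> a \<le> b \<and> (\<forall>n. ring_time w x n \<notin> {a<..b}) \<longrightarrow> s b x = s a x) \<and>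
     (\<forall>x n. \<exists>\<eta>. (\<forall>y. \<forall>\<^sub>F u in at_left (ring_time w x n). s u y = \<eta> y) \<and>
                 s (ring_time w x n) x = updated_spin \<eta> x (coin w x n))"

(* In infinite volume the initial state, clocks and coins determine the trajectory only almost
   surely. The process is therefore characterised, up to a null set, as a family of random
   configurations that starts from the initial state and obeys the clocks. Only the values at
   times t >= 0 matter. *)
definition zero_temp_ising :: "(real \<Rightarrow> config \<times> clocks \<Rightarrow> config) \<Rightarrow> bool" where
  "zero_temp_ising \<sigma> \<longleftrightarrow>
     (\<forall>t\<ge>0. \<sigma> t \<in> measurable ising_measure state_space) \<and>
     (AE \<omega> in ising_measure.
        \<sigma> 0 \<omega> = fst \<omega> \<and> obeys_clocks (snd \<omega>) (\<lambda>t. \<sigma> t \<omega>))"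


definition site_connected :: "site set \<Rightarrow> bool" where
  "site_connected A \<longleftrightarrow>
     (\<forall>x\<in>A. \<forall>y\<in>A. (x, y) \<in> {(u, v). u \<in> A \<and> v \<in> A \<and> neighbor u v}\<^sup>*)"

definition mono_connected_at :: "config \<Rightarrow> site \<Rightarrow> site set \<Rightarrow> bool" where
  "mono_connected_at \<eta> x A \<longleftrightarrow> x \<in> A \<and> site_connected A \<and> (\<forall>u\<in>A. \<forall>v\<in>A. \<eta> u = \<eta> v)"

definition cluster :: "config \<Rightarrow> site \<Rightarrow> site set" where
  "cluster \<eta> x = (GREATEST A. mono_connected_at \<eta> x A)"

(* The greatest such set exists, so that cluster is well defined. *)
lemma mono_connected_at_Union:
  "mono_connected_at \<eta> x (\<Union>{A. mono_connected_at \<eta> x A})" (is "mono_connected_at \<eta> x ?U")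
proof -
  let ?R = "\<lambda>A. {(u, v). u \<in> A \<and> v \<in> A \<and> neighbor u v}"
  have "mono_connected_at \<eta> x {x}"
    by (simp add: mono_connected_at_def site_connected_def)
  then have x: "x \<in> ?U"
    by (auto simp: mono_connected_at_def)
  have path: "(a, x) \<in> (?R ?U)\<^sup>* \<and> (x, a) \<in> (?R ?U)\<^sup>* \<and> \<eta> a = \<eta> x" if "a \<in> ?U" for a
  proof -
    from that obtain A where A: "mono_connected_at \<eta> x A" "a \<in> A" by auto
    have "?R A \<subseteq> ?R ?U" using A(1) by auto
    then have "(?R A)\<^sup>* \<subseteq> (?R ?U)\<^sup>*" by (rule rtrancl_mono)
    with A show ?thesis
      unfolding mono_connected_at_def site_connected_def by blast
  qed
  have "(a, b) \<in> (?R ?U)\<^sup>*" if "a \<in> ?U" "b \<in> ?U" for a b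
    using path[OF that(1)] path[OF that(2)] by (meson rtrancl_trans)
  moreover have "\<eta> a = \<eta> b" if "a \<in> ?U" "b \<in> ?U" for a b
    using path[OF that(1)] path[OF that(2)] by simp
  ultimately show ?thesis
    using x unfolding mono_connected_at_def site_connected_def by blast
qed

lemma cluster_eq_Union: "cluster \<eta> x = \<Union>{A. mono_connected_at \<eta> x A}"
  unfolding cluster_def
  by (rule Greatest_equality) (use mono_connected_at_Union in auto)

end

theory Submission
  imports Defs "HOL-Library.Transitive_Closure_Table"
begin

text \<open>
  The law of \<open>\<sigma> t\<close> is positively associated, invariant under the automorphisms of the lattice and under
  a global spin flip, and mixing under translations. By self-duality a square is crossed by a
  \<open>star\<close>-connected path of \<open>+1\<close> spins with probability at least \<open>1/2\<close>, and Tassion's form of the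
  Russo-Seymour-Welsh argument turns this into crossings of long rectangles, with a probability that is
  bounded below at infinitely many scales. Four such crossings surround the origin and confine the
  clusters of \<open>-1\<close> spins inside. So with positive probability there is no infinite cluster of \<open>-1\<close>
  spins, and the zero-one law and the spin flip conclude.

  The dynamics that flips at ties is not monotone for given coins, and the ring times are not monotone
  parameters, so positive association is proved for the law only: when the waiting times are rounded
  up to multiples of \<open>\<delta>\<close> they are geometric, the rings in a finite volume form a Bernoulli field, and the
  discretised dynamics is a composition of resamplings of single spins whose probability of \<open>+1\<close>
  increases with the configuration. The limits \<open>\<delta> \<rightarrow> 0\<close> and infinite volume are harmless because the sites
  that ring in a short time interval do not percolate, so that the spins in a finite set at time \<open>t\<close>
  depend on finitely many sites only; this also gives uniqueness of the trajectory and thereby the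
  symmetries.
\<close>

section \<open>Planar crossings\<close>

text \<open>Plus sites are joined by \<open>star\<close> and minus sites by \<open>neighbor\<close>
  because these lattices are dual: a rectangle without a crossing of one kind has a transversal
  crossing of the other, and paths of the two kinds cannot cross without sharing a site. As
  \<open>neighbor\<close> paths are also \<open>star\<close> paths, the spin flip yields at least
  \<open>1/2\<close> for squares. Tassion's comparison of a scale \<open>m\<close> with
  \<open>n\<close> near \<open>3 m / 2\<close> needs \<alpha>(n) \<le> 2 \<alpha>(m). This may fail
  at single scales but not at all large ones, since \<alpha>(n) \<le> n and doubling at each growth
  by \<open>3/2\<close> is too fast. A sequence of scales suffices: blocking arbitrarily large boxes
  with a uniform positive probability keeps the probability of an infinite cluster below one. The
  process is given by axioms, not by a construction, so its law is inaccessible until the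
  configuration at time t is tied almost surely to finite-volume dynamics. The volume and the mesh
  that work depend on the sample; an almost sure double limit is therefore turned into one pair of
  parameters that works with probability close to one.\<close>

definition star :: "site \<Rightarrow> site \<Rightarrow> bool" where
  "star x y \<longleftrightarrow> \<bar>fst x - fst y\<bar> \<le> 1 \<and> \<bar>snd x - snd y\<bar> \<le> 1"

text \<open>The clause \<open>u \<in> S\<close> is explicit because the reflexive closure relates
  every site to itself, also outside \<open>S\<close>.\<close>

definition linked :: "(site \<Rightarrow> site \<Rightarrow> bool) \<Rightarrow> site set \<Rightarrow> site \<Rightarrow> site \<Rightarrow> bool" where
  "linked r S u v \<longleftrightarrow> u \<in> S \<and> (u, v) \<in> {(a, b). a \<in> S \<and> b \<in> S \<and> r a b}\<^sup>*"

definition rect :: "int \<Rightarrow> int \<Rightarrow> int \<Rightarrow> int \<Rightarrow> site set" where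
  "rect a b c d = {a..b} \<times> {c..d}"

lemma mem_rect [simp]: "p \<in> rect a b c d \<longleftrightarrow> a \<le> fst p \<and> fst p \<le> b \<and> c \<le> snd p \<and> snd p \<le> d"
  by (cases p) (auto simp: rect_def)

lemma finite_rect [simp]: "finite (rect a b c d)"
  by (simp add: rect_def)

lemma star_sym: "star x y \<longleftrightarrow> star y x"
  by (auto simp: star_def)

lemma star_refl [simp]: "star x x"
  by (simp add: star_def)

lemma neighbor_iff': "neighbor x y \<longleftrightarrow> \<bar>fst x - fst y\<bar> + \<bar>snd x - snd y\<bar> = 1"
  using neighbor_iff[of "fst x" "snd x" "fst y" "snd y"] by simp

lemma neighbor_sym: "neighbor x y \<longleftrightarrow> neighbor y x"
  by (auto simp: neighbor_iff')

lemma neighbor_imp_star: "neighbor x y \<Longrightarrow> star x y"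
  by (auto simp: neighbor_iff' star_def)

lemma linked_refl: "u \<in> S \<Longrightarrow> linked r S u u"
  by (simp add: linked_def)

lemma linked_step: "linked r S u v \<Longrightarrow> r v w \<Longrightarrow> w \<in> S \<Longrightarrow> linked r S u w"
  unfolding linked_def
  by (metis (mono_tags, lifting) mem_Collect_eq old.prod.case rtrancl.simps)

lemma linked_start: "linked r S u v \<Longrightarrow> u \<in> S"
  by (simp add: linked_def)

lemma linked_end: "linked r S u v \<Longrightarrow> v \<in> S"
  unfolding linked_def by (metis (mono_tags, lifting) mem_Collect_eq old.prod.case rtranclE)

lemma linked_induct [consumes 1, case_names refl step]:
  assumes "linked r S u v" "u \<in> S \<Longrightarrow> P u"
    and "\<And>v w. linked r S u v \<Longrightarrow> P v \<Longrightarrow> v \<in> S \<Longrightarrow> w \<in> S \<Longrightarrow> r v w \<Longrightarrow> P w"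
  shows "P v"
proof -
  have "u \<in> S" "(u, v) \<in> {(a, b). a \<in> S \<and> b \<in> S \<and> r a b}\<^sup>*"
    using assms(1) by (auto simp: linked_def)
  from this(2) show ?thesis
    by (induction) (use assms(2,3) \<open>u \<in> S\<close> in \<open>auto simp: linked_def\<close>)
qed

lemma linked_trans: "linked r S u v \<Longrightarrow> linked r S v w \<Longrightarrow> linked r S u w"
  unfolding linked_def by auto

lemma linked_sym:
  assumes "\<And>x y. r x y \<Longrightarrow> r y x" "linked r S u v"
  shows "linked r S v u"
  using assms(2)
proof (induction rule: linked_induct)
  case (step v w)
  have "linked r S w v"
    using step assms(1) by (intro linked_step[OF linked_refl]) auto
  then show ?case using step linked_trans by blast
qed (auto simp: linked_refl)

lemma linked_mono:
  assumes "linked r S u v" "S \<subseteq> T" "\<And>x y. r x y \<Longrightarrow> r' x y"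
  shows "linked r' T u v"
  using assms(1)
  by (induction rule: linked_induct) (use assms in \<open>auto intro: linked_refl linked_step\<close>)

lemma linked_subset: "linked r S u v \<Longrightarrow> S \<subseteq> T \<Longrightarrow> linked r T u v"
  by (rule linked_mono)

lemma linked_star_sym: "linked star S u v \<Longrightarrow> linked star S v u"
  by (rule linked_sym) (auto simp: star_sym)

lemma linked_image:
  assumes "linked r S u v" "\<And>x y. r x y \<Longrightarrow> r' (T x) (T y)"
  shows "linked r' (T ` S) (T u) (T v)"
  using assms(1)
  by (induction rule: linked_induct) (use assms(2) in \<open>auto intro: linked_refl linked_step\<close>)

text \<open>Restricting to the set reached from \<open>u\<close> makes every site of the set
  connected to \<open>u\<close>; a meeting of two such sets then becomes a connection of their
  starting points.\<close>

lemma linked_component: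
  assumes "linked r S u v"
  shows "linked r {w. linked r S u w} u v"
  using assms
  by (induction rule: linked_induct) (auto intro: linked_refl linked_step)

lemma linked_vertical:
  assumes "c \<le> d"
  shows "linked star (rect a a c d) (a, c) (a, d)"
  using assms
proof (induction d rule: int_ge_induct)
  case base show ?case by (auto intro!: linked_refl)
next
  case (step i)
  have "linked star (rect a a c (i+1)) (a, c) (a, i)"
    by (rule linked_mono[OF step.IH]) auto
  then show ?case
    by (rule linked_step) (use step in \<open>auto simp: star_def\<close>)
qed

lemma linked_horizontal:
  assumes "a \<le> b"
  shows "linked star (rect a b c c) (a, c) (b, c)"
  using assms
proof (induction b rule: int_ge_induct)
  case base show ?case by (auto intro!: linked_refl)
next
  case (step i)
  have "linked star (rect a (i+1) c c) (a, c) (i, c)"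
    by (rule linked_mono[OF step.IH]) auto
  then show ?case
    by (rule linked_step) (use step in \<open>auto simp: star_def\<close>)
qed

section \<open>Lattice paths as curves in the plane\<close>

definition emb :: "site \<Rightarrow> real^2" where
  "emb p = vector [of_int (fst p), of_int (snd p)]"

lemma emb_nth [simp]: "emb p $ 1 = of_int (fst p)" "emb p $ 2 = of_int (snd p)"
  by (simp_all add: emb_def)

text \<open>The union of the closed unit squares centred at the sites of \<open>S\<close>. Squares
  of two sites meet only if the sites are \<open>star\<close>-related, so an intersection of curves
  can be read back as adjacency.\<close>

definition near :: "site set \<Rightarrow> (real^2) set" where
  "near S = {z. \<exists>w\<in>S. \<bar>z$1 - of_int (fst w)\<bar> \<le> 1/2 \<and> \<bar>z$2 - of_int (snd w)\<bar> \<le> 1/2}"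

text \<open>In each coordinate, the first half of the segment stays within \<open>1/2\<close> of
  \<open>v\<close> and the second half within \<open>1/2\<close> of \<open>w\<close>.\<close>

lemma segment_near:
  assumes "star v w" "v \<in> S" "w \<in> S"
  shows "closed_segment (emb v) (emb w) \<subseteq> near S"
proof
  fix z assume "z \<in> closed_segment (emb v) (emb w)"
  then obtain t where t: "0 \<le> t" "t \<le> 1" "z = (1 - t) *\<^sub>R emb v + t *\<^sub>R emb w"
    unfolding in_segment by auto
  define p q :: real where "p = of_int (fst w - fst v)" and "q = of_int (snd w - snd v)"
  have pq: "\<bar>p\<bar> \<le> 1" "\<bar>q\<bar> \<le> 1"
    using assms(1) unfolding star_def p_def q_def by linarith+
  have z: "z$1 - of_int (fst v) = t * p" "z$2 - of_int (snd v) = t * q"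
    "z$1 - of_int (fst w) = - ((1 - t) * p)" "z$2 - of_int (snd w) = - ((1 - t) * q)"
    by (auto simp: t(3) p_def q_def algebra_simps)
  show "z \<in> near S"
  proof (cases "t \<le> 1/2")
    case True
    have "\<bar>t * p\<bar> \<le> 1/2 * 1" "\<bar>t * q\<bar> \<le> 1/2 * 1"
      unfolding abs_mult using True t pq by (intro mult_mono; auto)+
    then show ?thesis using assms(2) unfolding near_def z[symmetric] by auto
  next
    case False
    have "\<bar>(1-t) * p\<bar> \<le> 1/2 * 1" "\<bar>(1-t) * q\<bar> \<le> 1/2 * 1"
      unfolding abs_mult using False t pq by (intro mult_mono; auto)+
    then have "\<bar>z$1 - of_int (fst w)\<bar> \<le> 1/2" "\<bar>z$2 - of_int (snd w)\<bar> \<le> 1/2"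
      unfolding z(3,4) by auto
    then show ?thesis using assms(3) unfolding near_def by blast
  qed
qed

text \<open>Degenerate segments \<open>v = w\<close> are included so that a path consisting of a
  single site is covered as well.\<close>

definition edges :: "(site \<Rightarrow> site \<Rightarrow> bool) \<Rightarrow> site set \<Rightarrow> (real^2) set" where
  "edges r S = (\<Union>v\<in>S. \<Union>w\<in>{w\<in>S. v = w \<or> r v w}. closed_segment (emb v) (emb w))"

lemma linked_path:
  assumes "linked r S u v" "convex K" "emb ` S \<subseteq> K"
  shows "\<exists>f. path f \<and> pathstart f = emb u \<and> pathfinish f = emb v \<and> path_image f \<subseteq> edges r S \<inter> K"
  using assms(1)
proof (induction rule: linked_induct)
  case refl
  then have "emb u \<in> edges r S"
    unfolding edges_def by (intro UN_I[of u]) auto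
  then show ?case
    using assms(3) refl
    by (intro exI[of _ "\<lambda>_. emb u"])
      (auto simp: path_def pathstart_def pathfinish_def path_image_def)
next
  case (step v w)
  then obtain f where f: "path f" "pathstart f = emb u" "pathfinish f = emb v"
    "path_image f \<subseteq> edges r S \<inter> K" by auto
  have "closed_segment (emb v) (emb w) \<subseteq> K"
    using step assms(2,3) by (simp add: closed_segment_subset image_subset_iff)
  moreover have "closed_segment (emb v) (emb w) \<subseteq> edges r S"
    using step unfolding edges_def by blast
  ultimately show ?case
    using f by (intro exI[of _ "f +++ linepath (emb v) (emb w)"]) (auto simp: path_image_join)
qed

lemma edges_star_near: "edges star S \<subseteq> near S"
proof -
  have "closed_segment (emb v) (emb w) \<subseteq> near S" if "v \<in> S" "w \<in> S" "v = w \<or> star v w" for v w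
    using segment_near[of v w S] that by auto
  then show ?thesis unfolding edges_def by blast
qed

lemma linked_star_path:
  assumes "linked star S u v" "convex K" "emb ` S \<subseteq> K"
  shows "\<exists>f. path f \<and> pathstart f = emb u \<and> pathfinish f = emb v \<and> path_image f \<subseteq> near S \<inter> K"
  using linked_path[OF assms] edges_star_near by blast

lemma near_meet:
  assumes "z \<in> near S" "z \<in> near T"
  shows "\<exists>x\<in>S. \<exists>y\<in>T. star x y"
proof -
  obtain x y where xy: "x \<in> S" "y \<in> T"
    "\<bar>z$1 - of_int (fst x)\<bar> \<le> 1/2" "\<bar>z$2 - of_int (snd x)\<bar> \<le> 1/2"
    "\<bar>z$1 - of_int (fst y)\<bar> \<le> 1/2" "\<bar>z$2 - of_int (snd y)\<bar> \<le> 1/2"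
    using assms unfolding near_def by blast
  have "\<bar>real_of_int (fst x - fst y)\<bar> \<le> 1" "\<bar>real_of_int (snd x - snd y)\<bar> \<le> 1"
    using xy by (auto simp: abs_if split: if_splits)
  then have "star x y" unfolding star_def by linarith
  then show ?thesis using xy by blast
qed

lemma emb_rect: "S \<subseteq> rect a b c d \<Longrightarrow> emb ` S \<subseteq> cbox (emb (a, c)) (emb (b, d))"
  by (fastforce simp: mem_box_cart forall_2)

text \<open>The planar input is the Fashoda theorem for curves that join opposite sides of a box. It
  yields adjacency only, since two diagonal steps can cross between the sites; this is enough for
  joining \<open>star\<close> paths.\<close>

lemma star_LR_TB_meet:
  assumes "linked star S u v" "S \<subseteq> rect a b c d" "fst u = a" "fst v = b"
    and "linked star T p q" "T \<subseteq> rect a b c d" "snd p = c" "snd q = d"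
  shows "\<exists>x\<in>S. \<exists>y\<in>T. star x y"
proof -
  obtain f where f: "path f" "pathstart f = emb u" "pathfinish f = emb v"
    "path_image f \<subseteq> near S \<inter> cbox (emb (a, c)) (emb (b, d))"
    using linked_star_path[OF assms(1) convex_box(1) emb_rect[OF assms(2)]] by auto
  obtain g where g: "path g" "pathstart g = emb p" "pathfinish g = emb q"
    "path_image g \<subseteq> near T \<inter> cbox (emb (a, c)) (emb (b, d))"
    using linked_star_path[OF assms(5) convex_box(1) emb_rect[OF assms(6)]] by auto
  obtain z where "z \<in> path_image f" "z \<in> path_image g"
    by (rule fashoda[of f g "emb (a,c)" "emb (b,d)"]) (use f g assms in auto)
  then show ?thesis using f(4) g(4) by (intro near_meet) auto
qed

lemma unit_step_integer:
  fixes a b c :: int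
  assumes "of_int a + s * of_int (b - a) = (of_int c :: real)" "\<bar>a - b\<bar> \<le> 1" "a \<noteq> b" "0 \<le> s" "s \<le> 1"
  shows "s = 0 \<or> s = 1"
proof -
  have "b = a + 1 \<or> b = a - 1" using assms(2,3) by linarith
  then have "s = of_int (c - a) \<or> s = of_int (a - c)" using assms(1) by auto
  then obtain k :: int where "s = of_int k" by blast
  then show ?thesis using assms(4,5) by (cases "k \<le> 0") auto
qed

lemma unit_intervals_meet:
  fixes a b c d :: int
  assumes "of_int a + t * of_int (b - a) = (of_int c + s * of_int (d - c) :: real)"
    and "\<bar>a - b\<bar> = 1" "\<bar>c - d\<bar> \<le> 1" "0 \<le> s" "s \<le> 1" "0 \<le> t" "t \<le> 1"
  shows "{a, b} \<inter> {c, d} \<noteq> {}"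
proof (rule ccontr)
  assume "\<not> ?thesis"
  \<comment> \<open>Two pairs of integers, each with spread at most one, can be disjoint only if one
    lies entirely below the other.\<close>
  then have "max c d < min a b \<or> max a b < min c d" using assms(2,3) by auto
  moreover have "of_int (min a b) \<le> of_int a + t * of_int (b - a)"
    "of_int a + t * of_int (b - a) \<le> of_int (max a b)"
    "of_int (min c d) \<le> of_int c + s * of_int (d - c)"
    "of_int c + s * of_int (d - c) \<le> of_int (max c d)"
    using convex_bound_le[of "of_int a" "of_int (max a b)" "of_int b" "1 - t" t]
      convex_bound_le[of "- of_int a" "- of_int (min a b)" "- of_int b" "1 - t" t]
      convex_bound_le[of "of_int c" "of_int (max c d)" "of_int d" "1 - s" s]
      convex_bound_le[of "- of_int c" "- of_int (min c d)" "- of_int d" "1 - s" s] assms(4-)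
    by (auto simp: algebra_simps)
  ultimately show False using assms(1) by linarith
qed

text \<open>A \<open>neighbor\<close> edge lies on a lattice line. A \<open>star\<close> step that
  is not parallel to this line meets it only at its ends, and parallel steps on the same line
  overlap as integer intervals, so a common end always exists.\<close>

lemma neighbor_star_segments_meet:
  assumes "v = w \<or> neighbor v w" "p = q \<or> star p q"
    and "z \<in> closed_segment (emb v) (emb w)" "z \<in> closed_segment (emb p) (emb q)"
  shows "{v, w} \<inter> {p, q} \<noteq> {}"
proof -
  obtain t where t: "0 \<le> t" "t \<le> 1" "z = (1 - t) *\<^sub>R emb v + t *\<^sub>R emb w"
    using assms(3) unfolding in_segment by auto
  obtain s where s: "0 \<le> s" "s \<le> 1" "z = (1 - s) *\<^sub>R emb p + s *\<^sub>R emb q"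
    using assms(4) unfolding in_segment by auto
  obtain v1 v2 w1 w2 p1 p2 q1 q2 where c: "v = (v1, v2)" "w = (w1, w2)" "p = (p1, p2)" "q = (q1, q2)"
    by (metis prod.exhaust)
  have vw: "\<bar>v1 - w1\<bar> + \<bar>v2 - w2\<bar> \<le> 1" using assms(1) c by (auto simp: neighbor_iff')
  have pq: "\<bar>p1 - q1\<bar> \<le> 1" "\<bar>p2 - q2\<bar> \<le> 1" using assms(2) c by (auto simp: star_def)
  have z1: "of_int v1 + t * of_int (w1 - v1) = (of_int p1 + s * of_int (q1 - p1) :: real)"
    and z2: "of_int v2 + t * of_int (w2 - v2) = (of_int p2 + s * of_int (q2 - p2) :: real)"
    using arg_cong[OF trans[OF t(3)[symmetric] s(3)], of "\<lambda>z. z$1"]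
      arg_cong[OF trans[OF t(3)[symmetric] s(3)], of "\<lambda>z. z$2"]
    by (simp_all add: c algebra_simps)
  have ts: ?thesis if "s = 0 \<or> s = 1"
  proof -
    have "\<bar>v1 - w1\<bar> \<le> 1" "\<bar>v2 - w2\<bar> \<le> 1" using vw by linarith+
    then have "t = 0 \<or> t = 1 \<or> v = w"
      using unit_step_integer[of v1 t w1 p1] unit_step_integer[of v2 t w2 p2] unit_step_integer[of v1 t w1 q1]
        unit_step_integer[of v2 t w2 q2] z1 z2 that vw t c by auto blast+
    then show ?thesis using that z1 z2 by (auto simp: c)
  qed
  show ?thesis
  proof (cases "v = w")
    case True
    then have "s = 0 \<or> s = 1 \<or> p = q"
      using unit_step_integer[of p1 s q1 v1] unit_step_integer[of p2 s q2 v2] z1 z2 pq s c by auto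
    then show ?thesis using ts True z1 z2 by (auto simp: c)
  next
    case False
    then consider "\<bar>v1 - w1\<bar> = 1" "v2 = w2" | "\<bar>v2 - w2\<bar> = 1" "v1 = w1"
      using vw unfolding c prod.inject by linarith
    then show ?thesis
    proof cases
      case 1
      then show ?thesis
        using unit_step_integer[of p2 s q2 v2] ts unit_intervals_meet[OF z1 1(1) pq(1)] z2 pq s t
        by (cases "p2 = q2") (auto simp: c)
    next
      case 2
      then show ?thesis
        using unit_step_integer[of p1 s q1 v1] ts unit_intervals_meet[OF z2 2(1) pq(2)] z1 pq s t
        by (cases "p1 = q1") (auto simp: c)
    qed
  qed
qed

text \<open>Unlike for two \<open>star\<close> paths, the crossing forces a common site. This is
  what makes a \<open>star\<close> crossing of plus spins impassable for a minus cluster.\<close>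

lemma neighbor_LR_star_TB_meet:
  assumes "linked neighbor S u v" "S \<subseteq> rect a b c d" "fst u = a" "fst v = b"
    and "linked star T p q" "T \<subseteq> rect a b c d" "snd p = c" "snd q = d"
  shows "S \<inter> T \<noteq> {}"
proof -
  obtain f where f: "path f" "pathstart f = emb u" "pathfinish f = emb v"
    "path_image f \<subseteq> edges neighbor S \<inter> cbox (emb (a, c)) (emb (b, d))"
    using linked_path[OF assms(1) convex_box(1) emb_rect[OF assms(2)]] by auto
  obtain g where g: "path g" "pathstart g = emb p" "pathfinish g = emb q"
    "path_image g \<subseteq> edges star T \<inter> cbox (emb (a, c)) (emb (b, d))"
    using linked_path[OF assms(5) convex_box(1) emb_rect[OF assms(6)]] by auto
  obtain z where "z \<in> path_image f" "z \<in> path_image g"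
    by (rule fashoda[of f g "emb (a,c)" "emb (b,d)"]) (use f g assms in auto)
  then have "z \<in> edges neighbor S" "z \<in> edges star T" using f(4) g(4) by auto
  then obtain v w p q where "v \<in> S" "w \<in> S" "v = w \<or> neighbor v w" "z \<in> closed_segment (emb v) (emb w)"
    "p \<in> T" "q \<in> T" "p = q \<or> star p q" "z \<in> closed_segment (emb p) (emb q)"
    unfolding edges_def by blast
  then show ?thesis using neighbor_star_segments_meet[of v w p q z] by blast
qed

lemma star_interlace_meet:
  assumes "linked star S u v" "S \<subseteq> rect a b c d" "linked star T p q" "T \<subseteq> rect a b c d"
    and "snd u = c" "snd v = c" "snd p = c" "snd q = c"
    and "fst u < fst p" "fst p < fst v" "fst v < fst q"
  shows "\<exists>x\<in>S. \<exists>y\<in>T. star x y"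
proof -
  obtain f where f: "path f" "pathstart f = emb u" "pathfinish f = emb v"
    "path_image f \<subseteq> near S \<inter> cbox (emb (a, c)) (emb (b, d))"
    using linked_star_path[OF assms(1) convex_box(1) emb_rect[OF assms(2)]] by auto
  obtain g where g: "path g" "pathstart g = emb p" "pathfinish g = emb q"
    "path_image g \<subseteq> near T \<inter> cbox (emb (a, c)) (emb (b, d))"
    using linked_star_path[OF assms(3) convex_box(1) emb_rect[OF assms(4)]] by auto
  obtain z where "z \<in> path_image f" "z \<in> path_image g"
    by (rule fashoda_interlace[of f g "emb (a,c)" "emb (b,d)"]) (use f g assms in auto)
  then show ?thesis using f(4) g(4) by (intro near_meet) auto
qed

text \<open>The path from \<open>p\<close> escapes between the two ends of the other path, so
  planarity forces them together. The interlacing form of the Fashoda theorem wants all four ends on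
  one side of a box; therefore the path from \<open>p\<close> is prolonged along the left and the
  top and back to the line of the right side.\<close>

lemma star_sandwich_meet:
  assumes S: "linked star S u v" "S \<subseteq> rect (a + 1) b c d" "fst u = b" "fst v = b"
    and T: "linked star T p q" "T \<subseteq> rect a b c d" "fst p = b" "fst q = a"
    and le: "snd u \<le> snd p" "snd p \<le> snd v"
  shows "\<exists>x\<in>S. \<exists>y\<in>T. star x y"
proof (cases "snd u = snd p \<or> snd p = snd v")
  case True
  then have "u = p \<or> v = p" using S T by (auto simp: prod_eq_iff)
  then show ?thesis
    using linked_start[OF S(1)] linked_end[OF S(1)] linked_start[OF T(1)] star_refl by blast
next
  case False
  \<comment> \<open>The detour keeps distance two from \<open>S\<close>, in columns by the
    hypothesis \<open>a + 1\<close> and in rows by the choice \<open>d + 2\<close>, so the adjacency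
    found below cannot involve it.\<close>
  define D where "D = rect (a - 1) (a - 1) c (d + 2) \<union> rect (a - 1) b (d + 2) (d + 2)"
  \<comment> \<open>A quarter turn that makes the right side the bottom side.\<close>
  define F :: "site \<Rightarrow> site" where "F = (\<lambda>p. (snd p, - fst p))"
  have F: "star (F x) (F y) \<longleftrightarrow> star x y" for x y
    by (auto simp: F_def star_def)
  have q: "q \<in> rect a b c d" using T(2) linked_end[OF T(1)] by auto
  have p: "p \<in> rect a b c d" using T(2) linked_start[OF T(1)] by auto
  have "linked star (T \<union> D) p q"
    by (rule linked_mono[OF T(1)]) auto
  then have "linked star (T \<union> D) p (a - 1, snd q)"
    by (rule linked_step) (use q T(4) in \<open>auto simp: star_def D_def\<close>)
  moreover have "linked star (T \<union> D) (a - 1, snd q) (a - 1, d + 2)"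
    by (rule linked_mono[OF linked_vertical]) (use q in \<open>auto simp: D_def\<close>)
  moreover have "linked star (T \<union> D) (a - 1, d + 2) (b, d + 2)"
    by (rule linked_mono[OF linked_horizontal]) (use q in \<open>auto simp: D_def\<close>)
  ultimately have TD: "linked star (T \<union> D) p (b, d + 2)"
    using linked_trans by blast
  have v: "v \<in> rect (a+1) b c d" using S(2) linked_end[OF S(1)] by auto
  have "\<exists>x\<in>F ` S. \<exists>y\<in>F ` (T \<union> D). star x y"
  proof (rule star_interlace_meet)
    show "linked star (F ` S) (F u) (F v)"
      by (rule linked_image[OF S(1)]) (simp add: F)
    show "linked star (F ` (T \<union> D)) (F p) (F (b, d + 2))"
      by (rule linked_image[OF TD]) (simp add: F)
    show "F ` S \<subseteq> rect c (d+2) (- b) (1 - a)" "F ` (T \<union> D) \<subseteq> rect c (d+2) (- b) (1 - a)"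
      using S(2) T(2) p unfolding F_def D_def by fastforce+
  qed (use S(3,4) T(3,4) False le v in \<open>auto simp: F_def\<close>)
  then obtain x y where xy: "x \<in> S" "y \<in> T \<union> D" "star x y"
    using F by blast
  have "y \<notin> D"
  proof
    assume "y \<in> D"
    moreover have "x \<in> rect (a+1) b c d" using xy S(2) by auto
    ultimately show False using xy(3) by (auto simp: D_def star_def)
  qed
  then show ?thesis using xy by auto
qed

section \<open>Parity of boundary edges and planar duality\<close>

lemma sum_int_atLeastLessThan_Suc:
  fixes g :: "int \<Rightarrow> int"
  assumes "a \<le> i"
  shows "sum g {a..<i+1} = sum g {a..<i} + g i"
proof -
  have "{a..<i+1} = insert i {a..<i}" using assms by auto
  then show ?thesis by simp
qed

lemma even_changes:
  fixes g :: "int \<Rightarrow> bool"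
  assumes "a \<le> b"
  shows "even (\<Sum>x\<in>{a..<b}. of_bool (g x \<noteq> g (x+1)) :: int) \<longleftrightarrow> (g a \<longleftrightarrow> g b)"
  using assms
proof (induction b rule: int_ge_induct)
  case (step i)
  then show ?case
    unfolding sum_int_atLeastLessThan_Suc[OF step(1)] by (auto simp del: sum_of_bool_eq)
qed auto

lemma even_telescope:
  fixes g :: "int \<Rightarrow> int"
  assumes "a \<le> b"
  shows "even (\<Sum>x\<in>{a..<b}. g x + g (x+1)) \<longleftrightarrow> even (g a + g b)"
  using assms
proof (induction b rule: int_ge_induct)
  case (step i)
  then show ?case unfolding sum_int_atLeastLessThan_Suc[OF step(1)] by auto
qed auto

definition cut :: "(site \<Rightarrow> bool) \<Rightarrow> (site \<Rightarrow> bool) \<Rightarrow> site \<Rightarrow> site \<Rightarrow> int" where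
  "cut u w p q = of_bool (u p \<and> \<not> u q \<and> w q \<or> u q \<and> \<not> u p \<and> w p)"

lemma cut_sym: "cut u w p q = cut u w q p"
  by (auto simp: cut_def)

text \<open>Along the 4-cycle, each maximal run of sites outside \<open>u\<close> is bounded by two
  edges, and \<open>w\<close> is constant on the run, so both edges are kept or both are
  dropped.\<close>

lemma even_cut_square:
  assumes "\<And>p q. {p, q} \<subseteq> {p0, p1, p2, p3} \<Longrightarrow> neighbor p q \<Longrightarrow> \<not> u p \<Longrightarrow> \<not> u q \<Longrightarrow>
      u p0 \<or> u p1 \<or> u p2 \<or> u p3 \<Longrightarrow> w p \<longleftrightarrow> w q"
    and "neighbor p0 p1" "neighbor p1 p2" "neighbor p2 p3" "neighbor p3 p0"
  shows "even (cut u w p0 p1 + cut u w p1 p2 + cut u w p2 p3 + cut u w p3 p0)"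
  unfolding cut_def
  using assms(1)[of p0 p1] assms(1)[of p1 p2] assms(1)[of p2 p3] assms(1)[of p3 p0] assms(2-)
  by auto

text \<open>
  Let \<open>U\<close> be what can be reached from the left side. Of the boundary edges of \<open>U\<close>, keep those whose
  outer endpoint is joined to the top side within the outer boundary. Around every unit square their
  number is even, so its parity is the same in all rows; in the top row it is odd.
\<close>

lemma star_LR_or_neighbor_TB:
  assumes "a \<le> b" "c \<le> d"
  shows "(\<exists>u v. linked star (P \<inter> rect a b c d) u v \<and> fst u = a \<and> fst v = b) \<or>
         (\<exists>u v. linked neighbor (rect a b c d - P) u v \<and> snd u = c \<and> snd v = d)"
proof (rule ccontr)
  assume neg: "\<not> ?thesis"
  define R where "R = rect a b c d"
  \<comment> \<open>All sites left of column \<open>a\<close> belong to \<open>U\<close>, which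
    gives \<open>U\<close> a boundary in every row even if column \<open>a\<close> contains no site
    of \<open>P\<close>.\<close>
  define U where "U p \<longleftrightarrow> fst p < a \<or> (\<exists>u. linked star (P \<inter> R) u p \<and> fst u = a)" for p
  \<comment> \<open>Adjacency to \<open>U\<close> is taken in the sense of \<open>star\<close>, so
    that all outer sites of a unit square that meets \<open>U\<close> lie in \<open>V\<close>,
    including the one diagonally opposite.\<close>
  define V where "V = {v \<in> R. \<not> U v \<and> (\<exists>u. U u \<and> c \<le> snd u \<and> snd u \<le> d \<and> star u v)}"
  define W where "W p \<longleftrightarrow> (\<exists>u. linked neighbor V p u \<and> snd u = d)" for p
  have Ub: "\<not> U p" if "fst p \<ge> b" for p
  proof
    assume "U p"
    moreover have "\<not> fst p < a" using that \<open>a \<le> b\<close> by simp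
    ultimately obtain u where u: "linked star (P \<inter> R) u p" "fst u = a"
      unfolding U_def by blast
    then have "p \<in> R" using linked_end by blast
    then have "fst p = b" using that by (auto simp: R_def)
    then show False using u neg unfolding R_def by blast
  qed
  have U_step: "U q" if "U p" "star p q" "q \<in> P" "q \<in> R" "c \<le> snd p" "snd p \<le> d" for p q
  proof (cases "fst p < a")
    case True
    then have "fst q = a" using that by (auto simp: star_def R_def)
    moreover have "linked star (P \<inter> R) q q" using that by (intro linked_refl) auto
    ultimately show ?thesis unfolding U_def by blast
  next
    case False
    then obtain u where "linked star (P \<inter> R) u p" "fst u = a"
      using \<open>U p\<close> unfolding U_def by blast
    then show ?thesis using that unfolding U_def by (blast intro: linked_step)
  qed
  have VP: "V \<subseteq> R - P"
    using U_step by (auto simp: V_def)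
  have W_top: "W p" if "p \<in> V" "snd p = d" for p
    using that unfolding W_def by (blast intro: linked_refl)
  have W_bot: "\<not> W p" if "snd p = c" for p
  proof
    assume "W p"
    then obtain u where u: "linked neighbor V p u" "snd u = d" by (auto simp: W_def)
    then have "linked neighbor (R - P) p u" by (intro linked_mono[OF u(1) VP]) auto
    then show False using neg that u unfolding R_def by blast
  qed
  have W_nb: "W p \<longleftrightarrow> W q" if "p \<in> V" "q \<in> V" "neighbor p q" for p q
  proof -
    have "linked neighbor V p q" "linked neighbor V q p"
      using that neighbor_sym by (blast intro: linked_step linked_refl)+
    then show ?thesis unfolding W_def by (blast intro: linked_trans)
  qed
  have V_I: "q \<in> V" if "U p" "\<not> U q" "star p q" "c \<le> snd p" "snd p \<le> d" "c \<le> snd q" "snd q \<le> d" for p q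
  proof -
    have "fst p < b" using Ub[of p] that(1) by (cases "fst p < b") auto
    moreover have "a \<le> fst q" using that by (auto simp: U_def)
    ultimately have "q \<in> R" using that by (auto simp: R_def star_def)
    then show ?thesis using that unfolding V_def by blast
  qed
  define h where "h y = (\<Sum>x\<in>{a-1..<b}. cut U W (x, y) (x+1, y))" for y
  have step_even: "even (h y + h (y + 1))" if y: "c \<le> y" "y < d" for y
  proof -
    have "even (cut U W (x,y) (x+1,y) + cut U W (x+1,y) (x+1,y+1) + cut U W (x+1,y+1) (x,y+1)
        + cut U W (x,y+1) (x,y))" for x
    proof (rule even_cut_square)
      fix p q assume pq: "{p, q} \<subseteq> {(x,y), (x+1,y), (x+1,y+1), (x,y+1)}" "neighbor p q" "\<not> U p" "\<not> U q"
        "U (x,y) \<or> U (x+1,y) \<or> U (x+1,y+1) \<or> U (x,y+1)"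
      then obtain r where r: "U r" "r \<in> {(x,y), (x+1,y), (x+1,y+1), (x,y+1)}" by auto
      have "p \<in> V" "q \<in> V"
        by (rule V_I[OF r(1)]; use pq r y in \<open>auto simp: star_def\<close>)+
      then show "W p \<longleftrightarrow> W q" using W_nb pq by blast
    qed (auto simp: neighbor_iff')
    then have "even (\<Sum>x\<in>{a-1..<b}. cut U W (x,y) (x+1,y) + cut U W (x+1,y) (x+1,y+1)
        + cut U W (x+1,y+1) (x,y+1) + cut U W (x,y+1) (x,y))"
      by (intro dvd_sum) auto
    also have "(\<Sum>x\<in>{a-1..<b}. cut U W (x,y) (x+1,y) + cut U W (x+1,y) (x+1,y+1)
        + cut U W (x+1,y+1) (x,y+1) + cut U W (x,y+1) (x,y)) =
        h y + h (y+1) + (\<Sum>x\<in>{a-1..<b}. cut U W (x,y) (x,y+1) + cut U W (x+1,y) (x+1,y+1))"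
      unfolding h_def sum.distrib[symmetric]
    proof (intro sum.cong refl)
      fix x
      show "cut U W (x,y) (x+1,y) + cut U W (x+1,y) (x+1,y+1) + cut U W (x+1,y+1) (x,y+1)
          + cut U W (x,y+1) (x,y) = cut U W (x,y) (x+1,y) + cut U W (x,y+1) (x+1,y+1)
          + (cut U W (x,y) (x,y+1) + cut U W (x+1,y) (x+1,y+1))"
        using cut_sym[of U W "(x+1,y+1)" "(x,y+1)"] cut_sym[of U W "(x,y+1)" "(x,y)"] by simp
    qed
    finally have *: "even (h y + h (y+1) + (\<Sum>x\<in>{a-1..<b}. cut U W (x,y) (x,y+1) + cut U W (x+1,y) (x+1,y+1)))" .
    \<comment> \<open>The vertical edges cancel in pairs modulo two, except in column
      \<open>a - 1\<close>, which is inside \<open>U\<close>, and in column \<open>b\<close>, which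
      is outside; no edge is cut in either.\<close>
    have "U (a-1,y)" "U (a-1,y+1)" by (auto simp: U_def)
    moreover have "\<not> U (b,y)" "\<not> U (b,y+1)" using Ub by auto
    ultimately have "even (cut U W (a-1,y) (a-1,y+1) + cut U W (b,y) (b,y+1))"
      by (auto simp: cut_def)
    then have "even (\<Sum>x\<in>{a-1..<b}. cut U W (x,y) (x,y+1) + cut U W (x+1,y) (x+1,y+1))"
      using even_telescope[of "a-1" b "\<lambda>x. cut U W (x,y) (x,y+1)"] \<open>a \<le> b\<close> by simp
    then show ?thesis using * by simp
  qed
  have rows: "even (h c) \<longleftrightarrow> even (h y)" if "c \<le> y" "y \<le> d" for y
    using that
  proof (induction y rule: int_ge_induct)
    case (step i)
    then show ?case using step_even[of i] by simp
  qed simp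
  \<comment> \<open>In the top row every outer boundary site is in \<open>W\<close>, so
    \<open>h d\<close> counts all changes along a row that starts inside \<open>U\<close> and ends
    outside.\<close>
  have "h d = (\<Sum>x\<in>{a-1..<b}. of_bool (U (x, d) \<noteq> U (x+1, d)))"
    unfolding h_def
  proof (intro sum.cong refl)
    fix x
    have "W (x+1, d)" if "U (x, d)" "\<not> U (x+1, d)"
      by (rule W_top[OF V_I[OF that]]) (use \<open>c \<le> d\<close> in \<open>auto simp: star_def\<close>)
    moreover have "W (x, d)" if "U (x+1, d)" "\<not> U (x, d)"
      by (rule W_top[OF V_I[OF that]]) (use \<open>c \<le> d\<close> in \<open>auto simp: star_def\<close>)
    ultimately show "cut U W (x, d) (x+1, d) = of_bool (U (x, d) \<noteq> U (x+1, d))"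
      by (auto simp: cut_def)
  qed
  then have "odd (h d)"
    using even_changes[of "a-1" b "\<lambda>x. U (x, d)"] Ub[of "(b, d)"] \<open>a \<le> b\<close> by (simp add: U_def)
  moreover have "h c = 0"
    unfolding h_def by (intro sum.neutral) (use W_bot in \<open>auto simp: cut_def\<close>)
  ultimately show False using rows[of d] \<open>c \<le> d\<close> by simp
qed

section \<open>Russo-Seymour-Welsh\<close>

definition local_event :: "(site set \<Rightarrow> bool) \<Rightarrow> bool" where
  "local_event Q \<longleftrightarrow> (\<exists>B. finite B \<and> (\<forall>S. Q S \<longleftrightarrow> Q (S \<inter> B)))"

definition increasing_event :: "(site set \<Rightarrow> bool) \<Rightarrow> bool" where
  "increasing_event Q \<longleftrightarrow> (\<forall>S T. S \<subseteq> T \<longrightarrow> Q S \<longrightarrow> Q T)"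

definition cross :: "site set \<Rightarrow> site set \<Rightarrow> site set \<Rightarrow> site set \<Rightarrow> bool" where
  "cross R A C S \<longleftrightarrow> (\<exists>u\<in>A. \<exists>v\<in>C. linked star (S \<inter> R) u v)"

abbreviation "LR a b c d \<equiv> cross (rect a b c d) (rect a a c d) (rect b b c d)"
abbreviation "TB a b c d \<equiv> cross (rect a b c d) (rect a b c c) (rect a b d d)"

lemma local_event_conj:
  assumes "local_event Q" "local_event Q'"
  shows "local_event (\<lambda>S. Q S \<and> Q' S)"
proof -
  obtain B B' where B: "finite B" "\<And>S. Q S \<longleftrightarrow> Q (S \<inter> B)" "finite B'" "\<And>S. Q' S \<longleftrightarrow> Q' (S \<inter> B')"
    using assms unfolding local_event_def by metis
  have "Q S \<longleftrightarrow> Q (S \<inter> (B \<union> B'))" "Q' S \<longleftrightarrow> Q' (S \<inter> (B \<union> B'))" for S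
    using B(2)[of S] B(2)[of "S \<inter> (B \<union> B')"] B(4)[of S] B(4)[of "S \<inter> (B \<union> B')"]
    by (simp_all add: Int_assoc Int_absorb1)
  then show ?thesis
    unfolding local_event_def using B(1,3) by (intro exI[of _ "B \<union> B'"]) auto
qed

lemma local_event_True: "local_event (\<lambda>S. True)"
  unfolding local_event_def by (intro exI[of _ "{}"]) auto

lemma increasing_event_conj: "increasing_event Q \<Longrightarrow> increasing_event Q' \<Longrightarrow> increasing_event (\<lambda>S. Q S \<and> Q' S)"
  unfolding increasing_event_def by blast

lemma local_event_compl: 
  assumes "local_event Q"
  shows "local_event (\<lambda>S. Q (- S))"
proof -
  obtain B where B: "finite B" "\<And>S. Q S \<longleftrightarrow> Q (S \<inter> B)"
    using assms unfolding local_event_def by metis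
  have "- (S \<inter> B) \<inter> B = - S \<inter> B" for S by auto
  then have "Q (- S) \<longleftrightarrow> Q (- (S \<inter> B))" for S
    using B(2)[of "- S"] B(2)[of "- (S \<inter> B)"] by simp
  then show ?thesis using B(1) unfolding local_event_def by blast
qed

lemma local_event_Ball:
  assumes "finite I" "\<And>i. i \<in> I \<Longrightarrow> local_event (Q i)"
  shows "local_event (\<lambda>S. \<forall>i\<in>I. Q i S)"
  using assms by (induction I) (auto intro: local_event_conj local_event_True)

lemma local_event_cross [simp]: "finite R \<Longrightarrow> local_event (cross R A C)"
  unfolding local_event_def cross_def by (intro exI[of _ R]) auto

lemma increasing_event_cross [simp]: "increasing_event (cross R A C)"
  unfolding increasing_event_def cross_def by (blast intro: linked_subset)

lemma cross_mono: "cross R A C S \<Longrightarrow> R \<subseteq> R' \<Longrightarrow> A \<subseteq> A' \<Longrightarrow> C \<subseteq> C' \<Longrightarrow> cross R' A' C' S"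
  unfolding cross_def by (blast intro: linked_subset)

lemma cross_vimage:
  assumes "bij T" "\<And>x y. star (T x) (T y) \<longleftrightarrow> star x y"
  shows "cross R A C (T -` S) \<longleftrightarrow> cross (T ` R) (T ` A) (T ` C) S"
proof -
  have *: "linked star (T -` S \<inter> R) u v \<longleftrightarrow> linked star (S \<inter> T ` R) (T u) (T v)" for u v
  proof
    assume "linked star (T -` S \<inter> R) u v"
    then have "linked star (T ` (T -` S \<inter> R)) (T u) (T v)"
      by (rule linked_image) (simp add: assms)
    then show "linked star (S \<inter> T ` R) (T u) (T v)"
      by (rule linked_mono) auto
  next
    assume "linked star (S \<inter> T ` R) (T u) (T v)"
    then have "linked star (inv T ` (S \<inter> T ` R)) (inv T (T u)) (inv T (T v))"
      by (rule linked_image) (metis assms bij_inv_eq_iff)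
    moreover have "inv T ` (S \<inter> T ` R) \<subseteq> T -` S \<inter> R"
      using assms(1) by (auto simp: bij_is_inj)
    ultimately show "linked star (T -` S \<inter> R) u v"
      using assms(1) by (auto simp: bij_is_inj intro: linked_mono)
  qed
  show ?thesis unfolding cross_def * by blast
qed

section \<open>Joining crossings\<close>

lemma meet_linked:
  assumes "\<exists>x\<in>{w. linked star S u w}. \<exists>y\<in>{w. linked star S p w}. star x y"
  shows "linked star S u p"
proof -
  obtain x y where xy: "linked star S u x" "linked star S p y" "star x y" using assms by auto
  have "linked star S u y" using xy linked_end by (blast intro: linked_step)
  then show ?thesis using xy(2) linked_star_sym linked_trans by blast
qed

text \<open>The two crossings are first replaced by the components of \<open>u\<close> and
  \<open>p\<close>, so that the adjacent sites delivered by planarity are themselves connected to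
  \<open>u\<close> and \<open>p\<close>.\<close>

lemma LR_TB_linked:
  assumes "linked star S u v" "S \<subseteq> rect a b c d" "fst u = a" "fst v = b"
    and "linked star S' p q" "S' \<subseteq> rect a b c d" "snd p = c" "snd q = d"
    and "S \<subseteq> Z" "S' \<subseteq> Z"
  shows "linked star Z u p"
proof -
  have 1: "{w. linked star S u w} \<subseteq> rect a b c d" "{w. linked star S' p w} \<subseteq> rect a b c d"
    using assms(2,6) linked_end by blast+
  have "\<exists>x\<in>{w. linked star S u w}. \<exists>y\<in>{w. linked star S' p w}. star x y"
    by (rule star_LR_TB_meet[OF linked_component[OF assms(1)] 1(1) assms(3,4)
          linked_component[OF assms(5)] 1(2) assms(7,8)])
  then obtain x y where "linked star S u x" "linked star S' p y" "star x y" by auto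
  then show ?thesis
    using linked_mono[of star S u x Z star] linked_mono[of star S' p y Z star] assms(9,10)
    by (intro meet_linked) blast
qed

lemma sandwich_linked:
  assumes S: "linked star S u v" "S \<subseteq> rect (a + 1) b c d" "fst u = b" "fst v = b"
    and T: "linked star T p q" "T \<subseteq> rect a b c d" "fst p = b" "fst q = a"
    and le: "snd u \<le> snd p" "snd p \<le> snd v"
    and Z: "S \<subseteq> Z" "T \<subseteq> Z"
  shows "linked star Z u p"
proof -
  have 1: "{w. linked star S u w} \<subseteq> rect (a+1) b c d" "{w. linked star T p w} \<subseteq> rect a b c d"
    using S(2) T(2) linked_end by blast+
  have "\<exists>x\<in>{w. linked star S u w}. \<exists>y\<in>{w. linked star T p w}. star x y"
    by (rule star_sandwich_meet[OF linked_component[OF S(1)] 1(1) S(3,4)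
          linked_component[OF T(1)] 1(2) T(3,4) le])
  then obtain x y where "linked star S u x" "linked star T p y" "star x y" by auto
  then show ?thesis
    using linked_mono[of star S u x Z star] linked_mono[of star T p y Z star] Z
    by (intro meet_linked) blast
qed

lemma sandwich_linked_left:
  assumes S: "linked star S u v" "S \<subseteq> rect a (b - 1) c d" "fst u = a" "fst v = a"
    and T: "linked star T p q" "T \<subseteq> rect a b c d" "fst p = a" "fst q = b"
    and le: "snd u \<le> snd p" "snd p \<le> snd v"
    and Z: "S \<subseteq> Z" "T \<subseteq> Z"
  shows "linked star Z u p"
proof -
  define F :: "site \<Rightarrow> site" where "F = (\<lambda>p. (- fst p, snd p))"
  have F: "star x y \<Longrightarrow> star (F x) (F y)" for x y by (auto simp: F_def star_def)
  have FF: "F (F x) = x" for x by (simp add: F_def)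
  have "linked star (F ` Z) (F u) (F p)"
    by (rule sandwich_linked[OF linked_image[where T = F and r' = star, OF S(1) F] _ _ _
          linked_image[where T = F and r' = star, OF T(1) F], of "-b" "-a" c d])
      (use S(2-) T(2-) le Z in \<open>auto simp: F_def image_subset_iff\<close>)
  then have "linked star (F ` F ` Z) (F (F u)) (F (F p))"
    by (rule linked_image) (rule F)
  then show ?thesis by (simp add: FF image_image)
qed

definition box :: "int \<Rightarrow> int \<Rightarrow> int \<Rightarrow> site set" where
  "box p q m = rect (p - m) (p + m) (q - m) (q + m)"

text \<open>A top-bottom crossing of a box meets every left-right crossing, so it connects the ends of
  the four crossings below.\<close>

lemma corners_linked:
  assumes "cross (box p q m) (rect (p-m) (p-m) (q-m) (q+m)) (rect (p+m) (p+m) (q+\<alpha>) (q+m)) S"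
    and "cross (box p q m) (rect (p-m) (p-m) (q-m) (q+m)) (rect (p+m) (p+m) (q-m) (q-\<alpha>)) S"
    and "cross (box p q m) (rect (p+m) (p+m) (q-m) (q+m)) (rect (p-m) (p-m) (q+\<alpha>) (q+m)) S"
    and "cross (box p q m) (rect (p+m) (p+m) (q-m) (q+m)) (rect (p-m) (p-m) (q-m) (q-\<alpha>)) S"
    and "TB (p-m) (p+m) (q-m) (q+m) S"
  obtains v1 v2 v3 v4 where
    "fst v1 = p + m" "snd v1 \<ge> q + \<alpha>" "fst v2 = p + m" "snd v2 \<le> q - \<alpha>"
    "fst v3 = p - m" "snd v3 \<ge> q + \<alpha>" "fst v4 = p - m" "snd v4 \<le> q - \<alpha>"
    "linked star (S \<inter> box p q m) v2 v1" "linked star (S \<inter> box p q m) v4 v3"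
    "linked star (S \<inter> box p q m) v2 v4"
proof -
  let ?Z = "S \<inter> box p q m"
  obtain s t where st: "linked star ?Z s t" "snd s = q - m" "snd t = q + m"
    using assms(5) unfolding cross_def box_def by auto
  have LR: "linked star ?Z x s" if "linked star ?Z x y" "fst x = p - m" "fst y = p + m" for x y
    by (rule LR_TB_linked[OF that(1) _ that(2,3) st(1) _ st(2,3)]) (auto simp: box_def)
  have s: "linked star ?Z y s" if "linked star ?Z x y" "fst x = p - m \<and> fst y = p + m \<or> fst x = p + m \<and> fst y = p - m" for x y
    using that LR linked_trans linked_star_sym by metis
  obtain u1 v1 where 1: "linked star ?Z u1 v1" "fst u1 = p - m" "fst v1 = p + m" "snd v1 \<ge> q + \<alpha>"
    using assms(1) unfolding cross_def by auto
  obtain u2 v2 where 2: "linked star ?Z u2 v2" "fst u2 = p - m" "fst v2 = p + m" "snd v2 \<le> q - \<alpha>"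
    using assms(2) unfolding cross_def by auto
  obtain u3 v3 where 3: "linked star ?Z u3 v3" "fst u3 = p + m" "fst v3 = p - m" "snd v3 \<ge> q + \<alpha>"
    using assms(3) unfolding cross_def by auto
  obtain u4 v4 where 4: "linked star ?Z u4 v4" "fst u4 = p + m" "fst v4 = p - m" "snd v4 \<le> q - \<alpha>"
    using assms(4) unfolding cross_def by auto
  have "linked star ?Z v1 s" "linked star ?Z v2 s" "linked star ?Z v3 s" "linked star ?Z v4 s"
    using s[OF 1(1)] s[OF 2(1)] s[OF 3(1)] s[OF 4(1)] 1 2 3 4 by auto
  then have "linked star ?Z v2 v1" "linked star ?Z v4 v3" "linked star ?Z v2 v4"
    by (meson linked_trans linked_star_sym)+
  then show ?thesis using that 1 2 3 4 by blast
qed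

text \<open>The crossing of the left box ends between the two right corners of the small box, and so runs
  into the cluster that connects these corners; likewise on the other side.\<close>

lemma long_crossing:
  fixes n m \<alpha> :: int
  defines "p \<equiv> n - m"
  assumes nm: "m < n" "n \<le> 2 * m" "0 \<le> \<alpha>" "\<alpha> \<le> m"
    and "cross (box p \<alpha> m) (rect (p-m) (p-m) (\<alpha>-m) (\<alpha>+m)) (rect (p+m) (p+m) (\<alpha>+\<alpha>) (\<alpha>+m)) S"
    and "cross (box p \<alpha> m) (rect (p-m) (p-m) (\<alpha>-m) (\<alpha>+m)) (rect (p+m) (p+m) (\<alpha>-m) (\<alpha>-\<alpha>)) S"
    and "cross (box p \<alpha> m) (rect (p+m) (p+m) (\<alpha>-m) (\<alpha>+m)) (rect (p-m) (p-m) (\<alpha>+\<alpha>) (\<alpha>+m)) S"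
    and "cross (box p \<alpha> m) (rect (p+m) (p+m) (\<alpha>-m) (\<alpha>+m)) (rect (p-m) (p-m) (\<alpha>-m) (\<alpha>-\<alpha>)) S"
    and "TB (p-m) (p+m) (\<alpha>-m) (\<alpha>+m) S"
    and A: "cross (rect (-n) n (-n) n) (rect (-n) (-n) (-n) n) (rect n n 0 (2*\<alpha>)) S"
    and B: "cross (rect (n-2*m) (3*n-2*m) (-n) n) (rect (3*n-2*m) (3*n-2*m) (-n) n) (rect (n-2*m) (n-2*m) 0 (2*\<alpha>)) S"
  shows "LR (-n) (3*n-2*m) (-n) (2*m) S"
proof -
  let ?R = "rect (-n) (3*n-2*m) (-n) (2*m)"
  obtain v1 v2 v3 v4 where v: "fst v1 = p + m" "snd v1 \<ge> \<alpha> + \<alpha>" "fst v2 = p + m" "snd v2 \<le> \<alpha> - \<alpha>"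
    "fst v3 = p - m" "snd v3 \<ge> \<alpha> + \<alpha>" "fst v4 = p - m" "snd v4 \<le> \<alpha> - \<alpha>"
    "linked star (S \<inter> box p \<alpha> m) v2 v1" "linked star (S \<inter> box p \<alpha> m) v4 v3"
    "linked star (S \<inter> box p \<alpha> m) v2 v4"
    using corners_linked[OF assms(6-10)] by metis
  \<comment> \<open>The right side of the small box lies on the right side of the left large box,
    and its left side on the left side of the right large box. The targets between heights
    \<open>0\<close> and \<open>2 * \<alpha>\<close> lie between the corner sites \<open>v2\<close>,
    \<open>v1\<close> and \<open>v4\<close>, \<open>v3\<close>.\<close>
  have bR: "box p \<alpha> m \<subseteq> rect (n-2*m) n (-n) (2*m)"
    using nm by (auto simp: box_def p_def)
  obtain a1 a2 where a: "linked star (S \<inter> rect (-n) n (-n) n) a1 a2" "fst a1 = -n" "-n \<le> snd a1" "snd a1 \<le> n" "fst a2 = n"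
     "0 \<le> snd a2" "snd a2 \<le> 2*\<alpha>"
    using A unfolding cross_def by auto
  obtain b1 b2 where b: "linked star (S \<inter> rect (n-2*m) (3*n-2*m) (-n) n) b1 b2" "fst b1 = 3*n-2*m" "-n \<le> snd b1" "snd b1 \<le> n" "fst b2 = n-2*m"
     "0 \<le> snd b2" "snd b2 \<le> 2*\<alpha>"
    using B unfolding cross_def by auto
  have "linked star (S \<inter> ?R) v2 a2"
    by (rule sandwich_linked[OF v(9) _ _ _ linked_star_sym[OF a(1)], of "-n" n "-n" "2*m"])
      (use nm v a bR in \<open>auto simp: p_def\<close>)
  moreover have "linked star (S \<inter> ?R) v4 b2"
    by (rule sandwich_linked_left[OF v(10) _ _ _ linked_star_sym[OF b(1)], of "n-2*m" "3*n-2*m" "-n" "2*m"])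
      (use nm v b bR in \<open>auto simp: p_def\<close>)
  moreover have "linked star (S \<inter> ?R) v2 v4"
    by (rule linked_mono[OF v(11)]) (use nm bR in auto)
  moreover have "linked star (S \<inter> ?R) a1 a2"
    by (rule linked_mono[OF a(1)]) (use nm in auto)
  moreover have "linked star (S \<inter> ?R) b2 b1"
    by (rule linked_mono[OF linked_star_sym[OF b(1)]]) (use nm in auto)
  ultimately have "linked star (S \<inter> ?R) a1 b1"
    by (meson linked_trans linked_star_sym)
  then show ?thesis unfolding cross_def
    using a b nm by (intro bexI[of _ a1] bexI[of _ b1]) auto
qed

text \<open>The vertical crossing of the square with columns from \<open>L - h\<close> to
  \<open>L\<close>, in which the two rectangles overlap, meets both horizontal crossings and joins
  them.\<close>

lemma extend_crossing:
  assumes "h \<ge> 0" "L \<ge> h" "W \<ge> h" "LR 0 L 0 h S" "TB (L-h) L 0 h S" "LR (L-h) (L-h+W) 0 h S"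
  shows "LR 0 (L-h+W) 0 h S"
proof -
  let ?R = "S \<inter> rect 0 (L-h+W) 0 h"
  obtain a b where a: "linked star (S \<inter> rect 0 L 0 h) a b" "fst a = 0" "fst b = L" "0 \<le> snd a" "snd a \<le> h"
    using assms(4) by (auto simp: cross_def)
  obtain s t where s: "linked star (S \<inter> rect (L-h) L 0 h) s t" "snd s = 0" "snd t = h"
    using assms(5) by (auto simp: cross_def)
  obtain c d where c: "linked star (S \<inter> rect (L-h) (L-h+W) 0 h) c d" "fst c = L-h" "fst d = L-h+W" "0 \<le> snd d" "snd d \<le> h"
    using assms(6) by (auto simp: cross_def)
  have "linked star ?R a s"
    by (rule LR_TB_linked[OF a(1) _ a(2,3) s(1) _ s(2,3)]) (use assms(1-3) in auto)
  moreover have "linked star ?R c s"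
    by (rule LR_TB_linked[OF c(1) _ c(2,3) s(1) _ s(2,3)]) (use assms(1-3) in auto)
  moreover have "linked star ?R c d"
    by (rule linked_mono[OF c(1)]) (use assms(1-3) in auto)
  ultimately have "linked star ?R a d"
    by (meson linked_trans linked_star_sym)
  then show ?thesis unfolding cross_def
    using a c assms(1-3) by (intro bexI[of _ a] bexI[of _ d]) auto
qed

text \<open>The path is stopped just before its first step out of \<open>D\<close>. The set
  \<open>F\<close> collects the sites where this can happen, and contains the end \<open>y\<close>
  in case the path never leaves.\<close>

lemma linked_exit:
  assumes "linked r T x y" "x \<in> D" "y \<in> D \<Longrightarrow> y \<in> F"
    and "\<And>v w. v \<in> T \<Longrightarrow> w \<in> T \<Longrightarrow> r v w \<Longrightarrow> v \<in> D \<Longrightarrow> w \<notin> D \<Longrightarrow> v \<in> F"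
  shows "\<exists>z\<in>F. linked r (T \<inter> D) x z"
proof -
  have "linked r (T \<inter> D) x y \<or> (\<exists>z\<in>F. linked r (T \<inter> D) x z)"
    using assms(1)
  proof (induction rule: linked_induct)
    case (step v w)
    show ?case
    proof (cases "\<exists>z\<in>F. linked r (T \<inter> D) x z")
      case False
      then have v: "linked r (T \<inter> D) x v" using step by blast
      then have "v \<in> D" using linked_end by blast
      then have "w \<in> D" using assms(4)[OF step.hyps(2,3,4)] False v by blast
      then show ?thesis using v step by (blast intro: linked_step)
    qed auto
  qed (use assms in \<open>auto intro: linked_refl\<close>)
  then show ?thesis using assms(3) linked_end by blast
qed

text \<open>Read backwards from the right side, the minus path passes from column
  \<open>2 * h\<close> to column \<open>h\<close> before it gets back to \<open>x\<close>, and on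
  this stretch it would share a site with the crossing of plus spins.\<close>

lemma no_short_crossing:
  assumes "linked neighbor (- S \<inter> rect (-2*h) (2*h) (-2*h) (2*h)) x z"
    and "\<bar>fst x\<bar> \<le> h" "fst z = 2 * h" "h > 0"
  shows "\<not> TB h (2*h) (-2*h) (2*h) S"
proof
  assume "TB h (2*h) (-2*h) (2*h) S"
  then obtain s t where s: "linked star (S \<inter> rect h (2*h) (-2*h) (2*h)) s t" "snd s = -2*h" "snd t = 2*h"
    by (auto simp: cross_def)
  let ?B = "rect (-2*h) (2*h) (-2*h) (2*h)" and ?D = "rect h (2*h) (-2*h) (2*h)"
  have zx: "linked neighbor (- S \<inter> ?B) z x"
    by (rule linked_sym[OF _ assms(1)]) (simp add: neighbor_sym)
  have "z \<in> ?B" using linked_start[OF zx] by blast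
  then have "\<exists>w\<in>{w. fst w = h}. linked neighbor (- S \<inter> ?B \<inter> ?D) z w"
    by (intro linked_exit[OF zx]) (use assms in \<open>auto simp: neighbor_iff'\<close>)
  then obtain w where w: "fst w = h" "linked neighbor (- S \<inter> ?B \<inter> ?D) z w" by auto
  have wz: "linked neighbor (- S \<inter> ?B \<inter> ?D) w z"
    by (rule linked_sym[OF _ w(2)]) (simp add: neighbor_sym)
  have "(- S \<inter> ?B \<inter> ?D) \<inter> (S \<inter> ?D) \<noteq> {}"
    by (rule neighbor_LR_star_TB_meet[OF wz _ w(1) assms(3) s(1) _ s(2,3)]) auto
  then show False by auto
qed

section \<open>Lattice symmetries and confinement\<close>

lemma rect_images:
  "(\<lambda>(x,y). (x + p, y + q)) ` rect a b c d = rect (a+p) (b+p) (c+q) (d+q)"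
  "(\<lambda>(x,y). (- x, y)) ` rect a b c d = rect (-b) (-a) c d"
  "(\<lambda>(x,y). (x, - y)) ` rect a b c d = rect a b (-d) (-c)"
  "(\<lambda>(x,y). (y, x)) ` rect a b c d = rect c d a b"
proof -
  show "(\<lambda>(x,y). (x + p, y + q)) ` rect a b c d = rect (a+p) (b+p) (c+q) (d+q)"
  proof (intro equalityI subsetI)
    fix z assume "z \<in> rect (a+p) (b+p) (c+q) (d+q)"
    then show "z \<in> (\<lambda>(x,y). (x + p, y + q)) ` rect a b c d"
      by (intro image_eqI[of _ _ "(fst z - p, snd z - q)"]) auto
  qed auto
  show "(\<lambda>(x,y). (- x, y)) ` rect a b c d = rect (-b) (-a) c d"
  proof (intro equalityI subsetI)
    fix z assume "z \<in> rect (-b) (-a) c d"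
    then show "z \<in> (\<lambda>(x,y). (- x, y)) ` rect a b c d"
      by (intro image_eqI[of _ _ "(- fst z, snd z)"]) auto
  qed auto
  show "(\<lambda>(x,y). (x, - y)) ` rect a b c d = rect a b (-d) (-c)"
  proof (intro equalityI subsetI)
    fix z assume "z \<in> rect a b (-d) (-c)"
    then show "z \<in> (\<lambda>(x,y). (x, - y)) ` rect a b c d"
      by (intro image_eqI[of _ _ "(fst z, - snd z)"]) auto
  qed auto
  show "(\<lambda>(x,y). (y, x)) ` rect a b c d = rect c d a b"
    by (auto simp: rect_def)
qed

definition automorphism :: "(site \<Rightarrow> site) \<Rightarrow> bool" where
  "automorphism T \<longleftrightarrow> bij T \<and> (\<forall>x y. neighbor (T x) (T y) \<longleftrightarrow> neighbor x y)"

lemma automorphisms: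
  "automorphism (\<lambda>(x,y). (x + p, y + q))" "automorphism (\<lambda>(x,y). (- x, y))"
  "automorphism (\<lambda>(x,y). (x, - y))" "automorphism (\<lambda>(x,y). (y, x))"
proof -
  have "bij (\<lambda>(x::int,y::int). (x + p, y + q))"
    by (rule o_bij[of "\<lambda>(x,y). (x - p, y - q)"]) auto
  then show "automorphism (\<lambda>(x,y). (x + p, y + q))"
    by (auto simp: automorphism_def neighbor_iff')
  have "bij (\<lambda>(x::int,y::int). (- x, y))"
    by (rule o_bij[of "\<lambda>(x,y). (- x, y)"]) auto
  then show "automorphism (\<lambda>(x,y). (- x, y))"
    by (auto simp: automorphism_def neighbor_iff')
  have "bij (\<lambda>(x::int,y::int). (x, - y))"
    by (rule o_bij[of "\<lambda>(x,y). (x, - y)"]) auto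
  then show "automorphism (\<lambda>(x,y). (x, - y))"
    by (auto simp: automorphism_def neighbor_iff')
  have "bij (\<lambda>(x::int,y::int). (y, x))"
    by (rule o_bij[of "\<lambda>(x,y). (y, x)"]) auto
  then show "automorphism (\<lambda>(x,y). (y, x))"
    by (auto simp: automorphism_def neighbor_iff')
qed

lemma automorphisms_star:
  "star ((\<lambda>(x,y). (x + p, y + q)) v) ((\<lambda>(x,y). (x + p, y + q)) w) \<longleftrightarrow> star v w"
  "star ((\<lambda>(x,y). (- x, y)) v) ((\<lambda>(x,y). (- x, y)) w) \<longleftrightarrow> star v w"
  "star ((\<lambda>(x,y). (x, - y)) v) ((\<lambda>(x,y). (x, - y)) w) \<longleftrightarrow> star v w"
  "star ((\<lambda>(x,y). (y, x)) v) ((\<lambda>(x,y). (y, x)) w) \<longleftrightarrow> star v w"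
  by (cases v; cases w; simp add: star_def abs_le_iff conj_ac)+

text \<open>A minus path that leaves the outer box reaches one of its four sides first. A symmetry
  of the square carries this side to the right side, where the crossing of the right strip stops the
  path.\<close>

lemma confined:
  assumes "linked neighbor (- S) x y" "\<bar>fst x\<bar> \<le> h" "\<bar>snd x\<bar> \<le> h" "h > 0"
    and "TB h (2*h) (-2*h) (2*h) S" "TB (-2*h) (-h) (-2*h) (2*h) S"
    and "LR (-2*h) (2*h) h (2*h) S" "LR (-2*h) (2*h) (-2*h) (-h) S"
  shows "y \<in> rect (-2*h) (2*h) (-2*h) (2*h)"
proof (rule ccontr)
  let ?B = "rect (-2*h) (2*h) (-2*h) (2*h)"
  assume "y \<notin> ?B"
  then have "\<exists>z\<in>{z. \<bar>fst z\<bar> = 2 * h \<or> \<bar>snd z\<bar> = 2 * h}. linked neighbor (- S \<inter> ?B) x z"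
    by (intro linked_exit[OF assms(1)]) (use assms(2-4) in \<open>auto simp: neighbor_iff'\<close>)
  then obtain z where z: "linked neighbor (- S \<inter> ?B) x z" "\<bar>fst z\<bar> = 2 * h \<or> \<bar>snd z\<bar> = 2 * h"
    by blast
  have False if T: "bij T" "\<And>v w. neighbor (T v) (T w) \<longleftrightarrow> neighbor v w" "\<And>v w. star (T v) (T w) \<longleftrightarrow> star v w"
      "T ` ?B = ?B" "\<bar>fst (T x)\<bar> \<le> h" "fst (T z) = 2 * h"
      "cross (T -` rect h (2*h) (-2*h) (2*h)) (T -` rect h (2*h) (-2*h) (-2*h)) (T -` rect h (2*h) (2*h) (2*h)) S" for T
  proof -
    have img: "T ` (T -` A) = A" for A using T(1) by (simp add: bij_is_surj surj_image_vimage_eq)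
    have "linked neighbor (T ` (- S \<inter> ?B)) (T x) (T z)"
      by (rule linked_image[OF z(1)]) (use T in auto)
    then have "linked neighbor (- (T ` S) \<inter> ?B) (T x) (T z)"
      by (rule linked_mono) (use T(1,4) in \<open>auto simp: bij_image_Compl_eq dest: bij_is_inj[THEN injD]\<close>)
    then have "\<not> TB h (2*h) (-2*h) (2*h) (T ` S)"
      by (rule no_short_crossing) (use T assms in auto)
    moreover have "T -` (T ` S) = S" using T(1) by (simp add: bij_is_inj inj_vimage_image_eq)
    ultimately show False
      using cross_vimage[OF T(1,3), of "T -` rect h (2*h) (-2*h) (2*h)" "T -` rect h (2*h) (-2*h) (-2*h)"
          "T -` rect h (2*h) (2*h) (2*h)" "T ` S"] T(7) by (simp add: img bij_is_surj[OF T(1)])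
  qed note * = this
  have bij: "bij (\<lambda>p::site. (- fst p, snd p))" "bij (\<lambda>p::site. (snd p, fst p))" "bij (\<lambda>p::site. (- snd p, fst p))"
    by (rule o_bij[of "\<lambda>p. (- fst p, snd p)"] o_bij[of "\<lambda>p. (snd p, fst p)"] o_bij[of "\<lambda>p. (snd p, - fst p)"];
        force)+
  have img: "T ` A = A" if "bij T" "T -` A = A" for T :: "site \<Rightarrow> site" and A
    using that by (metis bij_is_surj surj_image_vimage_eq)
  consider "fst z = 2*h" | "fst z = -2*h" | "snd z = 2*h" | "snd z = -2*h" using z(2) by linarith
  then show False
  proof cases
    case 1
    have "bij (\<lambda>p::site. p)" using bij_id by (simp add: id_def)
    then show ?thesis
      by (rule *[of "\<lambda>p. p"]) (use assms 1 in auto)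
  next
    case 2
    have v: "(\<lambda>p. (- fst p, snd p)) -` rect a b c d = rect (-b) (-a) c d" for a b c d by auto
    show ?thesis
      by (rule *[of "\<lambda>p. (- fst p, snd p)"]) (use assms 2 bij in \<open>auto simp: v neighbor_iff' star_def intro!: img\<close>)
  next
    case 3
    have v: "(\<lambda>p. (snd p, fst p)) -` rect a b c d = rect c d a b" for a b c d by auto
    show ?thesis
      by (rule *[of "\<lambda>p. (snd p, fst p)"]) (use assms 3 bij in \<open>auto simp: v neighbor_iff' star_def intro!: img\<close>)
  next
    case 4
    have v: "(\<lambda>p. (- snd p, fst p)) -` rect a b c d = rect c d (-b) (-a)" for a b c d by auto
    show ?thesis
      by (rule *[of "\<lambda>p. (- snd p, fst p)"]) (use assms 4 bij in \<open>auto simp: v neighbor_iff' star_def intro!: img\<close>)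
  qed
qed


definition blocked :: "int \<Rightarrow> site set \<Rightarrow> bool" where
  "blocked h S \<longleftrightarrow> TB h (2*h) (-2*h) (2*h) S \<and> TB (-2*h) (-h) (-2*h) (2*h) S \<and>
     LR (-2*h) (2*h) h (2*h) S \<and> LR (-2*h) (2*h) (-2*h) (-h) S"

text \<open>Connections inside boxes are local events, so this turns \<open>infinite_at\<close> into
  a countable combination of local events and makes it measurable.\<close>

lemma linked_neighbor_finite_subset:
  assumes "linked neighbor S x y"
  shows "\<exists>n::nat. linked neighbor (S \<inter> rect (- int n) (int n) (- int n) (int n)) x y"
  using assms
proof (induction rule: linked_induct)
  case refl
  then show ?case
    by (intro exI[of _ "nat (\<bar>fst x\<bar> + \<bar>snd x\<bar>)"] linked_refl) auto
next
  case (step v w)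
  then obtain n :: nat where n: "linked neighbor (S \<inter> rect (- int n) (int n) (- int n) (int n)) x v" by auto
  define k where "k = max n (nat (\<bar>fst w\<bar> + \<bar>snd w\<bar>))"
  have "linked neighbor (S \<inter> rect (- int k) (int k) (- int k) (int k)) x v"
    by (rule linked_mono[OF n]) (auto simp: k_def)
  then have "linked neighbor (S \<inter> rect (- int k) (int k) (- int k) (int k)) x w"
    by (rule linked_step) (use step in \<open>auto simp: k_def\<close>)
  then show ?case by blast
qed

lemma infinite_site_set:
  "infinite (A :: site set) \<longleftrightarrow> (\<forall>n::nat. \<exists>y. y \<in> A \<and> y \<notin> rect (- int n) (int n) (- int n) (int n))"
proof
  assume inf: "infinite A"
  show "\<forall>n::nat. \<exists>y. y \<in> A \<and> y \<notin> rect (- int n) (int n) (- int n) (int n)"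
  proof
    fix n :: nat
    have "\<not> A \<subseteq> rect (- int n) (int n) (- int n) (int n)"
      using inf finite_subset[OF _ finite_rect] by blast
    then show "\<exists>y. y \<in> A \<and> y \<notin> rect (- int n) (int n) (- int n) (int n)" by blast
  qed
next
  assume *: "\<forall>n::nat. \<exists>y. y \<in> A \<and> y \<notin> rect (- int n) (int n) (- int n) (int n)"
  show "infinite A"
  proof
    assume fin: "finite A"
    define n where "n = nat (\<Sum>p\<in>A. \<bar>fst p\<bar> + \<bar>snd p\<bar>)"
    have "\<bar>fst p\<bar> + \<bar>snd p\<bar> \<le> int n" if "p \<in> A" for p
      using member_le_sum[OF that, of "\<lambda>p. \<bar>fst p\<bar> + \<bar>snd p\<bar>"] fin
      unfolding n_def by (simp add: sum_nonneg)
    then have "A \<subseteq> rect (- int n) (int n) (- int n) (int n)" by fastforce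
    then show False using * by blast
  qed
qed

section \<open>Crossing probabilities of a symmetric, positively associated random set\<close>

definition infinite_at :: "site set \<Rightarrow> site \<Rightarrow> bool" where
  "infinite_at S x \<longleftrightarrow> infinite {y. linked neighbor S x y}"

text \<open>Abstracted from the process because the argument is applied both to the set of plus
  spins and to its complement. Every hypothesis concerns finitely many sites and is therefore within
  reach of finite approximations.\<close>

locale planar_random_set = prob_space M for M :: "'a measure" +
  fixes X :: "'a \<Rightarrow> site set"
  assumes measurable_site: "{\<omega> \<in> space M. x \<in> X \<omega>} \<in> events"
    and association: "local_event Q \<Longrightarrow> local_event Q' \<Longrightarrow> increasing_event Q \<Longrightarrow> increasing_event Q' \<Longrightarrow>
      prob {\<omega> \<in> space M. Q (X \<omega>)} * prob {\<omega> \<in> space M. Q' (X \<omega>)} \<le> prob {\<omega> \<in> space M. Q (X \<omega>) \<and> Q' (X \<omega>)}"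
    and invariance: "local_event Q \<Longrightarrow> automorphism T \<Longrightarrow>
      prob {\<omega> \<in> space M. Q (T -` X \<omega>)} = prob {\<omega> \<in> space M. Q (X \<omega>)}"
    and flip_invariance: "local_event Q \<Longrightarrow>
      prob {\<omega> \<in> space M. Q (- X \<omega>)} = prob {\<omega> \<in> space M. Q (X \<omega>)}"
begin

definition pr :: "(site set \<Rightarrow> bool) \<Rightarrow> real" where
  "pr Q = prob {\<omega> \<in> space M. Q (X \<omega>)}"

lemma sets_local [measurable]:
  assumes "local_event Q"
  shows "{\<omega> \<in> space M. Q (X \<omega>)} \<in> events"
proof -
  obtain B where B: "finite B" "\<And>S. Q S \<longleftrightarrow> Q (S \<inter> B)"
    using assms unfolding local_event_def by metis
  have "{\<omega> \<in> space M. Q (X \<omega>)} =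
      (\<Union>A\<in>{A. A \<subseteq> B \<and> Q A}. {\<omega> \<in> space M. \<forall>x\<in>B. x \<in> X \<omega> \<longleftrightarrow> x \<in> A})"
  proof (intro equalityI subsetI)
    fix \<omega> assume "\<omega> \<in> {\<omega> \<in> space M. Q (X \<omega>)}"
    then show "\<omega> \<in> (\<Union>A\<in>{A. A \<subseteq> B \<and> Q A}. {\<omega> \<in> space M. \<forall>x\<in>B. x \<in> X \<omega> \<longleftrightarrow> x \<in> A})"
      using B(2)[of "X \<omega>"] by (intro UN_I[of "X \<omega> \<inter> B"]) auto
  next
    fix \<omega> assume "\<omega> \<in> (\<Union>A\<in>{A. A \<subseteq> B \<and> Q A}. {\<omega> \<in> space M. \<forall>x\<in>B. x \<in> X \<omega> \<longleftrightarrow> x \<in> A})"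
    then obtain A where A: "A \<subseteq> B" "Q A" "\<omega> \<in> space M" "\<forall>x\<in>B. x \<in> X \<omega> \<longleftrightarrow> x \<in> A" by auto
    then have "X \<omega> \<inter> B = A" by auto
    then show "\<omega> \<in> {\<omega> \<in> space M. Q (X \<omega>)}" using B(2)[of "X \<omega>"] A by auto
  qed
  also have "\<dots> \<in> events"
  proof (intro sets.finite_UN)
    show "finite {A. A \<subseteq> B \<and> Q A}" using B(1) by simp
    fix A
    have "{\<omega> \<in> space M. x \<in> X \<omega> \<longleftrightarrow> x \<in> A} \<in> events" for x
    proof (cases "x \<in> A")
      case False
      have "{\<omega> \<in> space M. x \<notin> X \<omega>} = space M - {\<omega> \<in> space M. x \<in> X \<omega>}" by auto
      then show ?thesis using False measurable_site[of x] by auto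
    qed (use measurable_site in auto)
    then show "{\<omega> \<in> space M. \<forall>x\<in>B. x \<in> X \<omega> \<longleftrightarrow> x \<in> A} \<in> events"
      using B(1) by (intro sets.sets_Collect_finite_All) auto
  qed
  finally show ?thesis .
qed

lemma pr_mono:
  assumes "local_event Q'" "\<And>S. Q S \<Longrightarrow> Q' S"
  shows "pr Q \<le> pr Q'"
  unfolding pr_def by (rule finite_measure_mono) (use assms sets_local in auto)

lemma pr_or_le:
  assumes "local_event Q" "local_event Q'"
  shows "pr (\<lambda>S. Q S \<or> Q' S) \<le> pr Q + pr Q'"
proof -
  have "{\<omega> \<in> space M. Q (X \<omega>) \<or> Q' (X \<omega>)} = {\<omega> \<in> space M. Q (X \<omega>)} \<union> {\<omega> \<in> space M. Q' (X \<omega>)}" by auto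
  then show ?thesis
    unfolding pr_def using measure_Un_le[OF sets_local sets_local, OF assms] by simp
qed

lemma pr_cross_image:
  assumes "automorphism T" "\<And>x y. star (T x) (T y) \<longleftrightarrow> star x y" "finite R"
  shows "pr (cross (T ` R) (T ` A) (T ` C)) = pr (cross R A C)"
proof -
  have "bij T" using assms(1) by (simp add: automorphism_def)
  then show ?thesis
    using invariance[OF local_event_cross[OF assms(3), of A C] assms(1)] unfolding pr_def
    by (simp add: cross_vimage assms(2))
qed

lemma pr_translate:
  "pr (cross (rect (a+p) (b+p) (c+q) (d+q)) (rect (a'+p) (b'+p) (c'+q) (d'+q)) (rect (a''+p) (b''+p) (c''+q) (d''+q)))
   = pr (cross (rect a b c d) (rect a' b' c' d') (rect a'' b'' c'' d''))"
  using pr_cross_image[OF automorphisms(1) automorphisms_star(1) finite_rect, of p q a b c d "rect a' b' c' d'" "rect a'' b'' c'' d''"]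
  unfolding rect_images .

lemma pr_reflect_x:
  "pr (cross (rect a b c d) (rect a' b' c' d') (rect a'' b'' c'' d'')) =
   pr (cross (rect (-b) (-a) c d) (rect (-b') (-a') c' d') (rect (-b'') (-a'') c'' d''))"
  using pr_cross_image[OF automorphisms(2) automorphisms_star(2) finite_rect, of a b c d "rect a' b' c' d'" "rect a'' b'' c'' d''"]
  unfolding rect_images by simp

lemma pr_reflect_y:
  "pr (cross (rect a b c d) (rect a' b' c' d') (rect a'' b'' c'' d'')) =
   pr (cross (rect a b (-d) (-c)) (rect a' b' (-d') (-c')) (rect a'' b'' (-d'') (-c'')))"
  using pr_cross_image[OF automorphisms(3) automorphisms_star(3) finite_rect, of a b c d "rect a' b' c' d'" "rect a'' b'' c'' d''"]
  unfolding rect_images by simp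

lemma pr_swap:
  "pr (cross (rect c d a b) (rect c' d' a' b') (rect c'' d'' a'' b''))
   = pr (cross (rect a b c d) (rect a' b' c' d') (rect a'' b'' c'' d''))"
  using pr_cross_image[OF automorphisms(4) automorphisms_star(4) finite_rect, of a b c d "rect a' b' c' d'" "rect a'' b'' c'' d''"]
  unfolding rect_images .

lemma pr_TB: "pr (TB a b c d) = pr (LR c d a b)"
  by (rule pr_swap)

lemma pr_LR_translate: "pr (LR (a+p) (b+p) (c+q) (d+q)) = pr (LR a b c d)"
  by (rule pr_translate)

text \<open>Either the random set crosses horizontally by \<open>star\<close> steps, or its
  complement crosses vertically by \<open>neighbor\<close> steps, hence also by \<open>star\<close>
  steps. A flip, a reflection in the diagonal and a translation give the second event the
  probability of the first.\<close>

lemma pr_LR_square: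
  assumes "k \<ge> 0"
  shows "pr (LR a (a+k) c (c+k)) \<ge> 1/2"
proof -
  have "LR a (a+k) c (c+k) S \<or> TB a (a+k) c (c+k) (- S)" for S
    using star_LR_or_neighbor_TB[of a "a+k" c "c+k" S]
  proof
    assume "\<exists>u v. linked star (S \<inter> rect a (a + k) c (c + k)) u v \<and> fst u = a \<and> fst v = a + k"
    then obtain u v where uv: "linked star (S \<inter> rect a (a + k) c (c + k)) u v" "fst u = a" "fst v = a + k" by blast
    have "u \<in> rect a (a + k) c (c + k)" "v \<in> rect a (a + k) c (c + k)"
      using linked_start[OF uv(1)] linked_end[OF uv(1)] by blast+
    then show ?thesis
      unfolding cross_def using uv by (intro disjI1 bexI[of _ u] bexI[of _ v]) auto
  next
    assume "\<exists>u v. linked neighbor (rect a (a + k) c (c + k) - S) u v \<and> snd u = c \<and> snd v = c + k"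
    then obtain u v where uv: "linked neighbor (rect a (a + k) c (c + k) - S) u v" "snd u = c" "snd v = c + k" by blast
    have l: "linked star (- S \<inter> rect a (a + k) c (c + k)) u v"
      by (rule linked_mono[OF uv(1)]) (auto simp: neighbor_imp_star)
    have "u \<in> rect a (a + k) c (c + k)" "v \<in> rect a (a + k) c (c + k)"
      using linked_start[OF l] linked_end[OF l] by blast+
    then show ?thesis
      unfolding cross_def using uv l by (intro disjI2 bexI[of _ u] bexI[of _ v]) auto
  qed (use assms in auto)
  then have "1 = pr (\<lambda>S. LR a (a+k) c (c+k) S \<or> TB a (a+k) c (c+k) (- S))"
    by (simp add: pr_def prob_space)
  also have "\<dots> \<le> pr (LR a (a+k) c (c+k)) + pr (\<lambda>S. TB a (a+k) c (c+k) (- S))"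
    by (rule pr_or_le) (auto intro: local_event_compl)
  also have "pr (\<lambda>S. TB a (a+k) c (c+k) (- S)) = pr (TB a (a+k) c (c+k))"
    unfolding pr_def by (rule flip_invariance) simp
  also have "\<dots> = pr (LR (a + (c - a)) (a+k + (c - a)) (c + (a - c)) (c+k + (a - c)))"
    using pr_TB[of a "a+k" c "c+k"] by (simp add: algebra_simps)
  also have "\<dots> = pr (LR a (a+k) c (c+k))"
    by (rule pr_LR_translate)
  finally show ?thesis by simp
qed

lemma pr_list:
  assumes "\<And>Q. Q \<in> set Qs \<Longrightarrow> local_event Q \<and> increasing_event Q \<and> pr Q \<ge> \<epsilon>" "\<epsilon> \<ge> 0"
  shows "pr (\<lambda>S. \<forall>Q\<in>set Qs. Q S) \<ge> \<epsilon> ^ length Qs"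
  using assms(1)
proof (induction Qs)
  case Nil
  then show ?case by (simp add: pr_def prob_space)
next
  case (Cons Q Qs)
  have inc: "increasing_event (\<lambda>S. \<forall>Q\<in>set Qs. Q S)"
    using Cons.prems unfolding increasing_event_def by (meson list.set_intros(2))
  have "\<epsilon> ^ length (Q # Qs) \<le> pr Q * pr (\<lambda>S. \<forall>Q\<in>set Qs. Q S)"
    using Cons assms(2) by (auto intro!: mult_mono simp: pr_def)
  also have "\<dots> \<le> pr (\<lambda>S. Q S \<and> (\<forall>Q\<in>set Qs. Q S))"
    unfolding pr_def by (rule association) (use Cons.prems inc in \<open>auto intro!: local_event_Ball\<close>)
  finally show ?case by simp
qed

definition side_arm :: "int \<Rightarrow> int \<Rightarrow> int \<Rightarrow> site set \<Rightarrow> bool" where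
  "side_arm n a b = cross (rect (-n) n (-n) n) (rect (-n) (-n) (-n) n) (rect n n a b)"

text \<open>In Tassion's argument this height splits the upper half of the right side into two parts that
  are both hit from the left side with probability at least \<open>1/8\<close>.\<close>

definition \<alpha> :: "int \<Rightarrow> int" where
  "\<alpha> n = Max {a. 0 \<le> a \<and> a \<le> n \<and> pr (side_arm n a n) \<ge> 1/8}"

lemma side_arm_split: 
  assumes "a \<le> b + 1"
  shows "pr (side_arm n a c) \<le> pr (side_arm n a b) + pr (side_arm n (b + 1) c)"
proof -
  have "side_arm n a b S \<or> side_arm n (b + 1) c S" if "side_arm n a c S" for S
  proof -
    obtain u v where "u \<in> rect (-n) (-n) (-n) n" "v \<in> rect n n a c" "linked star (S \<inter> rect (-n) n (-n) n) u v"
      using \<open>side_arm n a c S\<close> unfolding side_arm_def cross_def by blast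
    moreover from this have "v \<in> rect n n a b \<or> v \<in> rect n n (b + 1) c" by auto
    ultimately show ?thesis unfolding side_arm_def cross_def by blast
  qed
  then have "pr (side_arm n a c) \<le> pr (\<lambda>S. side_arm n a b S \<or> side_arm n (b + 1) c S)"
    unfolding pr_def using sets_local[of "side_arm n a b"] sets_local[of "side_arm n (b+1) c"]
    by (intro finite_measure_mono) (auto simp: side_arm_def)
  also have "\<dots> \<le> pr (side_arm n a b) + pr (side_arm n (b + 1) c)"
    by (rule pr_or_le) (auto simp: side_arm_def)
  finally show ?thesis .
qed

text \<open>The whole right side is reached with probability at least \<open>1/2\<close>, and the
  reflection in the horizontal axis exchanges its halves; the lower half is enlarged by row
  \<open>0\<close> to make the two mirror images.\<close>

lemma side_arm_half:
  assumes "n \<ge> 0"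
  shows "pr (side_arm n 0 n) \<ge> 1/4"
proof -
  have "1/2 \<le> pr (LR (-n) (-n + 2*n) (-n) (-n + 2*n))"
    by (rule pr_LR_square) (use assms in auto)
  also have "\<dots> = pr (side_arm n (-n) n)" by (simp add: side_arm_def)
  also have "\<dots> \<le> pr (side_arm n (-n) (-1)) + pr (side_arm n (-1 + 1) n)"
    by (rule side_arm_split) (use assms in auto)
  also have "pr (side_arm n (-n) (-1)) \<le> pr (side_arm n (-n) 0)"
    unfolding side_arm_def by (rule pr_mono) (auto elim: cross_mono)
  also have "pr (side_arm n (-n) 0) = pr (side_arm n 0 n)"
    unfolding side_arm_def using pr_reflect_y[of "-n" n "-n" n "-n" "-n" "-n" n n n 0 n] by simp
  finally show ?thesis by simp
qed

text \<open>By maximality the part above \<open>\<alpha> n\<close> has probability below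
  \<open>1/8\<close>, so of the \<open>1/4\<close> for the upper half at least \<open>1/8\<close>
  remains for heights up to \<open>\<alpha> n\<close>. If \<open>\<alpha> n = n\<close>, nothing is
  cut off.\<close>

lemma \<alpha>:
  assumes "n \<ge> 0"
  shows "0 \<le> \<alpha> n" "\<alpha> n \<le> n" "pr (side_arm n (\<alpha> n) n) \<ge> 1/8" "pr (side_arm n 0 (\<alpha> n)) \<ge> 1/8"
proof -
  let ?A = "{a. 0 \<le> a \<and> a \<le> n \<and> pr (side_arm n a n) \<ge> 1/8}"
  have fin: "finite ?A" by (rule finite_subset[of _ "{0..n}"]) auto
  have "0 \<in> ?A" using side_arm_half[OF assms] assms by auto
  then have "\<alpha> n \<in> ?A" unfolding \<alpha>_def using fin by (intro Max_in) auto
  then show *: "0 \<le> \<alpha> n" "\<alpha> n \<le> n" "pr (side_arm n (\<alpha> n) n) \<ge> 1/8" by auto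
  show "pr (side_arm n 0 (\<alpha> n)) \<ge> 1/8"
  proof (cases "\<alpha> n = n")
    case True
    then show ?thesis using side_arm_half[OF assms] by simp
  next
    case False
    have "\<alpha> n + 1 \<notin> ?A"
    proof
      assume "\<alpha> n + 1 \<in> ?A"
      then have "\<alpha> n + 1 \<le> Max ?A" using fin by (rule Max_ge[rotated])
      then show False by (simp add: \<alpha>_def)
    qed
    then have "pr (side_arm n (\<alpha> n + 1) n) < 1/8" using * False by auto
    then show ?thesis
      using side_arm_split[of 0 "\<alpha> n" n n] side_arm_half[OF assms] * by auto
  qed
qed

text \<open>Seven increasing events force the long crossing: four corner arms and a vertical
  crossing of the small square, and one arm in each of two large squares. The comparison
  \<open>\<alpha> n \<le> 2 * \<alpha> m\<close> makes the targets of the large arms fit between the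
  corners of the small square.\<close>

lemma pr_long_crossing:
  assumes nm: "0 \<le> m" "m < n" "n \<le> 2 * m" and le: "\<alpha> n \<le> 2 * \<alpha> m"
  shows "pr (LR (-n) (3*n-2*m) (-n) (2*m)) \<ge> (1/8)^7"
proof -
  define a where "a = \<alpha> m"
  define p where "p = n - m"
  have a: "0 \<le> a" "a \<le> m" "pr (side_arm m a m) \<ge> 1/8" using \<alpha>[of m] nm by (auto simp: a_def)
  define Qs where "Qs = [
      cross (box p a m) (rect (p-m) (p-m) (a-m) (a+m)) (rect (p+m) (p+m) (a+a) (a+m)),
      cross (box p a m) (rect (p-m) (p-m) (a-m) (a+m)) (rect (p+m) (p+m) (a-m) (a-a)),
      cross (box p a m) (rect (p+m) (p+m) (a-m) (a+m)) (rect (p-m) (p-m) (a+a) (a+m)),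
      cross (box p a m) (rect (p+m) (p+m) (a-m) (a+m)) (rect (p-m) (p-m) (a-m) (a-a)),
      TB (p-m) (p+m) (a-m) (a+m),
      cross (rect (-n) n (-n) n) (rect (-n) (-n) (-n) n) (rect n n 0 (2*a)),
      cross (rect (n-2*m) (3*n-2*m) (-n) n) (rect (3*n-2*m) (3*n-2*m) (-n) n) (rect (n-2*m) (n-2*m) 0 (2*a))]"
  have 1: "pr (cross (box p a m) (rect (p-m) (p-m) (a-m) (a+m)) (rect (p+m) (p+m) (a+a) (a+m))) \<ge> 1/8"
    using a(3) pr_translate[of "-m" p m "-m" a m "-m" "-m" "-m" m m m a m]
    by (simp add: side_arm_def box_def algebra_simps)
  have 2: "pr (cross (box p a m) (rect (p-m) (p-m) (a-m) (a+m)) (rect (p+m) (p+m) (a-m) (a-a))) \<ge> 1/8"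
    using a(3) pr_translate[of "-m" p m "-m" a m "-m" "-m" "-m" m m m "-m" "-a"]
      pr_reflect_y[of "-m" m "-m" m "-m" "-m" "-m" m m m a m]
    by (simp add: side_arm_def box_def algebra_simps)
  have 3: "pr (cross (box p a m) (rect (p+m) (p+m) (a-m) (a+m)) (rect (p-m) (p-m) (a+a) (a+m))) \<ge> 1/8"
    using a(3) pr_translate[of "-m" p m "-m" a m m m "-m" m "-m" "-m" a m]
      pr_reflect_x[of "-m" m "-m" m "-m" "-m" "-m" m m m a m]
    by (simp add: side_arm_def box_def algebra_simps)
  have 4: "pr (cross (box p a m) (rect (p+m) (p+m) (a-m) (a+m)) (rect (p-m) (p-m) (a-m) (a-a))) \<ge> 1/8"
    using a(3) pr_translate[of "-m" p m "-m" a m m m "-m" m "-m" "-m" "-m" "-a"]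
      pr_reflect_x[of "-m" m "-m" m "-m" "-m" "-m" m m m a m]
      pr_reflect_y[of "-m" m "-m" m m m "-m" m "-m" "-m" a m]
    by (simp add: side_arm_def box_def algebra_simps)
  have 5: "pr (TB (p-m) (p+m) (a-m) (a+m)) \<ge> 1/8"
    using pr_LR_square[of "2*m" "a-m" "p-m"] nm by (simp add: pr_TB algebra_simps)
  have "1/8 \<le> pr (side_arm n 0 (\<alpha> n))" using \<alpha>(4)[of n] nm by auto
  also have "\<dots> \<le> pr (side_arm n 0 (2*a))"
    unfolding side_arm_def by (rule pr_mono) (use le in \<open>auto simp: a_def elim!: cross_mono\<close>)
  finally have 6: "pr (side_arm n 0 (2*a)) \<ge> 1/8" .
  have 7: "pr (cross (rect (n-2*m) (3*n-2*m) (-n) n) (rect (3*n-2*m) (3*n-2*m) (-n) n) (rect (n-2*m) (n-2*m) 0 (2*a))) \<ge> 1/8"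
    using 6 pr_translate[of "-n" "2*n-2*m" n "-n" 0 n n n "-n" n "-n" "-n" 0 "2*a"]
      pr_reflect_x[of "-n" n "-n" n "-n" "-n" "-n" n n n 0 "2*a"]
    by (simp add: side_arm_def algebra_simps)
  have fin: "finite (box p a m)" by (simp add: box_def)
  have "(1/8) ^ length Qs \<le> pr (\<lambda>S. \<forall>Q\<in>set Qs. Q S)"
    by (rule pr_list) (use 1 2 3 4 5 6 7 fin in \<open>auto simp: Qs_def side_arm_def\<close>)
  also have "\<dots> \<le> pr (LR (-n) (3*n-2*m) (-n) (2*m))"
  proof (rule pr_mono)
    fix S assume "\<forall>Q\<in>set Qs. Q S"
    then show "LR (-n) (3*n-2*m) (-n) (2*m) S"
      using long_crossing[OF nm(2,3) a(1,2), of S] by (simp add: Qs_def p_def)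
  qed simp
  also have "length Qs = 7" by (simp add: Qs_def)
  finally show ?thesis .
qed

text \<open>Otherwise \<alpha> + 1 would at least double each time the scale grows by the factor
  \<open>3/2\<close>, and would overtake the scale, which bounds \<alpha>.\<close>

lemma doubling_scales: "\<exists>m\<ge>N. \<alpha> (3 * m div 2) \<le> 2 * \<alpha> m"
proof (rule ccontr)
  assume "\<not> ?thesis"
  then have big: "\<alpha> (3 * m div 2) \<ge> 2 * \<alpha> m + 1" if "m \<ge> N" for m using that by force
  define n where "n j = ((\<lambda>m. 3 * m div 2) ^^ j) (max N 0)" for j
  have n: "n j \<ge> max N 0 \<and> real_of_int (n j) \<le> (3/2)^j * real_of_int (max N 0) \<and> \<alpha> (n j) + 1 \<ge> 2 ^ j" for j
  proof (induction j)
    case 0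
    then show ?case using \<alpha>(1)[of "max N 0"] by (simp add: n_def)
  next
    case (Suc j)
    have *: "n (Suc j) = 3 * n j div 2" by (simp add: n_def)
    have "real_of_int (3 * n j div 2) \<le> 3/2 * real_of_int (n j)"
      using real_of_int_div4[of "3 * n j" 2] by simp
    moreover have "\<alpha> (3 * n j div 2) \<ge> 2 * \<alpha> (n j) + 1" using big Suc by auto
    ultimately show ?case using Suc unfolding * by (auto simp: max_def split: if_splits)
  qed
  define C where "C = real_of_int (max N 0) + 1"
  have C: "C > 0" by (simp add: C_def)
  \<comment> \<open>The number \<open>4/3\<close> is the ratio of the growth factors
    \<open>2\<close> and \<open>3/2\<close>.\<close>
  obtain j where j: "(4/3 :: real) ^ j > C" using real_arch_pow[of "4/3" C] by auto
  have "real_of_int (\<alpha> (n j)) \<le> real_of_int (n j)" using \<alpha>(2)[of "n j"] n[of j] by auto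
  then have "2 ^ j \<le> (3/2)^j * real_of_int (max N 0) + 1"
    using n[of j] of_int_le_iff[of "2^j" "\<alpha> (n j) + 1", where ?'a = real] by simp
  also have "\<dots> \<le> (3/2)^j * C" by (simp add: C_def algebra_simps)
  finally have "(2::real)^j \<le> (3/2)^j * C" .
  then have "(2::real)^j / (3/2)^j \<le> C" by (simp add: field_simps)
  then show False using j by (simp add: power_divide[symmetric])
qed

text \<open>Each step adds \<open>W - h\<close> to the length. It costs \<open>1/2\<close> for a
  vertical crossing of the overlapping square and \<open>c\<close> for another copy of the crossing
  of length \<open>W\<close>.\<close>

lemma pr_extend:
  assumes "h \<ge> 0" "W \<ge> h" "pr (LR 0 W 0 h) \<ge> c" "c \<ge> 0"
  shows "pr (LR 0 (W + int j * (W - h)) 0 h) \<ge> c * (c / 2) ^ j"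
proof (induction j)
  case (Suc j)
  define L where "L = W + int j * (W - h)"
  have L: "L \<ge> h" using assms unfolding L_def by (smt (verit) mult_nonneg_nonneg of_nat_0_le_iff)
  have tb: "pr (TB (L-h) L 0 h) \<ge> 1/2"
    using pr_LR_square[of h 0 "L-h"] assms by (simp add: pr_TB)
  have W: "pr (LR (L-h) (L-h+W) 0 h) \<ge> c"
    using pr_LR_translate[of 0 "L-h" W 0 0 h] assms by (simp add: algebra_simps)
  have "c * (c/2) ^ Suc j \<le> (c * (c/2)^j) * (1/2 * c)" by simp
  also have "\<dots> \<le> pr (LR 0 L 0 h) * (pr (TB (L-h) L 0 h) * pr (LR (L-h) (L-h+W) 0 h))"
    using Suc tb W assms by (intro mult_mono) (auto simp: L_def pr_def)
  also have "\<dots> \<le> pr (LR 0 L 0 h) * pr (\<lambda>S. TB (L-h) L 0 h S \<and> LR (L-h) (L-h+W) 0 h S)"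
    unfolding pr_def by (intro mult_left_mono association) auto
  also have "\<dots> \<le> pr (\<lambda>S. LR 0 L 0 h S \<and> TB (L-h) L 0 h S \<and> LR (L-h) (L-h+W) 0 h S)"
    unfolding pr_def by (intro association) (auto intro: local_event_conj increasing_event_conj)
  also have "\<dots> \<le> pr (LR 0 (L-h+W) 0 h)"
    using extend_crossing[OF assms(1) L assms(2)] by (intro pr_mono) auto
  also have "L - h + W = W + int (Suc j) * (W - h)" by (simp add: L_def algebra_simps)
  finally show ?case .
qed (use assms in auto)

text \<open>The factor \<open>(1/8)^7\<close> is the bound in \<open>pr_long_crossing\<close>; sixty
  extensions by \<open>pr_extend\<close> contribute the power and reach a rectangle four times as
  long as high.\<close>

definition blocking_const :: real where
  "blocking_const = (1/8)^7 * ((1/8)^7 / 2) ^ 60"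

lemma long_crossing_scales: "\<exists>h\<ge>N. h > 0 \<and> pr (LR 0 (4*h) 0 h) \<ge> blocking_const"
proof -
  \<comment> \<open>With \<open>n\<close> close to \<open>3 * m / 2\<close> the ratio of
    \<open>W\<close> to \<open>h\<close> is close to \<open>8/7\<close>. As
    \<open>W - h = 3 * n - 4 * m\<close> is at least \<open>(m - 3) / 2\<close> and \<open>h\<close>
    at most \<open>7 * m / 2\<close>, for \<open>m \<ge> 10\<close> sixty extensions lead beyond
    length \<open>4 * h\<close>.\<close>
  obtain m where m: "m \<ge> max N 10" "\<alpha> (3 * m div 2) \<le> 2 * \<alpha> m"
    using doubling_scales by blast
  define n where "n = 3 * m div 2"
  have n: "m < n" "n \<le> 2 * m" "2 * n \<le> 3 * m" "3 * m - 1 \<le> 2 * n" using m by (auto simp: n_def)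
  define h where "h = n + 2 * m"
  define W where "W = 4 * n - 2 * m"
  have "(1/8)^7 \<le> pr (LR (-n) (3*n-2*m) (-n) (2*m))"
    by (rule pr_long_crossing) (use m n in \<open>auto simp: n_def\<close>)
  also have "\<dots> = pr (LR 0 W 0 h)"
    using pr_LR_translate[of "-n" n "3*n-2*m" "-n" n "2*m"] by (simp add: W_def h_def algebra_simps)
  finally have W: "pr (LR 0 W 0 h) \<ge> (1/8)^7" .
  have "blocking_const \<le> pr (LR 0 (W + int 60 * (W - h)) 0 h)"
    unfolding blocking_const_def by (rule pr_extend[OF _ _ W]) (use m n in \<open>auto simp: h_def W_def\<close>)
  also have "\<dots> \<le> pr (LR 0 (4*h) 0 h)"
  proof (rule pr_mono)
    fix S assume "LR 0 (W + int 60 * (W - h)) 0 h S"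
    then obtain u v where uv: "linked star (S \<inter> rect 0 (W + int 60 * (W - h)) 0 h) u v" "fst u = 0" "fst v = W + int 60 * (W - h)"
      "0 \<le> snd u" "snd u \<le> h"
      unfolding cross_def by auto
    have "\<exists>z\<in>{z. fst z = 4 * h}. linked star (S \<inter> rect 0 (W + int 60 * (W - h)) 0 h \<inter> {z. fst z \<le> 4 * h}) u z"
      by (rule linked_exit[OF uv(1)]) (use m n uv in \<open>auto simp: star_def h_def W_def\<close>)
    then obtain z where z: "fst z = 4 * h" "linked star (S \<inter> rect 0 (W + int 60 * (W - h)) 0 h \<inter> {z. fst z \<le> 4 * h}) u z" by auto
    then have zr: "z \<in> rect 0 (W + int 60 * (W - h)) 0 h" using linked_end by blast
    have "linked star (S \<inter> rect 0 (4*h) 0 h) u z"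
      by (rule linked_mono[OF z(2)]) auto
    then show "LR 0 (4*h) 0 h S"
      unfolding cross_def using uv z zr by (intro bexI[of _ u] bexI[of _ z]) auto
  qed simp
  finally show ?thesis using m n by (intro exI[of _ h]) (auto simp: h_def)
qed

text \<open>The four strips around the inner box are translated or turned copies of one rectangle of
  size \<open>4 * h\<close> by \<open>h\<close>, so association gives the fourth power.\<close>

lemma pr_blocked: "\<exists>h\<ge>N. h > 0 \<and> pr (blocked h) \<ge> blocking_const ^ 4"
proof -
  obtain h where h: "h \<ge> N" "h > 0" "pr (LR 0 (4*h) 0 h) \<ge> blocking_const"
    using long_crossing_scales by blast
  define Qs where "Qs = [TB h (2*h) (-2*h) (2*h), TB (-2*h) (-h) (-2*h) (2*h),
    LR (-2*h) (2*h) h (2*h), LR (-2*h) (2*h) (-2*h) (-h)]"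
  have "pr (LR (-2*h) (2*h) h (2*h)) \<ge> blocking_const" "pr (LR (-2*h) (2*h) (-2*h) (-h)) \<ge> blocking_const"
    using h(3) pr_LR_translate[of 0 "-2*h" "4*h" 0 h h] pr_LR_translate[of 0 "-2*h" "4*h" 0 "-2*h" h]
    by (simp_all add: algebra_simps)
  then have "blocking_const ^ length Qs \<le> pr (\<lambda>S. \<forall>Q\<in>set Qs. Q S)"
    using pr_TB[of h "2*h" "-2*h" "2*h"] pr_TB[of "-2*h" "-h" "-2*h" "2*h"]
    by (intro pr_list) (auto simp: Qs_def blocking_const_def)
  then show ?thesis using h by (intro exI[of _ h]) (simp add: Qs_def blocked_def[abs_def] power4_eq_xxxx mult.assoc)
qed

lemma sets_infinite_at: "{\<omega> \<in> space M. infinite_at (- X \<omega>) x} \<in> events"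
proof -
  have loc: "local_event (\<lambda>S. linked neighbor (- S \<inter> rect (- int n) (int n) (- int n) (int n)) x y)" for n y
  proof -
    have "- S \<inter> rect (- int n) (int n) (- int n) (int n) =
        - (S \<inter> rect (- int n) (int n) (- int n) (int n)) \<inter> rect (- int n) (int n) (- int n) (int n)" for S
      by blast
    then show ?thesis
      unfolding local_event_def
      by (intro exI[of _ "rect (- int n) (int n) (- int n) (int n)"] conjI finite_rect allI arg_cong[where f = "\<lambda>A. linked neighbor A x y"])
  qed
  have "infinite_at (- X \<omega>) x \<longleftrightarrow> (\<forall>n::nat. \<exists>y\<in>- rect (- int n) (int n) (- int n) (int n). \<exists>m::nat.
      linked neighbor (- X \<omega> \<inter> rect (- int m) (int m) (- int m) (int m)) x y)" for \<omega>
  proof -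
    have "linked neighbor (- X \<omega>) x y \<longleftrightarrow> (\<exists>m::nat.
      linked neighbor (- X \<omega> \<inter> rect (- int m) (int m) (- int m) (int m)) x y)" for y
      using linked_neighbor_finite_subset[of "- X \<omega>" x y] linked_subset[of neighbor _ x y "- X \<omega>"] by blast
    then show ?thesis unfolding infinite_at_def infinite_site_set by blast
  qed
  then have "{\<omega> \<in> space M. infinite_at (- X \<omega>) x} = {\<omega> \<in> space M. \<forall>n::nat. \<exists>y\<in>- rect (- int n) (int n) (- int n) (int n). \<exists>m::nat.
      linked neighbor (- X \<omega> \<inter> rect (- int m) (int m) (- int m) (int m)) x y}" by simp
  also have "\<dots> \<in> events"
    by (intro sets.sets_Collect_countable_All sets.sets_Collect_countable_Ex'
        sets.sets_Collect_countable_Ex sets_local[OF loc]) auto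
  finally show ?thesis .
qed

text \<open>A blocked scale beyond \<open>N\<close> keeps every cluster that starts in the box of
  radius \<open>N\<close> finite, and its probability is bounded below independently of
  \<open>N\<close>. The boxes then exhaust the lattice.\<close>

lemma prob_infinite_cluster_less_1:
  "{\<omega> \<in> space M. \<exists>x. infinite_at (- X \<omega>) x} \<in> events"
  "prob {\<omega> \<in> space M. \<exists>x. infinite_at (- X \<omega>) x} < 1"
proof -
  define E where "E N = {\<omega> \<in> space M. \<exists>x\<in>rect (- int N) (int N) (- int N) (int N). infinite_at (- X \<omega>) x}" for N :: nat
  have E: "E N \<in> events" for N
    unfolding E_def by (intro sets.sets_Collect_finite_Ex sets_infinite_at) auto
  have "\<exists>N::nat. x \<in> rect (- int N) (int N) (- int N) (int N)" for x
    by (intro exI[of _ "nat (\<bar>fst x\<bar> + \<bar>snd x\<bar>)"]) auto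
  then have UN: "{\<omega> \<in> space M. \<exists>x. infinite_at (- X \<omega>) x} = (\<Union>N. E N)"
    unfolding E_def by blast
  then show "{\<omega> \<in> space M. \<exists>x. infinite_at (- X \<omega>) x} \<in> events" using E by auto
  have "prob (E N) \<le> 1 - blocking_const ^ 4" for N
  proof -
    obtain h where h: "h \<ge> int N" "h > 0" "pr (blocked h) \<ge> blocking_const ^ 4"
      using pr_blocked by blast
    have loc: "local_event (blocked h)"
      unfolding blocked_def[abs_def] by (intro local_event_conj) auto
    have "E N \<subseteq> space M - {\<omega> \<in> space M. blocked h (X \<omega>)}"
    proof
      fix \<omega> assume "\<omega> \<in> E N"
      then obtain x where x: "\<omega> \<in> space M" "x \<in> rect (- int N) (int N) (- int N) (int N)" "infinite_at (- X \<omega>) x"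
        unfolding E_def by blast
      have "\<not> blocked h (X \<omega>)"
      proof
        assume "blocked h (X \<omega>)"
        then have "{y. linked neighbor (- X \<omega>) x y} \<subseteq> rect (-2*h) (2*h) (-2*h) (2*h)"
          using confined[of "X \<omega>" x _ h] x(2) h by (auto simp: blocked_def)
        then show False using x(3) finite_subset[OF _ finite_rect] unfolding infinite_at_def by blast
      qed
      then show "\<omega> \<in> space M - {\<omega> \<in> space M. blocked h (X \<omega>)}" using x by auto
    qed
    then have "prob (E N) \<le> prob (space M - {\<omega> \<in> space M. blocked h (X \<omega>)})"
      by (rule finite_measure_mono) (use sets_local[OF loc] in auto)
    also have "\<dots> = 1 - pr (blocked h)"
      unfolding pr_def by (rule prob_compl[OF sets_local[OF loc]])
    finally show ?thesis using h(3) by simp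
  qed
  moreover have "(\<lambda>N. prob (E N)) \<longlonglongrightarrow> prob (\<Union>N. E N)"
  proof (rule finite_Lim_measure_incseq)
    have "rect (- int i) (int i) (- int i) (int i) \<subseteq> rect (- int j) (int j) (- int j) (int j)" if "i \<le> j" for i j
      using that by auto
    then show "incseq E" unfolding incseq_def E_def by blast
  qed (use E in auto)
  ultimately have "prob (\<Union>N. E N) \<le> 1 - blocking_const ^ 4"
    by (intro LIMSEQ_le_const2) auto
  moreover have "blocking_const ^ 4 > 0" by (simp add: blocking_const_def)
  ultimately show "prob {\<omega> \<in> space M. \<exists>x. infinite_at (- X \<omega>) x} < 1"
    unfolding UN by linarith
qed

end

section \<open>The clock of a site\<close>

lemma (in product_prob_space) measure_PiM_Collect:
  assumes "J \<subseteq> I" "finite J" "\<And>i. i \<in> J \<Longrightarrow> X i \<in> sets (M i)"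
  shows "measure (Pi\<^sub>M I M) {x \<in> space (Pi\<^sub>M I M). \<forall>i\<in>J. x i \<in> X i} = (\<Prod>i\<in>J. measure (M i) (X i))"
proof -
  have "{x \<in> space (Pi\<^sub>M I M). \<forall>i\<in>J. x i \<in> X i} = prod_emb I M J (Pi\<^sub>E J X)"
    unfolding prod_emb_def using assms by (auto simp: space_PiM Pi_iff)
  then show ?thesis using measure_PiM_emb[OF assms] by simp
qed

abbreviation "mark_measure \<equiv> density lborel (exponential_density 1) \<Otimes>\<^sub>M uniform_count_measure (UNIV :: bool set)"

definition site_clock :: "(nat \<Rightarrow> real \<times> bool) measure" where
  "site_clock = Pi\<^sub>M UNIV (\<lambda>n. mark_measure)"

definition ring :: "(nat \<Rightarrow> real \<times> bool) \<Rightarrow> nat \<Rightarrow> real" where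
  "ring v n = (\<Sum>k\<le>n. fst (v k))"

lemma ring_time_eq: "ring_time w x n = ring (w x) n"
  by (simp add: ring_time_def ring_def)

lemma clock_measure_eq: "clock_measure = Pi\<^sub>M UNIV (\<lambda>x. site_clock)"
  by (simp add: clock_measure_def site_clock_def)

interpretation expo: prob_space "density lborel (exponential_density 1)"
  by (rule prob_space_exponential_density) simp

interpretation coins: prob_space "uniform_count_measure (UNIV :: bool set)"
  by (rule prob_space_uniform_count_measure) auto

interpretation spins: prob_space "uniform_count_measure {-1, 1 :: int}"
  by (rule prob_space_uniform_count_measure) auto

interpretation mark: pair_prob_space "density lborel (exponential_density 1)" "uniform_count_measure (UNIV :: bool set)" ..

interpretation K: prob_space site_clock
  unfolding site_clock_def by (intro prob_space_PiM) (rule mark.P.prob_space_axioms)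

interpretation site: sequence_space mark_measure
  rewrites "Pi\<^sub>M UNIV (\<lambda>n::nat. mark_measure) = site_clock"
   by unfold_locales (simp add: site_clock_def)

interpretation Clk: prob_space clock_measure
  unfolding clock_measure_eq by (intro prob_space_PiM) (rule K.prob_space_axioms)

interpretation Ini: prob_space bernoulli_initial
  unfolding bernoulli_initial_def by (intro prob_space_PiM) (rule spins.prob_space_axioms)

interpretation clocks: product_prob_space "\<lambda>x::site. site_clock" UNIV
  rewrites "Pi\<^sub>M UNIV (\<lambda>x::site. site_clock) = clock_measure"
  by unfold_locales (simp add: clock_measure_eq)

interpretation init: product_prob_space "\<lambda>x::site. uniform_count_measure {-1, 1 :: int}" UNIV
  rewrites "Pi\<^sub>M UNIV (\<lambda>x::site. uniform_count_measure {-1, 1 :: int}) = bernoulli_initial"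
  by unfold_locales (simp add: bernoulli_initial_def)

interpretation I: prob_space ising_measure
  by (rule prob_space_ising_measure)

lemma sets_site_clock: "K.events = sets (Pi\<^sub>M UNIV (\<lambda>n::nat. borel \<Otimes>\<^sub>M count_space UNIV))"
  unfolding site_clock_def
  by (intro sets_PiM_cong sets_pair_measure_cong refl) (auto simp: sets_uniform_count_measure)

lemma space_site_clock [simp]: "space site_clock = UNIV"
  using sets_eq_imp_space_eq[OF sets_site_clock] by (simp add: space_PiM space_pair_measure)

lemma space_clock_measure [simp]: "space clock_measure = UNIV"
  by (simp add: clock_measure_eq space_PiM)

lemma space_bernoulli_initial: "space bernoulli_initial = {\<eta>. \<forall>x. \<eta> x \<in> {-1, 1}}"
  by (auto simp: bernoulli_initial_def space_PiM space_uniform_count_measure)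

lemma measurable_mark [measurable]: "(\<lambda>v. v n) \<in> measurable site_clock (borel \<Otimes>\<^sub>M count_space UNIV)"
  unfolding measurable_cong_sets[OF sets_site_clock refl] by measurable

lemma measurable_ring [measurable]: "(\<lambda>v. ring v n) \<in> borel_measurable site_clock"
  unfolding ring_def by measurable

lemma measurable_site_clock [measurable]: "(\<lambda>w. w x) \<in> measurable clock_measure site_clock"
  unfolding clock_measure_eq by measurable

lemma measurable_ring_time [measurable]: "(\<lambda>w. ring_time w x n) \<in> borel_measurable clock_measure"
  unfolding ring_time_eq by measurable

section \<open>Exponential waiting times and ring times\<close>

lemma AE_exponential: "AE x in density lborel (exponential_density 1). x > 0"
proof (subst AE_density)
  have "AE x in lborel. x \<noteq> (0::real)" by (rule AE_lborel_singleton)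
  then show "AE x in lborel. 0 < ennreal (exponential_density 1 x) \<longrightarrow> 0 < x"
    by eventually_elim (auto simp: exponential_density_def split: if_splits)
qed simp

lemma distr_mark_fst: "distr mark_measure (density lborel (exponential_density 1)) fst = density lborel (exponential_density 1)"
  by (rule coins.distr_pair_fst)

lemma AE_mark: "AE s in mark_measure. fst s > 0"
  using AE_exponential by (subst (asm) distr_mark_fst[symmetric]) (auto intro: AE_distrD[rotated])

lemma AE_gap_pos: "AE v in site_clock. \<forall>n. fst (v n) > 0"
proof -
  have "AE v in site_clock. fst (v n) > 0" for n
    unfolding site_clock_def
    by (rule AE_PiM_component[of UNIV "\<lambda>_. mark_measure" n]) (auto simp: AE_mark mark.P.prob_space_axioms)
  then show ?thesis by (simp add: AE_all_countable)
qed

lemma emeasure_exponential_le: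
  assumes "A \<in> sets borel"
  shows "emeasure (density lborel (exponential_density 1)) A \<le> emeasure lborel A"
proof -
  have "emeasure (density lborel (exponential_density 1)) A = (\<integral>\<^sup>+x. ennreal (exponential_density 1 x) * indicator A x \<partial>lborel)"
    using assms by (intro emeasure_density) auto
  also have "\<dots> \<le> (\<integral>\<^sup>+x. indicator A x \<partial>lborel)"
    by (intro nn_integral_mono) (auto simp: exponential_density_def indicator_def)
  finally show ?thesis using assms by simp
qed

lemma emeasure_mark_fst:
  assumes "A \<in> sets borel"
  shows "emeasure mark_measure {s. fst s \<in> A} = emeasure (density lborel (exponential_density 1)) A"
proof -
  have "emeasure (density lborel (exponential_density 1)) A =
      emeasure (distr mark_measure (density lborel (exponential_density 1)) fst) A"
    by (simp add: distr_mark_fst)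
  also have "\<dots> = emeasure mark_measure {s. fst s \<in> A}"
  proof (subst emeasure_distr)
    show "fst \<in> measurable mark_measure (density lborel (exponential_density 1))" by (rule measurable_fst)
  qed (use assms in \<open>auto simp: space_pair_measure space_uniform_count_measure vimage_def\<close>)
  finally show ?thesis by simp
qed

text \<open>Given all marks but the first, the \<open>n\<close>-th ring is the first waiting time
  plus a constant, and the exponential density is at most one.\<close>

lemma prob_ring_interval:
  assumes "a \<le> b"
  shows "K.prob {v. ring v n \<in> {a<..b}} \<le> b - a"
proof -
  define c where "c \<omega> = (\<Sum>k<n. fst (\<omega> k :: real \<times> bool))" for \<omega>
  have c [measurable]: "c \<in> borel_measurable site_clock" unfolding c_def by measurable
  have r: "ring (case_nat s \<omega>) n = fst s + c \<omega>" for s \<omega>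
    unfolding ring_def c_def using sum.atMost_shift[of "\<lambda>k. fst (case_nat s \<omega> k)" n] by simp
  have iter: "distr (mark_measure \<Otimes>\<^sub>M site_clock) site_clock (\<lambda>(s, \<omega>). case_nat s \<omega>) = site_clock"
    by (rule site.PiM_iter)
  have m [measurable]: "(\<lambda>(s, \<omega>). case_nat s \<omega>) \<in> measurable (mark_measure \<Otimes>\<^sub>M site_clock) site_clock"
    unfolding site_clock_def by measurable
  have A: "{v. ring v n \<in> {a<..b}} \<in> K.events"
    using measurable_sets[OF measurable_ring[of n], of "{a<..b}"] by (simp add: vimage_def)
  have B: "{p. fst (fst p) + c (snd p) \<in> {a<..b}} \<in> sets (mark_measure \<Otimes>\<^sub>M site_clock)"
  proof -
    have "(\<lambda>p. fst (fst p) + c (snd p)) \<in> borel_measurable (mark_measure \<Otimes>\<^sub>M site_clock)" by measurable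
    from measurable_sets[OF this, of "{a<..b}"] show ?thesis
      by (simp add: vimage_def space_pair_measure space_uniform_count_measure)
  qed
  interpret P: pair_prob_space mark_measure site_clock ..
  have "emeasure site_clock {v. ring v n \<in> {a<..b}} =
      emeasure (distr (mark_measure \<Otimes>\<^sub>M site_clock) site_clock (\<lambda>(s, \<omega>). case_nat s \<omega>)) {v. ring v n \<in> {a<..b}}"
    by (simp only: iter)
  also have "\<dots> = emeasure (mark_measure \<Otimes>\<^sub>M site_clock) {p. fst (fst p) + c (snd p) \<in> {a<..b}}"
    using A by (subst emeasure_distr)
      (auto simp: r space_pair_measure space_uniform_count_measure vimage_def split_beta' intro!: arg_cong2[where f = emeasure])
  also have "\<dots> = (\<integral>\<^sup>+\<omega>. emeasure mark_measure ((\<lambda>s. (s, \<omega>)) -` {p. fst (fst p) + c (snd p) \<in> {a<..b}}) \<partial>site_clock)"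
    by (rule P.emeasure_pair_measure_alt2[OF B])
  also have "\<dots> \<le> (\<integral>\<^sup>+\<omega>. ennreal (b - a) \<partial>site_clock)"
  proof (rule nn_integral_mono)
    fix \<omega>
    have eq: "(\<lambda>s. (s, \<omega>)) -` {p. fst (fst p) + c (snd p) \<in> {a<..b}} = {s. fst s \<in> {a - c \<omega><..b - c \<omega>}}"
      by auto
    have "emeasure mark_measure ((\<lambda>s. (s, \<omega>)) -` {p. fst (fst p) + c (snd p) \<in> {a<..b}}) =
        emeasure (density lborel (exponential_density 1)) {a - c \<omega><..b - c \<omega>}"
      unfolding eq by (rule emeasure_mark_fst) simp
    also have "\<dots> \<le> emeasure lborel {a - c \<omega><..b - c \<omega>}"
      by (rule emeasure_exponential_le) simp
    also have "\<dots> = ennreal (b - a)" using assms by simp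
    finally show "emeasure mark_measure ((\<lambda>s. (s, \<omega>)) -` {p. fst (fst p) + c (snd p) \<in> {a<..b}}) \<le> ennreal (b - a)" .
  qed
  also have "\<dots> = ennreal (b - a)" using K.emeasure_space_1 by simp
  finally show ?thesis using assms by (simp add: K.emeasure_eq_measure)
qed

lemma prob_gap_greater:
  assumes "a \<ge> 0"
  shows "measure mark_measure {s. fst s > a} = exp (- a)"
proof -
  have "distributed (density lborel (exponential_density 1)) lborel (\<lambda>x. x) (exponential_density 1)"
    unfolding distributed_def by (auto simp: distr_id2)
  from expo.exponential_distributedD_gt[OF this assms]
  have "measure (density lborel (exponential_density 1)) {a<..} = exp (- a)"
    by (simp add: greaterThan_def)
  then show ?thesis
    using emeasure_mark_fst[of "{a<..}"] by (simp add: measure_def)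
qed

lemma ring_mono:
  assumes "\<And>k. fst (v k) > 0" "m \<le> n"
  shows "ring v m \<le> ring v n"
  unfolding ring_def using assms by (intro sum_mono2) (auto intro: less_imp_le)

text \<open>If the ring comes by time \<open>T\<close>, none of its \<open>n + 1\<close> independent
  waiting times exceeds \<open>T\<close>. This is cruder than the gamma distribution, but it tends
  to zero with \<open>n\<close>.\<close>

lemma prob_ring_le:
  assumes "T \<ge> 0"
  shows "K.prob {v. ring v n \<le> T} \<le> (1 - exp (- T)) ^ Suc n"
proof -
  have sp: "space mark_measure = UNIV" by (simp add: space_pair_measure space_uniform_count_measure)
  have le: "{s. fst s \<le> T} \<in> sets mark_measure"
  proof -
    have "fst -` {..T} \<inter> space mark_measure \<in> sets mark_measure" by measurable
    then show ?thesis by (simp add: sp vimage_def)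
  qed
  have "{s. fst s \<le> T} = space mark_measure - {s. fst s > T}" by (auto simp: sp)
  moreover have "{s. fst s > T} = space mark_measure - {s. fst s \<le> T}" by (auto simp: sp)
  ultimately have p: "measure mark_measure {s. fst s \<le> T} = 1 - exp (- T)"
    using mark.P.prob_compl[of "{s. fst s > T}"] prob_gap_greater[OF assms] le sets.compl_sets[OF le] by simp
  have "K.prob {v. ring v n \<le> T} \<le> K.prob {v \<in> space site_clock. \<forall>k\<in>{..n}. v k \<in> {s. fst s \<le> T}}"
  proof (rule K.finite_measure_mono_AE)
    show "AE v in site_clock. v \<in> {v. ring v n \<le> T} \<longrightarrow> v \<in> {v \<in> space site_clock. \<forall>k\<in>{..n}. v k \<in> {s. fst s \<le> T}}"
      using AE_gap_pos
    proof eventually_elim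
      case (elim v)
      have "fst (v k) \<le> ring v n" if "k \<le> n" for k
        unfolding ring_def using elim that by (intro member_le_sum) (auto intro: less_imp_le)
      then show ?case by fastforce
    qed
    show "{v \<in> space site_clock. \<forall>k\<in>{..n}. v k \<in> {s. fst s \<le> T}} \<in> K.events"
      unfolding mem_Collect_eq by measurable
  qed
  also have "\<dots> = (\<Prod>k\<le>n. measure mark_measure {s. fst s \<le> T})"
    using le by (intro site.measure_PiM_Collect) auto
  also have "\<dots> = (1 - exp (- T)) ^ Suc n" by (simp add: p)
  finally show ?thesis .
qed

lemma prob_ring_le_tendsto: "(\<lambda>n. K.prob {v. ring v n \<le> T}) \<longlonglongrightarrow> 0"
proof (rule tendsto_sandwich[OF _ _ tendsto_const])
  define T' where "T' = max T 0"
  have le: "K.prob {v. ring v n \<le> T} \<le> (1 - exp (- T')) ^ Suc n" for n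
  proof -
    have "{v. ring v n \<le> T'} \<in> K.events"
      using measurable_sets[OF measurable_ring[of n], of "{..T'}"] by (simp add: vimage_def)
    then have "K.prob {v. ring v n \<le> T} \<le> K.prob {v. ring v n \<le> T'}"
      by (intro K.finite_measure_mono) (auto simp: T'_def)
    also have "\<dots> \<le> (1 - exp (- T')) ^ Suc n" by (rule prob_ring_le) (simp add: T'_def)
    finally show ?thesis .
  qed
  show "\<forall>\<^sub>F n in sequentially. K.prob {v. ring v n \<le> T} \<le> (1 - exp (- T')) ^ Suc n"
    using le by simp
  have "(\<lambda>n. (1 - exp (- T')) ^ n) \<longlonglongrightarrow> 0"
    by (intro LIMSEQ_power_zero) (auto simp: T'_def)
  then show "(\<lambda>n. (1 - exp (- T')) ^ Suc n) \<longlonglongrightarrow> 0" by (rule LIMSEQ_Suc)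
qed simp

lemma AE_ring_unbounded: "AE v in site_clock. \<forall>T. \<exists>n. ring v n > T"
proof -
  have "AE v in site_clock. \<exists>n. ring v n > real N" for N
  proof -
    have meas: "{v. \<forall>n. ring v n \<le> real N} \<in> K.events"
      using measurable_sets[OF measurable_ring, of "{..real N}"]
      by (simp add: vimage_def Collect_all_eq)
    have "K.prob {v. \<forall>n. ring v n \<le> real N} \<le> K.prob {v. ring v n \<le> real N}" for n
      using measurable_sets[OF measurable_ring[of n], of "{..real N}"]
      by (intro K.finite_measure_mono) (auto simp: vimage_def)
    then have "K.prob {v. \<forall>n. ring v n \<le> real N} \<le> 0"
      by (intro LIMSEQ_le_const[OF prob_ring_le_tendsto[of "real N"]]) auto
    then have "{v. \<forall>n. ring v n \<le> real N} \<in> null_sets site_clock"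
      using meas by (auto simp: null_sets_def K.emeasure_eq_measure measure_le_0_iff)
    then show ?thesis by (rule AE_I') (auto simp: not_less)
  qed
  then have "AE v in site_clock. \<forall>N. \<exists>n. ring v n > real N" by (simp add: AE_all_countable)
  then show ?thesis
    by eventually_elim (meson less_trans reals_Archimedean2)
qed

lemma measurable_rings_in: "{v. \<exists>n. ring v n \<in> {a<..b}} \<in> K.events"
  using measurable_sets[OF measurable_ring, of "{a<..b}"]
  by (simp add: vimage_def Collect_ex_eq)

text \<open>Rings beyond the \<open>N\<close>-th do not occur before time \<open>T\<close> with high probability, and each of the first
  \<open>N\<close> has a density bounded by one.\<close>

lemma prob_ring_short_interval:
  assumes "\<rho> > 0"
  shows "\<exists>\<delta>>0. \<forall>a b. a \<le> b \<and> b \<le> T \<and> b - a \<le> \<delta> \<longrightarrow> K.prob {v. \<exists>n. ring v n \<in> {a<..b}} \<le> \<rho>"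
proof -
  have "\<exists>N. K.prob {v. ring v N \<le> T} < \<rho> / 2"
    using LIMSEQ_D[OF prob_ring_le_tendsto[of T], of "\<rho> / 2"] assms by auto
  then obtain N where N: "K.prob {v. ring v N \<le> T} < \<rho> / 2" by blast
  \<comment> \<open>The first \<open>N + 1\<close> rings share the remaining probability
    \<open>\<rho> / 2\<close>.\<close>
  define \<delta> where "\<delta> = \<rho> / (2 * (N + 1))"
  have "\<delta> > 0" using assms by (simp add: \<delta>_def)
  moreover have "K.prob {v. \<exists>n. ring v n \<in> {a<..b}} \<le> \<rho>" if "a \<le> b" "b \<le> T" "b - a \<le> \<delta>" for a b
  proof -
    have m: "{v. ring v n \<in> {a<..b}} \<in> K.events" "{v. ring v N \<le> T} \<in> K.events" for n
      using measurable_sets[OF measurable_ring[of n], of "{a<..b}"]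
        measurable_sets[OF measurable_ring[of N], of "{..T}"] by (simp_all add: vimage_def)
    have "K.prob {v. \<exists>n. ring v n \<in> {a<..b}} \<le>
        K.prob ({v. ring v N \<le> T} \<union> (\<Union>n\<in>{..N}. {v. ring v n \<in> {a<..b}}))"
    proof (rule K.finite_measure_mono_AE)
      show "AE v in site_clock. v \<in> {v. \<exists>n. ring v n \<in> {a<..b}} \<longrightarrow>
          v \<in> {v. ring v N \<le> T} \<union> (\<Union>n\<in>{..N}. {v. ring v n \<in> {a<..b}})"
        using AE_gap_pos
      proof eventually_elim
        case (elim v)
        show ?case
        proof
          assume "v \<in> {v. \<exists>n. ring v n \<in> {a<..b}}"
          then obtain n where n: "ring v n \<in> {a<..b}" by auto
          show "v \<in> {v. ring v N \<le> T} \<union> (\<Union>n\<in>{..N}. {v. ring v n \<in> {a<..b}})"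
          proof (cases "n \<le> N")
            case False
            then have "ring v N \<le> ring v n" using elim by (intro ring_mono) auto
            then show ?thesis using n that by auto
          qed (use n in auto)
        qed
      qed
    qed (use m in auto)
    also have "\<dots> \<le> K.prob {v. ring v N \<le> T} + K.prob (\<Union>n\<in>{..N}. {v. ring v n \<in> {a<..b}})"
      using m by (intro measure_Un_le) auto
    also have "K.prob (\<Union>n\<in>{..N}. {v. ring v n \<in> {a<..b}}) \<le> (\<Sum>n\<le>N. K.prob {v. ring v n \<in> {a<..b}})"
      using m by (intro measure_UNION_le) auto
    also have "\<dots> \<le> (\<Sum>n\<le>N. \<delta>)"
      using prob_ring_interval[OF that(1)] that(3) by (intro sum_mono) (meson order_trans)
    also have "\<dots> = \<rho> / 2" by (simp add: \<delta>_def field_simps)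
    finally show ?thesis using N by simp
  qed
  ultimately show ?thesis by blast
qed


section \<open>Cylinder events and the rounding of waiting times\<close>

abbreviation "spin_measure \<equiv> uniform_count_measure {-1, 1 :: int}"

lemma prob_cylinder:
  assumes "finite F" "\<And>x. x \<in> F \<Longrightarrow> A x \<subseteq> {-1, 1}" "\<And>x. x \<in> F \<Longrightarrow> B x \<in> K.events"
  shows "{\<omega> \<in> space ising_measure. \<forall>x\<in>F. fst \<omega> x \<in> A x \<and> snd \<omega> x \<in> B x} \<in> I.events"
    and "I.prob {\<omega> \<in> space ising_measure. \<forall>x\<in>F. fst \<omega> x \<in> A x \<and> snd \<omega> x \<in> B x} =
      (\<Prod>x\<in>F. measure spin_measure (A x) * K.prob (B x))"
proof -
  let ?A = "{\<eta> \<in> space bernoulli_initial. \<forall>x\<in>F. \<eta> x \<in> A x}"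
  let ?B = "{w \<in> space clock_measure. \<forall>x\<in>F. w x \<in> B x}"
  have eq: "{\<omega> \<in> space ising_measure. \<forall>x\<in>F. fst \<omega> x \<in> A x \<and> snd \<omega> x \<in> B x} = ?A \<times> ?B"
    by (auto simp: ising_measure_def space_pair_measure)
  have sA: "A x \<in> sets spin_measure" if "x \<in> F" for x
    using assms(2)[OF that] by (simp add: sets_uniform_count_measure)
  have A: "?A \<in> sets bernoulli_initial"
    unfolding bernoulli_initial_def using assms(1) sA by measurable
  have B: "?B \<in> Clk.events"
    using assms(1,3) by measurable
  show "{\<omega> \<in> space ising_measure. \<forall>x\<in>F. fst \<omega> x \<in> A x \<and> snd \<omega> x \<in> B x} \<in> I.events"
    by (subst eq) (use pair_measureI[OF A B] in \<open>simp add: ising_measure_def\<close>)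
  have "emeasure ising_measure (?A \<times> ?B) = emeasure bernoulli_initial ?A * emeasure clock_measure ?B"
    unfolding ising_measure_def by (rule Clk.emeasure_pair_measure_Times[OF A B])
  then have "I.prob (?A \<times> ?B) = measure bernoulli_initial ?A * Clk.prob ?B"
    by (simp add: measure_def enn2real_mult)
  also have "measure bernoulli_initial ?A = (\<Prod>x\<in>F. measure spin_measure (A x))"
    using assms(1) sA by (intro init.measure_PiM_Collect) auto
  also have "Clk.prob ?B = (\<Prod>x\<in>F. K.prob (B x))"
    using assms(1,3) by (intro clocks.measure_PiM_Collect) auto
  finally show "I.prob {\<omega> \<in> space ising_measure. \<forall>x\<in>F. fst \<omega> x \<in> A x \<and> snd \<omega> x \<in> B x} =
      (\<Prod>x\<in>F. measure spin_measure (A x) * K.prob (B x))"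
    unfolding eq by (simp add: prod.distrib)
qed

text \<open>Waiting times rounded up to multiples of \<open>\<delta>\<close> are geometric, so that the discretised rings of a
  site form a Bernoulli sequence.\<close>

definition gap :: "real \<Rightarrow> real \<times> bool \<Rightarrow> nat" where
  "gap \<delta> s = Suc (nat \<lfloor>fst s / \<delta>\<rfloor>)"

definition slot :: "real \<Rightarrow> (nat \<Rightarrow> real \<times> bool) \<Rightarrow> nat \<Rightarrow> nat" where
  "slot \<delta> v n = (\<Sum>k\<le>n. gap \<delta> (v k))"

definition slot_mark :: "real \<Rightarrow> (nat \<Rightarrow> real \<times> bool) \<Rightarrow> nat \<Rightarrow> bool option" where
  "slot_mark \<delta> v j =
     (if \<exists>n. slot \<delta> v n = j then Some (snd (v (LEAST n. slot \<delta> v n = j))) else None)"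

text \<open>A slot stays empty when a waiting time exceeds \<delta>, which has probability
  \<open>exp (- \<delta>)\<close>; otherwise it carries a fair coin.\<close>

definition mark_weight :: "real \<Rightarrow> bool option \<Rightarrow> real" where
  "mark_weight \<delta> y = (case y of None \<Rightarrow> exp (- \<delta>) | Some c \<Rightarrow> (1 - exp (- \<delta>)) / 2)"

lemma slot_strict_mono: "m < n \<Longrightarrow> slot \<delta> v m < slot \<delta> v n"
  by (rule lift_Suc_mono_less[of "slot \<delta> v"]) (auto simp: slot_def gap_def)

lemma slot_eq_iff: "slot \<delta> v m = slot \<delta> v n \<longleftrightarrow> m = n"
  by (metis slot_strict_mono less_irrefl linorder_neqE_nat)

lemma slot_mark_slot: "slot_mark \<delta> v (slot \<delta> v n) = Some (snd (v n))"
proof -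
  have "(LEAST m. slot \<delta> v m = slot \<delta> v n) = n"
    by (auto simp: slot_eq_iff intro!: Least_equality)
  then show ?thesis by (auto simp: slot_mark_def)
qed

lemma slot_mark_eq_Some_iff: "slot_mark \<delta> v j = Some c \<longleftrightarrow> (\<exists>n. slot \<delta> v n = j \<and> snd (v n) = c)"
proof (cases "\<exists>n. slot \<delta> v n = j")
  case True
  then obtain n where "slot \<delta> v n = j" by blast
  then show ?thesis using slot_mark_slot[of \<delta> v n] slot_eq_iff[of \<delta> v] by auto
qed (simp add: slot_mark_def)

lemma slot_mark_eq_None_iff: "slot_mark \<delta> v j = None \<longleftrightarrow> (\<forall>n. slot \<delta> v n \<noteq> j)"
  by (auto simp: slot_mark_def)

lemma slot_case_nat: "slot \<delta> (case_nat s \<omega>) n = (case n of 0 \<Rightarrow> gap \<delta> s | Suc m \<Rightarrow> gap \<delta> s + slot \<delta> \<omega> m)"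
  by (cases n) (simp_all only: slot_def sum.atMost_Suc_shift nat.case, simp_all)

lemma slot_pos: "slot \<delta> v n > 0"
  using member_le_sum[of 0 "{..n}" "\<lambda>k. gap \<delta> (v k)"] by (simp add: slot_def gap_def)

lemma slot_mark_case_nat:
  "j < gap \<delta> s \<Longrightarrow> slot_mark \<delta> (case_nat s \<omega>) j = None"
  "slot_mark \<delta> (case_nat s \<omega>) (gap \<delta> s) = Some (snd s)"
  "j > 0 \<Longrightarrow> slot_mark \<delta> (case_nat s \<omega>) (gap \<delta> s + j) = slot_mark \<delta> \<omega> j"
proof -
  show "j < gap \<delta> s \<Longrightarrow> slot_mark \<delta> (case_nat s \<omega>) j = None"
    by (auto simp: slot_mark_eq_None_iff slot_case_nat split: nat.splits)
  show "slot_mark \<delta> (case_nat s \<omega>) (gap \<delta> s) = Some (snd s)"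
    by (auto simp: slot_mark_eq_Some_iff slot_case_nat intro!: exI[of _ 0])
  assume j: "j > 0"
  show "slot_mark \<delta> (case_nat s \<omega>) (gap \<delta> s + j) = slot_mark \<delta> \<omega> j"
  proof (cases "slot_mark \<delta> \<omega> j")
    case None
    then have "slot_mark \<delta> (case_nat s \<omega>) (gap \<delta> s + j) = None"
      using j by (auto simp: slot_mark_eq_None_iff slot_case_nat split: nat.splits)
    then show ?thesis using None by simp
  next
    case (Some c)
    then obtain n where "slot \<delta> \<omega> n = j" "snd (\<omega> n) = c" by (auto simp: slot_mark_eq_Some_iff)
    then have "slot_mark \<delta> (case_nat s \<omega>) (gap \<delta> s + j) = Some c"
      by (auto simp: slot_mark_eq_Some_iff slot_case_nat intro!: exI[of _ "Suc n"])
    then show ?thesis using Some by simp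
  qed
qed

lemma measurable_gap_mark [measurable]: "gap \<delta> \<in> measurable (borel \<Otimes>\<^sub>M count_space UNIV) (count_space UNIV)"
  unfolding gap_def[abs_def] by measurable

lemma measurable_slot [measurable]: "(\<lambda>v. slot \<delta> v n) \<in> measurable site_clock (count_space UNIV)"
  unfolding slot_def by measurable

lemma sets_slot_mark: "{v. slot_mark \<delta> v j = y} \<in> K.events"
proof (cases y)
  case None
  have "{v \<in> space site_clock. \<forall>n. slot \<delta> v n \<noteq> j} \<in> K.events" by measurable
  then show ?thesis by (simp add: None slot_mark_eq_None_iff)
next
  case (Some c)
  have "{v \<in> space site_clock. \<exists>n. slot \<delta> v n = j \<and> snd (v n) = c} \<in> K.events" by measurable
  then show ?thesis by (simp add: Some slot_mark_eq_Some_iff)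
qed

lemma measurable_slot_mark [measurable]: "(\<lambda>v. slot_mark \<delta> v j) \<in> measurable site_clock (count_space UNIV)"
  by (intro measurable_count_space_eq2_countable[THEN iffD2])
    (auto simp: vimage_def sets_slot_mark)

lemma sets_slot_marks: "{v. \<forall>j\<in>{1..M}. slot_mark \<delta> v j = y j} \<in> K.events"
proof -
  have "{v \<in> space site_clock. \<forall>j\<in>{1..M}. slot_mark \<delta> v j = y j} \<in> K.events" by measurable
  then show ?thesis by simp
qed

lemma sets_mark: "sets mark_measure = sets (borel \<Otimes>\<^sub>M count_space UNIV)"
  by (intro sets_pair_measure_cong) (auto simp: sets_uniform_count_measure)

lemma space_mark [simp]: "space mark_measure = UNIV"
  by (simp add: space_pair_measure space_uniform_count_measure)

lemma sets_mark_Collect: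
  assumes "Measurable.pred (borel \<Otimes>\<^sub>M count_space UNIV) P"
  shows "{s. P s} \<in> sets mark_measure"
  using measurable_sets[OF assms, of "{True}"] unfolding sets_mark
  by (simp add: vimage_def space_pair_measure)

lemma prob_gap_gt:
  assumes "\<delta> > 0"
  shows "measure mark_measure {s. gap \<delta> s > M} = exp (- \<delta>) ^ M"
proof -
  have "measure mark_measure {s. gap \<delta> s > M} = measure mark_measure {s. fst s > real M * \<delta>}"
  \<comment> \<open>The two events differ only if the waiting time equals
    \<open>M * \<delta>\<close> or is not positive, which almost surely does not happen.\<close>
  proof (rule measure_eq_AE)
    have "AE x in density lborel (exponential_density 1). x \<noteq> real M * \<delta>"
      by (subst AE_density) (auto intro: AE_mp[OF AE_lborel_singleton[of "real M * \<delta>"]])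
    then have "AE s in mark_measure. fst s \<noteq> real M * \<delta>"
      by (subst (asm) distr_mark_fst[symmetric]) (auto intro: AE_distrD[rotated])
    then show "AE s in mark_measure. s \<in> {s. gap \<delta> s > M} \<longleftrightarrow> s \<in> {s. fst s > real M * \<delta>}"
      using AE_mark
    proof eventually_elim
      case (elim s)
      have "gap \<delta> s > M \<longleftrightarrow> M \<le> nat \<lfloor>fst s / \<delta>\<rfloor>" by (auto simp: gap_def)
      also have "\<dots> \<longleftrightarrow> real M \<le> fst s / \<delta>"
        using elim assms by (auto simp: le_nat_iff le_floor_iff)
      also have "\<dots> \<longleftrightarrow> real M * \<delta> \<le> fst s" using assms by (simp add: field_simps)
      finally show ?case using elim by auto
    qed
    show "{s. gap \<delta> s > M} \<in> sets mark_measure" by (rule sets_mark_Collect) measurable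
    show "{s. fst s > real M * \<delta>} \<in> sets mark_measure" by (rule sets_mark_Collect) measurable
  qed
  also have "\<dots> = exp (- (real M * \<delta>))" using assms by (intro prob_gap_greater) auto
  also have "\<dots> = exp (- \<delta>) ^ M" by (simp add: exp_of_nat_mult[symmetric])
  finally show ?thesis .
qed

lemma prob_gap_eq:
  assumes "\<delta> > 0" "g > 0"
  shows "measure mark_measure {s. gap \<delta> s = g \<and> snd s = c} = exp (- \<delta>) ^ (g - 1) * mark_weight \<delta> (Some c)"
proof -
  have eq: "{s. gap \<delta> s \<in> G \<and> snd s \<in> C} = {x. gap \<delta> (x, True) \<in> G} \<times> C" for G C
    by (auto simp: gap_def)
  have m: "{x. gap \<delta> (x, True) \<in> G} \<in> sets (density lborel (exponential_density 1))" for G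
  proof -
    have "(\<lambda>x. gap \<delta> (x, True)) \<in> measurable borel (count_space UNIV)"
      unfolding gap_def fst_conv by measurable
    from measurable_sets[OF this, of G] show ?thesis by (simp add: vimage_def)
  qed
  have prod: "measure mark_measure {s. gap \<delta> s \<in> G \<and> snd s \<in> C} =
      measure (density lborel (exponential_density 1)) {x. gap \<delta> (x, True) \<in> G} * (card C / 2)" for G C
  proof -
    have "emeasure mark_measure ({x. gap \<delta> (x, True) \<in> G} \<times> C) =
       emeasure (density lborel (exponential_density 1)) {x. gap \<delta> (x, True) \<in> G} * emeasure (uniform_count_measure UNIV) C"
      by (rule coins.emeasure_pair_measure_Times) (auto simp: m sets_uniform_count_measure)
    then show ?thesis
      unfolding eq by (simp add: measure_def enn2real_mult measure_uniform_count_measure[unfolded measure_def])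
  qed
  have "measure mark_measure {s. gap \<delta> s = g \<and> snd s = c} = measure mark_measure {s. gap \<delta> s = g} / 2"
    using prod[of "{g}" "{c}"] prod[of "{g}" UNIV] by simp
  also have "{s. gap \<delta> s = g} = {s. gap \<delta> s > g - 1} - {s. gap \<delta> s > g}" using assms by auto
  also have "measure mark_measure \<dots> = measure mark_measure {s. gap \<delta> s > g - 1} - measure mark_measure {s. gap \<delta> s > g}"
  proof (rule mark.P.finite_measure_Diff)
    show "{s. gap \<delta> s > g - 1} \<in> sets mark_measure" by (rule sets_mark_Collect) measurable
    show "{s. gap \<delta> s > g} \<in> sets mark_measure" by (rule sets_mark_Collect) measurable
  qed auto
  also have "\<dots> = exp (- \<delta>) ^ (g - 1) * (1 - exp (- \<delta>))"
    unfolding prob_gap_gt[OF assms(1)] using assms(2) by (cases g) (auto simp: algebra_simps)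
  finally show ?thesis by (simp add: mark_weight_def)
qed

text \<open>This is the renewal structure of the clock: the first mark is independent of the
  sequence of later marks, which again has the law \<open>site_clock\<close>.\<close>

lemma prob_case_nat:
  assumes "A \<in> sets mark_measure" "B \<in> K.events" "C \<in> K.events"
    and "\<And>s \<omega>. case_nat s \<omega> \<in> C \<longleftrightarrow> s \<in> A \<and> \<omega> \<in> B"
  shows "K.prob C = measure mark_measure A * K.prob B"
proof -
  have iter: "distr (mark_measure \<Otimes>\<^sub>M site_clock) site_clock (\<lambda>(s, \<omega>). case_nat s \<omega>) = site_clock"
    by (rule site.PiM_iter)
  have m [measurable]: "(\<lambda>(s, \<omega>). case_nat s \<omega>) \<in> measurable (mark_measure \<Otimes>\<^sub>M site_clock) site_clock"
    unfolding site_clock_def by measurable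
  have "emeasure site_clock C =
      emeasure (distr (mark_measure \<Otimes>\<^sub>M site_clock) site_clock (\<lambda>(s, \<omega>). case_nat s \<omega>)) C"
    by (simp only: iter)
  also have "\<dots> = emeasure (mark_measure \<Otimes>\<^sub>M site_clock) (A \<times> B)"
    using assms(3) by (subst emeasure_distr)
      (auto simp: assms(4) space_pair_measure space_uniform_count_measure intro!: arg_cong2[where f = emeasure])
  also have "\<dots> = emeasure mark_measure A * emeasure site_clock B"
    by (rule K.emeasure_pair_measure_Times[OF assms(1,2)])
  finally show ?thesis by (simp add: measure_def enn2real_mult)
qed

text \<open>The memoryless property in discrete form. Up to the first prescribed ring
  \<open>g\<close> all slots are empty, which fixes the first gap and its coin; after it the
  sequence starts afresh with \<open>M - g\<close> slots left, to which the induction hypothesis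
  applies.\<close>

lemma prob_slot_marks:
  assumes "\<delta> > 0"
  shows "K.prob {v. \<forall>j\<in>{1..M}. slot_mark \<delta> v j = y j} = (\<Prod>j\<in>{1..M}. mark_weight \<delta> (y j))"
proof (induction M arbitrary: y rule: less_induct)
  case (less M)
  have g0: "gap \<delta> s > 0" for s by (simp add: gap_def)
  show ?case
  proof (cases "\<exists>j\<in>{1..M}. y j \<noteq> None")
    case False
    \<comment> \<open>Without any prescribed ring, the first gap has to jump over all
      \<open>M\<close> slots, and the later marks are free.\<close>
    have "case_nat s \<omega> \<in> {v. \<forall>j\<in>{1..M}. slot_mark \<delta> v j = y j} \<longleftrightarrow> s \<in> {s. gap \<delta> s > M} \<and> \<omega> \<in> UNIV" for s \<omega>
    proof (cases "gap \<delta> s > M")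
      case True
      then have "slot_mark \<delta> (case_nat s \<omega>) j = y j" if "j \<in> {1..M}" for j
        using that False slot_mark_case_nat(1)[of j \<delta> s \<omega>] by auto
      then show ?thesis using True by auto
    next
      case gt: False
      then have "gap \<delta> s \<in> {1..M}" using g0[of s] by auto
      moreover from this have "y (gap \<delta> s) = None" using False by blast
      ultimately have "\<not> (\<forall>j\<in>{1..M}. slot_mark \<delta> (case_nat s \<omega>) j = y j)"
        using slot_mark_case_nat(2)[of \<delta> s \<omega>] by (metis option.distinct(1))
      then show ?thesis using gt by auto
    qed
    from prob_case_nat[OF _ _ sets_slot_marks this]
    have "K.prob {v. \<forall>j\<in>{1..M}. slot_mark \<delta> v j = y j} = measure mark_measure {s. gap \<delta> s > M}"
      using K.prob_space sets.top[of site_clock] sets_mark_Collect[of "\<lambda>s. gap \<delta> s > M"] by simp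
    also have "\<dots> = (\<Prod>j\<in>{1..M}. exp (- \<delta>))" using prob_gap_gt[OF assms] by simp
    also have "\<dots> = (\<Prod>j\<in>{1..M}. mark_weight \<delta> (y j))"
      by (intro prod.cong) (use False in \<open>auto simp: mark_weight_def\<close>)
    finally show ?thesis .
  next
    case True
    define g where "g = (LEAST j. j \<in> {1..M} \<and> y j \<noteq> None)"
    have g: "g \<in> {1..M}" "y g \<noteq> None"
      using LeastI_ex[of "\<lambda>j. j \<in> {1..M} \<and> y j \<noteq> None"] True unfolding g_def by blast+
    have before: "y j = None" if "1 \<le> j" "j < g" for j
      using not_less_Least[of j "\<lambda>j. j \<in> {1..M} \<and> y j \<noteq> None"] that g unfolding g_def[symmetric] by auto
    obtain c where c: "y g = Some c" using g by auto
    have "case_nat s \<omega> \<in> {v. \<forall>j\<in>{1..M}. slot_mark \<delta> v j = y j} \<longleftrightarrow>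
        s \<in> {s. gap \<delta> s = g \<and> snd s = c} \<and> \<omega> \<in> {v. \<forall>j\<in>{1..M-g}. slot_mark \<delta> v j = y (g + j)}" for s \<omega>
    proof
      assume "case_nat s \<omega> \<in> {v. \<forall>j\<in>{1..M}. slot_mark \<delta> v j = y j}"
      then have *: "slot_mark \<delta> (case_nat s \<omega>) j = y j" if "1 \<le> j" "j \<le> M" for j using that by auto
      have "\<not> g < gap \<delta> s" using *[of g] slot_mark_case_nat(1)[of g \<delta> s \<omega>] g by auto
      moreover have "\<not> gap \<delta> s < g"
        using *[of "gap \<delta> s"] before[of "gap \<delta> s"] slot_mark_case_nat(2)[of \<delta> s \<omega>] g g0[of s] by auto
      ultimately have eq: "gap \<delta> s = g" by simp
      moreover have "snd s = c" using *[of g] slot_mark_case_nat(2)[of \<delta> s \<omega>] g eq c by auto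
      moreover have "slot_mark \<delta> \<omega> j = y (g + j)" if "j \<in> {1..M-g}" for j
        using *[of "g + j"] slot_mark_case_nat(3)[of j \<delta> s \<omega>] that eq by auto
      ultimately show "s \<in> {s. gap \<delta> s = g \<and> snd s = c} \<and> \<omega> \<in> {v. \<forall>j\<in>{1..M-g}. slot_mark \<delta> v j = y (g + j)}"
        by auto
    next
      assume as: "s \<in> {s. gap \<delta> s = g \<and> snd s = c} \<and> \<omega> \<in> {v. \<forall>j\<in>{1..M-g}. slot_mark \<delta> v j = y (g + j)}"
      have "slot_mark \<delta> (case_nat s \<omega>) j = y j" if j: "j \<in> {1..M}" for j
      proof -
        consider "j < g" | "j = g" | "j > g" by linarith
        then show ?thesis
        proof cases
          case 1
          then show ?thesis using slot_mark_case_nat(1)[of j \<delta> s \<omega>] before j as by auto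
        next
          case 2
          then show ?thesis using slot_mark_case_nat(2)[of \<delta> s \<omega>] c as by auto
        next
          case 3
          then obtain i where i: "j = g + i" "i > 0" using less_imp_add_positive by blast
          then show ?thesis using slot_mark_case_nat(3)[of i \<delta> s \<omega>] as j by auto
        qed
      qed
      then show "case_nat s \<omega> \<in> {v. \<forall>j\<in>{1..M}. slot_mark \<delta> v j = y j}" by auto
    qed
    from prob_case_nat[OF _ sets_slot_marks sets_slot_marks this]
    have "K.prob {v. \<forall>j\<in>{1..M}. slot_mark \<delta> v j = y j} =
        measure mark_measure {s. gap \<delta> s = g \<and> snd s = c} *
        K.prob {v. \<forall>j\<in>{1..M-g}. slot_mark \<delta> v j = y (g + j)}"
      using sets_mark_Collect[of "\<lambda>s. gap \<delta> s = g \<and> snd s = c"] by simp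
    also have "measure mark_measure {s. gap \<delta> s = g \<and> snd s = c} = (\<Prod>j\<in>{1..<g}. mark_weight \<delta> (y j)) * mark_weight \<delta> (y g)"
    proof -
      have "(\<Prod>j\<in>{1..<g}. mark_weight \<delta> (y j)) = (\<Prod>j\<in>{1..<g}. exp (- \<delta>))"
        by (intro prod.cong) (use before in \<open>auto simp: mark_weight_def\<close>)
      then show ?thesis using prob_gap_eq[OF assms, of g c] g c by simp
    qed
    also have "K.prob {v. \<forall>j\<in>{1..M-g}. slot_mark \<delta> v j = y (g + j)} = (\<Prod>j\<in>{1..M-g}. mark_weight \<delta> (y (g + j)))"
      using less[of "M - g" "\<lambda>j. y (g + j)"] g by auto
    also have "\<dots> = (\<Prod>j\<in>{g<..M}. mark_weight \<delta> (y j))"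
      by (rule prod.reindex_bij_witness[of _ "\<lambda>j. j - g" "\<lambda>j. g + j"]) (use g in auto)
    also have "(\<Prod>j\<in>{1..<g}. mark_weight \<delta> (y j)) * mark_weight \<delta> (y g) * (\<Prod>j\<in>{g<..M}. mark_weight \<delta> (y j)) =
        (\<Prod>j\<in>{1..M}. mark_weight \<delta> (y j))"
    proof -
      have "{1..M} = {1..<g} \<union> insert g {g<..M}" using g by auto
      moreover have "{1..<g} \<inter> insert g {g<..M} = {}" by auto
      ultimately have "(\<Prod>j\<in>{1..M}. mark_weight \<delta> (y j)) =
          (\<Prod>j\<in>{1..<g}. mark_weight \<delta> (y j)) * (\<Prod>j\<in>insert g {g<..M}. mark_weight \<delta> (y j))"
        by (simp only: prod.union_disjoint finite_atLeastLessThan finite_insert finite_greaterThanAtMost)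
      then show ?thesis by (simp add: mult.assoc)
    qed
    finally show ?thesis .
  qed
qed

section \<open>Trajectories\<close>

declare split_paired_All [simp del] split_paired_Ex [simp del]

text \<open>A local version of \<open>obeys_clocks\<close> that constrains only sites of
  \<open>D\<close>, times up to \<open>T\<close>, and left limits near the ringing site. The process
  and the finite-volume dynamics both satisfy it, which makes them comparable.\<close>

definition follows :: "clocks \<Rightarrow> site set \<Rightarrow> real \<Rightarrow> (real \<Rightarrow> config) \<Rightarrow> bool" where
  "follows w D T s \<longleftrightarrow>
     (\<forall>x\<in>D. \<forall>a b. 0 \<le> a \<and> a \<le> b \<and> b \<le> T \<and> (\<forall>n. ring_time w x n \<notin> {a<..b}) \<longrightarrow> s b x = s a x) \<and>
     (\<forall>x\<in>D. \<forall>n. 0 < ring_time w x n \<and> ring_time w x n \<le> T \<longrightarrow>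
        (\<exists>\<eta>. (\<forall>y. y = x \<or> neighbor x y \<longrightarrow> (\<forall>\<^sub>F u in at_left (ring_time w x n). s u y = \<eta> y)) \<and>
             s (ring_time w x n) x = updated_spin \<eta> x (coin w x n)))"

definition ringing :: "clocks \<Rightarrow> real \<Rightarrow> real \<Rightarrow> site set" where
  "ringing w a b = {x. \<exists>n. ring_time w x n \<in> {a<..b}}"

definition regular_clocks :: "clocks \<Rightarrow> bool" where
  "regular_clocks w \<longleftrightarrow> (\<forall>x n. fst (w x n) > 0) \<and> (\<forall>x T. \<exists>n. ring_time w x n > T) \<and>
     (\<forall>x y m n. ring_time w x m = ring_time w y n \<longrightarrow> x = y)"

lemma obeys_clocks_follows: "obeys_clocks w s \<Longrightarrow> follows w D T s"
  unfolding obeys_clocks_def follows_def by blast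

lemma follows_subset: "follows w D T s \<Longrightarrow> D' \<subseteq> D \<Longrightarrow> follows w D' T s"
  unfolding follows_def by blast

lemma follows_const:
  assumes "follows w D T s" "x \<in> D" "0 \<le> a" "a \<le> b" "b \<le> T" "\<And>n. ring_time w x n \<notin> {a<..b}"
  shows "s b x = s a x"
  using assms unfolding follows_def by blast

lemma follows_ring:
  assumes "follows w D T s" "x \<in> D" "0 < ring_time w x n" "ring_time w x n \<le> T"
  obtains \<eta> where "\<And>y. y = x \<or> neighbor x y \<Longrightarrow> \<forall>\<^sub>F u in at_left (ring_time w x n). s u y = \<eta> y"
    "s (ring_time w x n) x = updated_spin \<eta> x (coin w x n)"
  using assms unfolding follows_def by blast

lemma disagreements_cong:
  assumes "\<And>y. y = x \<or> neighbor x y \<Longrightarrow> \<eta> y = \<eta>' y"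
  shows "disagreements \<eta> x = disagreements \<eta>' x"
proof -
  have "{y. neighbor x y \<and> \<eta> y \<noteq> \<eta> x} = {y. neighbor x y \<and> \<eta>' y \<noteq> \<eta>' x}"
    using assms by auto
  then show ?thesis by (simp add: disagreements_def)
qed

lemma updated_spin_cong:
  assumes "\<And>y. y = x \<or> neighbor x y \<Longrightarrow> \<eta> y = \<eta>' y"
  shows "updated_spin \<eta> x c = updated_spin \<eta>' x c"
  using disagreements_cong[of x \<eta> \<eta>'] assms by (simp add: updated_spin_def)

lemma ring_time_strict_mono:
  assumes "\<And>k. fst (w x k) > 0" "m < n"
  shows "ring_time w x m < ring_time w x n"
  by (rule lift_Suc_mono_less[OF _ assms(2), of "ring_time w x"]) (auto simp: ring_time_def assms(1))

lemma ring_time_pos: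
  assumes "\<And>k. fst (w x k) > 0"
  shows "ring_time w x n > 0"
  unfolding ring_time_def using assms by (intro sum_pos) auto

lemma finite_rings:
  assumes "regular_clocks w"
  shows "finite {n. ring_time w x n \<le> T}"
proof -
  obtain N where N: "ring_time w x N > T" using assms unfolding regular_clocks_def by blast
  have "n < N" if "ring_time w x n \<le> T" for n
  proof (rule ccontr)
    assume "\<not> n < N"
    then have "ring_time w x N \<le> ring_time w x n"
      using ring_time_strict_mono[of w x N n] assms by (cases "n = N") (auto simp: regular_clocks_def)
    then show False using N that by simp
  qed
  then have "{n. ring_time w x n \<le> T} \<subseteq> {..<N}" by auto
  then show ?thesis by (rule finite_subset) simp
qed

text \<open>Between rings a spin is constant, so a difference at time \<open>u\<close> is already
  present at the last ring before; without any ring since time \<open>a\<close> the trajectories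
  would still agree.\<close>

lemma follows_last_ring:
  assumes w: "regular_clocks w" and s: "follows w D T s" "follows w D T s'" and x: "x \<in> D"
    and au: "0 \<le> a" "a \<le> u" "u \<le> T" and agree: "s a x = s' a x" and ne: "s u x \<noteq> s' u x"
  obtains n where "ring_time w x n \<in> {a<..u}" "s (ring_time w x n) x \<noteq> s' (ring_time w x n) x"
proof -
  let ?R = "ring_time w x ` {n. ring_time w x n \<in> {a<..u}}"
  have fin: "finite ?R"
    by (intro finite_imageI finite_subset[OF _ finite_rings[OF w, of x u]]) auto
  have "?R \<noteq> {}"
  proof
    assume "?R = {}"
    then have "\<And>n. ring_time w x n \<notin> {a<..u}" by blast
    then have "s u x = s a x" "s' u x = s' a x" using follows_const s x au by blast+
    then show False using agree ne by simp
  qed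
  with fin have "Max ?R \<in> ?R" by (rule Max_in)
  then obtain n where n: "ring_time w x n \<in> {a<..u}" "Max ?R = ring_time w x n" by auto
  have last: "ring_time w x m \<notin> {ring_time w x n<..u}" for m
  proof
    assume m: "ring_time w x m \<in> {ring_time w x n<..u}"
    then have "ring_time w x m \<in> ?R" using n(1) by auto
    then have "ring_time w x m \<le> Max ?R" by (rule Max_ge[OF fin])
    then show False using m n(2) by simp
  qed
  then have "s u x = s (ring_time w x n) x" "s' u x = s' (ring_time w x n) x"
    using s x au n(1) by (auto intro!: follows_const[where D = D and T = T])
  then show ?thesis using that n(1) ne by simp
qed

text \<open>Consider the first ring in \<open>D\<close> after which the two trajectories differ: up to that time they
  agree on \<open>D\<close> and its neighbours, so the update there is the same.\<close>

lemma follows_agree: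
  assumes w: "regular_clocks w" and D: "finite D" and s: "follows w D T s" "follows w D T s'"
    and ab: "0 \<le> a" "b \<le> T" and start: "\<And>x. x \<in> D \<Longrightarrow> s a x = s' a x"
    and bdry: "\<And>x y u. x \<in> D \<Longrightarrow> neighbor x y \<Longrightarrow> y \<notin> D \<Longrightarrow> a \<le> u \<Longrightarrow> u \<le> b \<Longrightarrow> s u y = s' u y"
    and u: "a \<le> u" "u \<le> b" "x \<in> D"
  shows "s u x = s' u x"
proof (rule ccontr)
  assume ne: "s u x \<noteq> s' u x"
  define Bad where "Bad = {ring_time w y n |y n. y \<in> D \<and> ring_time w y n \<in> {a<..b} \<and>
    s (ring_time w y n) y \<noteq> s' (ring_time w y n) y}"
  have "Bad \<subseteq> (\<Union>y\<in>D. ring_time w y ` {n. ring_time w y n \<le> b})" by (auto simp: Bad_def)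
  then have fin: "finite Bad"
    by (rule finite_subset) (use D finite_rings[OF w] in auto)
  have bad: "\<exists>r\<in>Bad. r \<le> v" if v: "a \<le> v" "v \<le> b" "y \<in> D" "s v y \<noteq> s' v y" for v y
  proof -
    have "v \<le> T" using v(2) ab(2) by simp
    then obtain n where n: "ring_time w y n \<in> {a<..v}" "s (ring_time w y n) y \<noteq> s' (ring_time w y n) y"
      using follows_last_ring[OF w s v(3) ab(1) v(1) _ start[OF v(3)] v(4)] by blast
    then have "ring_time w y n \<in> {a<..b}" using v by auto
    then have "ring_time w y n \<in> Bad" using v(3) n(2) unfolding Bad_def by blast
    then show ?thesis using n(1) by auto
  qed
  have "Bad \<noteq> {}" using bad[OF u ne] by blast
  with fin have "Min Bad \<in> Bad" by (rule Min_in)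
  then obtain y n where y: "Min Bad = ring_time w y n" "y \<in> D" "ring_time w y n \<in> {a<..b}"
    "s (ring_time w y n) y \<noteq> s' (ring_time w y n) y" unfolding Bad_def by blast
  let ?r = "ring_time w y n"
  have before: "s v z = s' v z" if v: "a \<le> v" "v < ?r" "z = y \<or> neighbor y z" for v z
  proof (cases "z \<in> D")
    case True
    show ?thesis
    proof (rule ccontr)
      assume "s v z \<noteq> s' v z"
      moreover have "v \<le> b" using v y(3) by auto
      ultimately obtain r where "r \<in> Bad" "r \<le> v" using bad[of v z] v(1) True by blast
      then show False using Min_le[OF fin, of r] y(1) v by simp
    qed
  next
    case False
    then show ?thesis using bdry[OF y(2), of z v] that y by auto
  qed
  have pos: "0 < ?r" "?r \<le> T" using y(3) ab by auto
  obtain \<eta> where \<eta>: "\<And>z. z = y \<or> neighbor y z \<Longrightarrow> \<forall>\<^sub>F u in at_left ?r. s u z = \<eta> z"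
    "s ?r y = updated_spin \<eta> y (coin w y n)" using follows_ring[OF s(1) y(2) pos] by metis
  obtain \<eta>' where \<eta>': "\<And>z. z = y \<or> neighbor y z \<Longrightarrow> \<forall>\<^sub>F u in at_left ?r. s' u z = \<eta>' z"
    "s' ?r y = updated_spin \<eta>' y (coin w y n)" using follows_ring[OF s(2) y(2) pos] by metis
  have "\<eta> z = \<eta>' z" if z: "z = y \<or> neighbor y z" for z
  proof -
    have "\<forall>\<^sub>F u in at_left ?r. u \<in> {a<..<?r}"
      using y(3) by (intro eventually_at_left_real) auto
    then have "\<forall>\<^sub>F u in at_left ?r. \<eta> z = \<eta>' z"
      using \<eta>(1)[OF z] \<eta>'(1)[OF z] by eventually_elim (use before[OF _ _ z] in force)
    then show ?thesis by (simp add: trivial_limit_at_left_real eventually_const)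
  qed
  then have "updated_spin \<eta> y (coin w y n) = updated_spin \<eta>' y (coin w y n)" by (rule updated_spin_cong)
  then show False using \<eta>(2) \<eta>'(2) y(4) by simp
qed

lemma finite_neighbors: "finite {y. neighbor x y}"
proof -
  have "{y. neighbor x y} \<subseteq> rect (fst x - 1) (fst x + 1) (snd x - 1) (snd x + 1)"
    by (auto simp: neighbor_iff')
  then show ?thesis by (rule finite_subset) simp
qed

text \<open>Sites that do not ring keep their value from time \<open>a\<close>, and every site that
  borders a ringing cluster from outside is of this kind. So the finite clusters that meet
  \<open>B\<close>, with their frozen boundary, determine \<open>B\<close> at time
  \<open>b\<close>.\<close>

lemma finite_influence_step:
  assumes w: "regular_clocks w" and B: "finite B" and ab: "0 \<le> a" "a \<le> b" "b \<le> T"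
    and fin: "\<And>x. finite {y. linked neighbor (ringing w a b) x y}"
  shows "\<exists>\<Lambda>. finite \<Lambda> \<and> (\<forall>s s'. follows w \<Lambda> T s \<longrightarrow> follows w \<Lambda> T s' \<longrightarrow>
    (\<forall>x\<in>\<Lambda>. s a x = s' a x) \<longrightarrow> (\<forall>x\<in>B. s b x = s' b x))"
proof -
  define D where "D = (\<Union>x\<in>B. {y. linked neighbor (ringing w a b) x y})"
  define \<Lambda> where "\<Lambda> = B \<union> D \<union> (\<Union>x\<in>D. {y. neighbor x y})"
  have D: "finite D" unfolding D_def using B fin by auto
  have "finite \<Lambda>" unfolding \<Lambda>_def using B D finite_neighbors by auto
  moreover have "s b x = s' b x" if s: "follows w \<Lambda> T s" "follows w \<Lambda> T s'" "\<forall>x\<in>\<Lambda>. s a x = s' a x" and x: "x \<in> B" for s s' x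
  proof -
    have quiet: "s u y = s' u y" if "y \<in> \<Lambda>" "y \<notin> ringing w a b" "a \<le> u" "u \<le> b" for y u
    proof -
      have "\<And>n. ring_time w y n \<notin> {a<..u}" using that unfolding ringing_def by force
      moreover have "u \<le> T" using that ab by simp
      ultimately have "s u y = s a y" "s' u y = s' a y"
        using follows_const[OF s(1) that(1) ab(1) that(3)] follows_const[OF s(2) that(1) ab(1) that(3)] by blast+
      then show ?thesis using s(3) that by simp
    qed
    show ?thesis
    proof (cases "x \<in> ringing w a b")
      case True
      then have "x \<in> D" using x unfolding D_def by (auto intro: linked_refl)
      show ?thesis
      proof (rule follows_agree[OF w D _ _ ab(1) ab(3) _ _ ab(2) order_refl \<open>x \<in> D\<close>])
        show "follows w D T s" "follows w D T s'" using s by (auto intro: follows_subset simp: \<Lambda>_def)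
        fix y assume "y \<in> D"
        then show "s a y = s' a y" using s(3) by (auto simp: \<Lambda>_def)
      next
        fix y z u assume y: "y \<in> D" "neighbor y z" "z \<notin> D" "a \<le> u" "u \<le> b"
        obtain v where v: "v \<in> B" "linked neighbor (ringing w a b) v y" using y(1) unfolding D_def by blast
        have "z \<notin> ringing w a b"
        proof
          assume "z \<in> ringing w a b"
          then have "linked neighbor (ringing w a b) v z" using v(2) y(2) by (blast intro: linked_step)
          then show False using y(3) v(1) unfolding D_def by blast
        qed
        then show "s u z = s' u z" using y quiet[of z u] by (auto simp: \<Lambda>_def)
      qed
    next
      case False
      then show ?thesis using quiet[of x b] x ab by (auto simp: \<Lambda>_def)
    qed
  qed
  ultimately show ?thesis by blast
qed

definition finite_range :: "clocks \<Rightarrow> real \<Rightarrow> nat \<Rightarrow> bool" where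
  "finite_range w T K \<longleftrightarrow>
     (\<forall>k<K. \<forall>x. finite {y. linked neighbor (ringing w (T * k / K) (T * Suc k / K)) x y})"

text \<open>The time interval is cut into \<open>K\<close> pieces, and the set that matters is
  enlarged backwards over one piece at a time. It stays finite at each of the finitely many
  stages.\<close>

lemma finite_influence:
  assumes w: "regular_clocks w" and K: "finite_range w T K" "K > 0" and T: "T \<ge> 0" and B: "finite B"
  shows "\<exists>\<Lambda>. finite \<Lambda> \<and> (\<forall>s s'. follows w \<Lambda> T s \<longrightarrow> follows w \<Lambda> T s' \<longrightarrow>
    (\<forall>x\<in>\<Lambda>. s 0 x = s' 0 x) \<longrightarrow> (\<forall>x\<in>B. s T x = s' T x))"
proof -
  have "\<exists>\<Lambda>. finite \<Lambda> \<and> (\<forall>s s'. follows w \<Lambda> T s \<longrightarrow> follows w \<Lambda> T s' \<longrightarrow>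
    (\<forall>x\<in>\<Lambda>. s 0 x = s' 0 x) \<longrightarrow> (\<forall>x\<in>B. s (T * k / K) x = s' (T * k / K) x))" if "k \<le> K" for k
    using that B
  proof (induction k arbitrary: B)
    case 0
    then show ?case by (intro exI[of _ B]) auto
  next
    case (Suc k)
    have "\<exists>\<Lambda>. finite \<Lambda> \<and> (\<forall>s s'. follows w \<Lambda> T s \<longrightarrow> follows w \<Lambda> T s' \<longrightarrow>
      (\<forall>x\<in>\<Lambda>. s (T * k / K) x = s' (T * k / K) x) \<longrightarrow> (\<forall>x\<in>B. s (T * Suc k / K) x = s' (T * Suc k / K) x))"
    proof (rule finite_influence_step[OF w Suc.prems(2)])
      show "0 \<le> T * k / K" using T by simp
      show "T * k / K \<le> T * Suc k / K" using T by (intro divide_right_mono mult_left_mono) auto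
      have "T * Suc k / K \<le> T * K / K" using T Suc.prems(1) by (intro divide_right_mono mult_left_mono) auto
      then show "T * Suc k / K \<le> T" using K(2) by simp
      show "finite {y. linked neighbor (ringing w (T * real k / real K) (T * real (Suc k) / real K)) x y}" for x
        using K(1) Suc.prems(1) unfolding finite_range_def by auto
    qed
    then obtain L1 where L1: "finite L1" "\<And>s s'. follows w L1 T s \<Longrightarrow> follows w L1 T s' \<Longrightarrow>
      (\<forall>x\<in>L1. s (T * k / K) x = s' (T * k / K) x) \<Longrightarrow> (\<forall>x\<in>B. s (T * Suc k / K) x = s' (T * Suc k / K) x)"
      by blast
    obtain L2 where L2: "finite L2" "\<And>s s'. follows w L2 T s \<Longrightarrow> follows w L2 T s' \<Longrightarrow>
      (\<forall>x\<in>L2. s 0 x = s' 0 x) \<Longrightarrow> (\<forall>x\<in>L1. s (T * k / K) x = s' (T * k / K) x)"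
      using Suc.IH[of L1] L1(1) Suc.prems(1) by auto
    have sub: "follows w L1 T s \<and> follows w L2 T s" if "follows w (L1 \<union> L2) T s" for s
      using follows_subset[OF that] by blast
    show ?case
    proof (intro exI[of _ "L1 \<union> L2"] conjI allI impI)
      show "finite (L1 \<union> L2)" using L1(1) L2(1) by simp
      fix s s' assume s: "follows w (L1 \<union> L2) T s" "follows w (L1 \<union> L2) T s'" "\<forall>x\<in>L1 \<union> L2. s 0 x = s' 0 x"
      have "\<forall>x\<in>L1. s (T * k / K) x = s' (T * k / K) x"
        by (rule L2(2)) (use sub s in auto)
      then show "\<forall>x\<in>B. s (T * Suc k / K) x = s' (T * Suc k / K) x"
        by (intro L1(2)) (use sub s in auto)
    qed
  qed
  from this[of K] show ?thesis using K(2) by simp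
qed

section \<open>Dynamics in a finite volume\<close>

definition apply_ring :: "clocks \<Rightarrow> site \<times> nat \<Rightarrow> config \<Rightarrow> config" where
  "apply_ring w m \<eta> = \<eta>(fst m := updated_spin \<eta> (fst m) (coin w (fst m) (snd m)))"

lemma fold_apply_ring_other: "x \<notin> fst ` set L \<Longrightarrow> fold (apply_ring w) L \<eta> x = \<eta> x"
  by (induction L arbitrary: \<eta>) (auto simp: apply_ring_def)

lemma filter_le_append:
  fixes f :: "'b \<Rightarrow> real"
  assumes "sorted_wrt (\<lambda>m m'. f m < f m') L" "a \<le> b"
  shows "filter (\<lambda>m. f m \<le> b) L = filter (\<lambda>m. f m \<le> a) L @ filter (\<lambda>m. a < f m \<and> f m \<le> b) L"
  using assms(1)
proof (induction L)
  case (Cons m L)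
  show ?case
  proof (cases "f m \<le> a")
    case False
    then have "filter (\<lambda>m. f m \<le> a) L = []"
      using Cons.prems by (auto simp: filter_empty_conv)
    then show ?thesis using Cons False by auto
  qed (use Cons assms(2) in auto)
qed simp

definition ring_of :: "clocks \<Rightarrow> site \<times> nat \<Rightarrow> real" where
  "ring_of w m = ring_time w (fst m) (snd m)"

text \<open>The marks in chronological order. They are sorted through their times, which determine
  them when the clocks are regular.\<close>

definition ring_list :: "clocks \<Rightarrow> site set \<Rightarrow> real \<Rightarrow> (site \<times> nat) list" where
  "ring_list w \<Lambda> T =
     map (inv (ring_of w)) (sorted_list_of_set (ring_of w ` {m. fst m \<in> \<Lambda> \<and> ring_of w m \<le> T}))"

lemma ring_of_inj:
  assumes "regular_clocks w"
  shows "ring_of w m = ring_of w m' \<longleftrightarrow> m = m'"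
proof
  assume eq: "ring_of w m = ring_of w m'"
  then have fst: "fst m = fst m'" using assms unfolding regular_clocks_def ring_of_def by blast
  have "snd m = snd m'"
    using ring_time_strict_mono[of w "fst m" "snd m" "snd m'"] ring_time_strict_mono[of w "fst m" "snd m'" "snd m"]
      eq fst assms unfolding regular_clocks_def ring_of_def by (cases "snd m" "snd m'" rule: linorder_cases) auto
  then show "m = m'" using fst by (simp add: prod_eq_iff)
qed simp

lemma finite_marks:
  assumes "regular_clocks w" "finite \<Lambda>"
  shows "finite {m. fst m \<in> \<Lambda> \<and> ring_of w m \<le> T}"
proof -
  have "{m. fst m \<in> \<Lambda> \<and> ring_of w m \<le> T} = (SIGMA x:\<Lambda>. {n. ring_time w x n \<le> T})"
    by (auto simp: ring_of_def)
  then show ?thesis using finite_rings[OF assms(1)] assms(2) by auto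
qed

lemma ring_list:
  assumes "regular_clocks w" "finite \<Lambda>"
  shows "set (ring_list w \<Lambda> T) = {m. fst m \<in> \<Lambda> \<and> ring_of w m \<le> T}"
    and "sorted_wrt (\<lambda>m m'. ring_of w m < ring_of w m') (ring_list w \<Lambda> T)"
proof -
  let ?S = "{m. fst m \<in> \<Lambda> \<and> ring_of w m \<le> T}"
  have inj: "inj (ring_of w)" using ring_of_inj[OF assms(1)] by (auto simp: inj_on_def)
  note fin = finite_marks[OF assms, of T]
  show "set (ring_list w \<Lambda> T) = ?S"
    unfolding ring_list_def using fin inj by (simp add: image_image)
  have "sorted_wrt (\<lambda>r r'. ring_of w (inv (ring_of w) r) < ring_of w (inv (ring_of w) r'))
      (sorted_list_of_set (ring_of w ` ?S))"
  proof (rule sorted_wrt_mono_rel[OF _ strict_sorted_list_of_set])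
    fix r r' assume "r \<in> set (sorted_list_of_set (ring_of w ` ?S))" "r' \<in> set (sorted_list_of_set (ring_of w ` ?S))" "r < r'"
    then show "ring_of w (inv (ring_of w) r) < ring_of w (inv (ring_of w) r')"
      using fin by (auto simp: f_inv_into_f)
  qed
  then show "sorted_wrt (\<lambda>m m'. ring_of w m < ring_of w m') (ring_list w \<Lambda> T)"
    by (simp add: ring_list_def sorted_wrt_map)
qed

text \<open>Spins outside \<Lambda> are never updated, so the boundary condition is frozen at the
  initial state.\<close>

definition finite_volume :: "clocks \<Rightarrow> site set \<Rightarrow> real \<Rightarrow> config \<Rightarrow> real \<Rightarrow> config" where
  "finite_volume w \<Lambda> T \<eta> u = fold (apply_ring w) (filter (\<lambda>m. ring_of w m \<le> u) (ring_list w \<Lambda> T)) \<eta>"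

lemma finite_volume_end:
  assumes "regular_clocks w" "finite \<Lambda>"
  shows "finite_volume w \<Lambda> T \<eta> T = fold (apply_ring w) (ring_list w \<Lambda> T) \<eta>"
proof -
  have "filter (\<lambda>m. ring_of w m \<le> T) (ring_list w \<Lambda> T) = ring_list w \<Lambda> T"
    using ring_list(1)[OF assms, of T] by (simp add: filter_id_conv)
  then show ?thesis by (simp add: finite_volume_def)
qed

lemma finite_volume_start:
  assumes "regular_clocks w" "finite \<Lambda>"
  shows "finite_volume w \<Lambda> T \<eta> 0 = \<eta>"
proof -
  have "ring_of w m > 0" for m
    using ring_time_pos[of w "fst m" "snd m"] assms by (auto simp: regular_clocks_def ring_of_def)
  then have "filter (\<lambda>m. ring_of w m \<le> 0) (ring_list w \<Lambda> T) = []"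
    by (auto simp: filter_empty_conv not_le)
  then show ?thesis by (simp add: finite_volume_def)
qed

lemma finite_volume_follows:
  assumes w: "regular_clocks w" and \<Lambda>: "finite \<Lambda>"
  shows "follows w \<Lambda> T (finite_volume w \<Lambda> T \<eta>)"
  unfolding follows_def
proof (intro conjI ballI allI impI)
  fix x a b assume x: "x \<in> \<Lambda>" and ab: "0 \<le> a \<and> a \<le> b \<and> b \<le> T \<and> (\<forall>n. ring_time w x n \<notin> {a<..b})"
  let ?L = "ring_list w \<Lambda> T"
  have "finite_volume w \<Lambda> T \<eta> b =
      fold (apply_ring w) (filter (\<lambda>m. a < ring_of w m \<and> ring_of w m \<le> b) ?L) (finite_volume w \<Lambda> T \<eta> a)"
    unfolding finite_volume_def using filter_le_append[OF ring_list(2)[OF w \<Lambda>, of T], of a b] ab by simp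
  moreover have "x \<notin> fst ` set (filter (\<lambda>m. a < ring_of w m \<and> ring_of w m \<le> b) ?L)"
    using ab by (auto simp: ring_of_def)
  ultimately show "finite_volume w \<Lambda> T \<eta> b x = finite_volume w \<Lambda> T \<eta> a x"
    by (simp add: fold_apply_ring_other)
next
  fix x n assume x: "x \<in> \<Lambda>" and r: "0 < ring_time w x n \<and> ring_time w x n \<le> T"
  let ?L = "ring_list w \<Lambda> T" and ?r = "ring_time w x n"
  have "(x, n) \<in> set ?L" using ring_list(1)[OF w \<Lambda>] x r by (auto simp: ring_of_def)
  then obtain L1 L2 where L: "?L = L1 @ (x, n) # L2" by (meson split_list)
  have rx: "ring_of w (x, n) = ?r" by (simp add: ring_of_def)
  have L1: "ring_of w m < ?r" if "m \<in> set L1" for m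
    using ring_list(2)[OF w \<Lambda>, of T] that unfolding L by (auto simp: sorted_wrt_append rx)
  have L2: "ring_of w m > ?r" if "m \<in> set L2" for m
    using ring_list(2)[OF w \<Lambda>, of T] that unfolding L by (auto simp: sorted_wrt_append rx)
  have at: "filter (\<lambda>m. ring_of w m \<le> ?r) ?L = L1 @ [(x, n)]"
    unfolding L using L1 L2 by (auto simp: rx filter_id_conv filter_empty_conv less_imp_le not_le)
  have "\<forall>\<^sub>F u in at_left ?r. \<forall>m\<in>set L1. u \<in> {ring_of w m<..<?r}"
    by (intro eventually_ball_finite ballI eventually_at_left_real L1) auto
  moreover have "\<forall>\<^sub>F u in at_left ?r. u < ?r"
    by (simp add: eventually_at_filter)
  \<comment> \<open>Shortly before the ring exactly the marks of \<open>L1\<close> have been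
    applied, so the left limit is the configuration to which the update refers.\<close>
  ultimately have left: "\<forall>\<^sub>F u in at_left ?r. finite_volume w \<Lambda> T \<eta> u = fold (apply_ring w) L1 \<eta>"
  proof eventually_elim
    case (elim u)
    have "filter (\<lambda>m. ring_of w m \<le> u) L1 = L1"
      using elim by (auto simp: filter_id_conv less_imp_le)
    moreover have "filter (\<lambda>m. ring_of w m \<le> u) L2 = []"
      using elim(2) L2 by (force simp: filter_empty_conv not_le)
    ultimately show ?case unfolding finite_volume_def L using elim(2) rx by simp
  qed
  show "\<exists>\<eta>'. (\<forall>y. y = x \<or> neighbor x y \<longrightarrow> (\<forall>\<^sub>F u in at_left ?r. finite_volume w \<Lambda> T \<eta> u y = \<eta>' y)) \<and>
      finite_volume w \<Lambda> T \<eta> ?r x = updated_spin \<eta>' x (coin w x n)"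
  proof (intro exI conjI allI impI)
    show "\<forall>\<^sub>F u in at_left ?r. finite_volume w \<Lambda> T \<eta> u y = fold (apply_ring w) L1 \<eta> y" for y
      using left by eventually_elim simp
    show "finite_volume w \<Lambda> T \<eta> ?r x = updated_spin (fold (apply_ring w) L1 \<eta>) x (coin w x n)"
      unfolding finite_volume_def at by (simp add: apply_ring_def)
  qed
qed


section \<open>Dynamics in discrete time\<close>

definition update :: "site \<Rightarrow> bool option \<Rightarrow> config \<Rightarrow> config" where
  "update x m \<eta> = (case m of None \<Rightarrow> \<eta> | Some c \<Rightarrow> \<eta>(x := updated_spin \<eta> x c))"

text \<open>Within a slot the sites are updated in the order of \<open>xs\<close>. This arbitrary
  order is harmless, because for a fine mesh different rings in a finite volume and a bounded time
  have different slots.\<close>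

definition steps :: "site list \<Rightarrow> nat \<Rightarrow> (site \<times> nat) list" where
  "steps xs M = concat (map (\<lambda>j. map (\<lambda>x. (x, j)) xs) [1..<Suc M])"

definition run :: "(site \<times> nat \<Rightarrow> bool option) \<Rightarrow> (site \<times> nat) list \<Rightarrow> config \<Rightarrow> config" where
  "run Y L \<eta> = fold (\<lambda>p. update (fst p) (Y p)) L \<eta>"

definition slot_marks :: "clocks \<Rightarrow> real \<Rightarrow> site \<times> nat \<Rightarrow> bool option" where
  "slot_marks w \<delta> p = slot_mark \<delta> (w (fst p)) (snd p)"

lemma set_steps: "set (steps xs M) = set xs \<times> {1..M}"
  by (auto simp: steps_def)

lemma steps_Suc: "steps xs (Suc M) = steps xs M @ map (\<lambda>x. (x, Suc M)) xs"
  by (simp add: steps_def)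

lemma distinct_steps: "distinct xs \<Longrightarrow> distinct (steps xs M)"
proof (induction M)
  case (Suc M)
  then show ?case unfolding steps_Suc
    by (auto simp: set_steps distinct_map inj_on_def)
qed (simp add: steps_def)

lemma sorted_steps: "sorted (map snd (steps xs M))"
proof (induction M)
  case (Suc M)
  then show ?case unfolding steps_Suc
    by (auto simp: sorted_append set_steps comp_def map_replicate_const)
qed (simp add: steps_def)

lemma run_filter: "run Y L \<eta> = run Y (filter (\<lambda>p. Y p \<noteq> None) L) \<eta>"
  unfolding run_def by (induction L arbitrary: \<eta>) (auto simp: update_def)

definition mark_slot :: "clocks \<Rightarrow> real \<Rightarrow> site \<times> nat \<Rightarrow> site \<times> nat" where
  "mark_slot w \<delta> m = (fst m, slot \<delta> (w (fst m)) (snd m))"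

lemma run_mark_slot: "run (slot_marks w \<delta>) (map (mark_slot w \<delta>) L) \<eta> = fold (apply_ring w) L \<eta>"
  unfolding run_def
  by (induction L arbitrary: \<eta>)
    (auto simp: slot_marks_def mark_slot_def slot_mark_slot update_def apply_ring_def coin_def)

lemma run_eq_ring_list:
  assumes w: "regular_clocks w" and xs: "distinct xs"
    and bound: "\<And>m. fst m \<in> set xs \<Longrightarrow> ring_of w m \<le> T \<longleftrightarrow> slot \<delta> (w (fst m)) (snd m) \<le> M"
    and order: "\<And>m m'. m \<in> set (ring_list w (set xs) T) \<Longrightarrow> m' \<in> set (ring_list w (set xs) T) \<Longrightarrow>
      ring_of w m < ring_of w m' \<Longrightarrow> slot \<delta> (w (fst m)) (snd m) < slot \<delta> (w (fst m')) (snd m')"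
  shows "run (slot_marks w \<delta>) (steps xs M) \<eta> = fold (apply_ring w) (ring_list w (set xs) T) \<eta>"
proof -
  let ?L = "ring_list w (set xs) T"
  let ?F = "filter (\<lambda>p. slot_marks w \<delta> p \<noteq> None) (steps xs M)"
  note L = ring_list[OF w finite_set, of xs T]
  have "sorted_wrt (\<lambda>m m'. snd (mark_slot w \<delta> m) < snd (mark_slot w \<delta> m')) ?L"
    by (rule sorted_wrt_mono_rel[OF _ L(2)]) (simp add: order mark_slot_def)
  then have strict: "sorted_wrt (<) (map snd (map (mark_slot w \<delta>) ?L))"
    by (simp add: sorted_wrt_map)
  have sets: "set ?F = set (map (mark_slot w \<delta>) ?L)"
  proof (intro equalityI subsetI)
    fix p assume p: "p \<in> set ?F"
    then obtain n where n: "slot \<delta> (w (fst p)) n = snd p"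
      by (auto simp: slot_marks_def slot_mark_eq_None_iff)
    then have "p = mark_slot w \<delta> (fst p, n)" by (simp add: mark_slot_def)
    moreover have "(fst p, n) \<in> set ?L"
      using p n bound[of "(fst p, n)"] unfolding L(1) by (auto simp: set_steps)
    ultimately show "p \<in> set (map (mark_slot w \<delta>) ?L)" by (metis image_eqI set_map)
  next
    fix p assume "p \<in> set (map (mark_slot w \<delta>) ?L)"
    then obtain m where m: "p = mark_slot w \<delta> m" "m \<in> set ?L" by auto
    then have "fst m \<in> set xs" "slot \<delta> (w (fst m)) (snd m) \<le> M" using bound[of m] unfolding L(1) by auto
    then show "p \<in> set ?F"
      using m(1) slot_pos[of \<delta> "w (fst m)" "snd m"]
      by (auto simp: set_steps mark_slot_def slot_marks_def slot_mark_slot Suc_le_eq)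
  qed
  have inj: "inj_on snd (set (map (mark_slot w \<delta>) ?L))"
    using strict unfolding strict_sorted_iff distinct_map by blast
  have "?F = map (mark_slot w \<delta>) ?L"
  proof (rule map_sorted_distinct_set_unique[of snd])
    show "inj_on snd (set ?F \<union> set (map (mark_slot w \<delta>) ?L))" using inj sets by simp
    show "sorted (map snd ?F)" using sorted_steps by (rule sorted_filter)
    show "distinct (map snd ?F)"
      unfolding distinct_map using distinct_steps[OF xs] inj sets by simp
    show "sorted (map snd (map (mark_slot w \<delta>) ?L))" "distinct (map snd (map (mark_slot w \<delta>) ?L))"
      using strict unfolding strict_sorted_iff by blast+
  qed (rule sets)
  then show ?thesis
    using run_filter[of "slot_marks w \<delta>" "steps xs M" \<eta>] run_mark_slot[of w \<delta> ?L \<eta>] by simp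
qed

text \<open>Rounding lengthens each waiting time by a positive amount of at most \<delta>, and ring
  \<open>n\<close> is a sum of \<open>n + 1\<close> waiting times.\<close>

lemma slot_bounds:
  assumes "\<And>k. fst (v k) > 0" "\<delta> > 0"
  shows "ring v n < \<delta> * slot \<delta> v n" "\<delta> * slot \<delta> v n \<le> ring v n + \<delta> * (n + 1)"
proof -
  have g: "fst (v k) < \<delta> * gap \<delta> (v k) \<and> \<delta> * gap \<delta> (v k) \<le> fst (v k) + \<delta>" for k
  proof -
    have "0 \<le> \<lfloor>fst (v k) / \<delta>\<rfloor>" using assms(1)[of k] assms(2) by simp
    then have *: "real (gap \<delta> (v k)) = of_int \<lfloor>fst (v k) / \<delta>\<rfloor> + 1"
      by (simp add: gap_def)
    have "fst (v k) / \<delta> < of_int \<lfloor>fst (v k) / \<delta>\<rfloor> + 1" "of_int \<lfloor>fst (v k) / \<delta>\<rfloor> \<le> fst (v k) / \<delta>"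
      by linarith+
    then have "fst (v k) < (of_int \<lfloor>fst (v k) / \<delta>\<rfloor> + 1) * \<delta>" "of_int \<lfloor>fst (v k) / \<delta>\<rfloor> * \<delta> \<le> fst (v k)"
      using assms(2) by (simp_all only: pos_divide_less_eq pos_le_divide_eq)
    then show ?thesis unfolding * by (simp add: algebra_simps)
  qed
  have s: "\<delta> * slot \<delta> v n = (\<Sum>k\<le>n. \<delta> * gap \<delta> (v k))" by (simp add: slot_def sum_distrib_left)
  show "ring v n < \<delta> * slot \<delta> v n"
    unfolding s ring_def using g by (intro sum_strict_mono) auto
  have "(\<Sum>k\<le>n. \<delta> * gap \<delta> (v k)) \<le> (\<Sum>k\<le>n. fst (v k) + \<delta>)" using g by (intro sum_mono) auto
  also have "\<dots> = ring v n + \<delta> * (n + 1)" by (simp add: ring_def sum.distrib algebra_simps)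
  finally show "\<delta> * slot \<delta> v n \<le> ring v n + \<delta> * (n + 1)" unfolding s .
qed

text \<open>Up to \<open>T\<close> there are finitely many rings in the volume, at different times
  and none at \<open>T\<close>. Rounding moves them only later and by amounts that vanish with the
  mesh, so eventually the slot of each ring comes before the time of the next ring and before
  \<open>T\<close>.\<close>

lemma eventually_run_eq:
  fixes T :: real
  assumes w: "regular_clocks w" and xs: "distinct xs" and T: "T \<ge> 0" "\<And>x n. ring_time w x n \<noteq> T"
  shows "\<forall>\<^sub>F i in sequentially. \<forall>\<eta>. run (slot_marks w (1 / Suc i)) (steps xs (nat \<lfloor>T * Suc i\<rfloor>)) \<eta> =
    fold (apply_ring w) (ring_list w (set xs) T) \<eta>"
proof -
  let ?L = "ring_list w (set xs) T"
  note L = ring_list[OF w finite_set, of xs T]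
  have pos: "fst (w x k) > 0" for x k using w by (simp add: regular_clocks_def)
  define S where "S i m = slot (1 / Suc i) (w (fst m)) (snd m)" for i m
  have lower: "ring_of w m < S i m / Suc i" for i m
    using slot_bounds(1)[of "w (fst m)" "1 / real (Suc i)" "snd m", OF pos]
    by (simp add: ring_of_def ring_time_eq S_def)
  have upper: "\<forall>\<^sub>F i in sequentially. S i m / Suc i < b" if "ring_of w m < b" for m b
  proof -
    have "(\<lambda>i. ring_of w m + (snd m + 1) / Suc i) \<longlonglongrightarrow> ring_of w m + 0"
      by (intro tendsto_add tendsto_const LIMSEQ_Suc lim_const_over_n)
    then have "\<forall>\<^sub>F i in sequentially. ring_of w m + (snd m + 1) / Suc i < b"
      using that by (intro order_tendstoD) auto
    then show ?thesis
    proof eventually_elim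
      case (elim i)
      then show ?case
        using slot_bounds(2)[of "w (fst m)" "1 / real (Suc i)" "snd m", OF pos]
        by (simp add: ring_of_def ring_time_eq S_def add_divide_distrib)
    qed
  qed
  have "\<forall>\<^sub>F i in sequentially. \<forall>m\<in>set ?L. S i m / Suc i < T"
  proof (intro eventually_ball_finite ballI upper)
    fix m assume "m \<in> set ?L"
    then show "ring_of w m < T" using T(2)[of "fst m" "snd m"] unfolding L(1) by (auto simp: ring_of_def)
  qed simp
  moreover have "\<forall>\<^sub>F i in sequentially. \<forall>m\<in>set ?L. \<forall>m'\<in>{m'\<in>set ?L. ring_of w m < ring_of w m'}. S i m / Suc i < ring_of w m'"
    by (intro eventually_ball_finite ballI upper) auto
  ultimately show ?thesis
  proof eventually_elim
    case (elim i)
    let ?M = "nat \<lfloor>T * Suc i\<rfloor>"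
    have M: "k \<le> ?M \<longleftrightarrow> k / Suc i \<le> T" for k :: nat
      using T(1) by (auto simp: le_nat_iff le_floor_iff field_simps)
    have 1: "ring_of w m \<le> T \<longleftrightarrow> S i m \<le> ?M" if "fst m \<in> set xs" for m
    proof
      assume "ring_of w m \<le> T"
      then have "m \<in> set ?L" using that unfolding L(1) by simp
      then have "S i m / Suc i < T" using elim(1) by blast
      then show "S i m \<le> ?M" unfolding M by simp
    next
      assume "S i m \<le> ?M"
      then show "ring_of w m \<le> T" unfolding M using lower[of m i] by simp
    qed
    have 2: "S i m < S i m'" if "m \<in> set ?L" "m' \<in> set ?L" "ring_of w m < ring_of w m'" for m m'
    proof -
      have "S i m / Suc i < ring_of w m'" using elim(2) that by blast
      also have "\<dots> < S i m' / Suc i" by (rule lower)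
      finally show ?thesis by (simp add: divide_less_cancel)
    qed
    show ?case
      by (intro allI run_eq_ring_list[OF w xs]) (use 1 2 in \<open>auto simp: S_def\<close>)
  qed
qed

section \<open>Almost sure properties of the clocks\<close>

lemma AE_site_clock:
  assumes "AE v in site_clock. P v"
  shows "AE w in clock_measure. \<forall>x. P (w x)"
proof -
  have "AE w in clock_measure. P (w x)" for x
    unfolding clock_measure_eq
    by (rule AE_PiM_component[of UNIV "\<lambda>_. site_clock" x]) (auto simp: assms K.prob_space_axioms)
  then show ?thesis by (simp add: AE_all_countable)
qed

lemma sets_ring_interval: "{v. ring v n \<in> {a<..b}} \<in> K.events"
  using measurable_sets[OF measurable_ring[of n], of "{a<..b}"] by (simp add: vimage_def)

lemma sets_ring_coincide:
  "{w. ring_time w x m = ring_time w y n \<and> ring_time w x m \<in> {a<..b}} \<in> Clk.events"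
proof -
  have "(\<lambda>w. ring_time w x m - ring_time w y n) \<in> borel_measurable clock_measure" by measurable
  from measurable_sets[OF this, of "{0}"] measurable_sets[OF measurable_ring_time, of "{a<..b}" x m]
  have "{w. ring_time w x m - ring_time w y n = 0} \<inter> {w. ring_time w x m \<in> {a<..b}} \<in> Clk.events"
    by (intro sets.Int) (auto simp: vimage_def)
  then show ?thesis by (auto simp: Int_def)
qed

text \<open>Different sites are independent, so both rings fall into a given one of
  \<open>k + 1\<close> equal intervals with probability at most \<open>(N / (k + 1))^2\<close>; the
  sum over the intervals vanishes as \<open>k\<close> grows.\<close>

lemma prob_ring_coincide:
  assumes "x \<noteq> y"
  shows "Clk.prob {w. ring_time w x m = ring_time w y n \<and> ring_time w x m \<in> {0<..real N}} = 0"
    (is "measure _ ?E = 0")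
proof -
  have E: "?E \<in> Clk.events" by (rule sets_ring_coincide)
  have le: "Clk.prob ?E \<le> real N ^ 2 / Suc k" for k
  proof -
    define J where "J i = {real N * i / Suc k<..real N * Suc i / Suc k}" for i
    define A where "A i = {w \<in> space clock_measure. \<forall>z\<in>{x, y}. w z \<in> (if z = x then {v. ring v m \<in> J i} else {v. ring v n \<in> J i})}" for i
    have sA: "(if z = x then {v. ring v m \<in> J i} else {v. ring v n \<in> J i}) \<in> K.events" for z i
      using sets_ring_interval unfolding J_def by auto
    have A: "A i \<in> Clk.events" for i
      unfolding A_def using sA by measurable
    have "?E \<subseteq> (\<Union>i\<in>{..<Suc k}. A i)"
    proof
      fix w assume w: "w \<in> ?E"
      define r where "r = ring_time w x m"
      have r: "0 < r" "r \<le> real N" "ring_time w y n = r" using w by (auto simp: r_def)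
      then have N: "real N > 0" by linarith
      \<comment> \<open>The index is the ceiling less one because the intervals \<open>J i\<close>
        are open on the left.\<close>
      define i where "i = nat (\<lceil>r * Suc k / real N\<rceil> - 1)"
      have pos: "0 < r * Suc k / real N" using r N by simp
      then have ceil: "\<lceil>r * Suc k / real N\<rceil> \<ge> 1" by (simp add: one_le_ceiling)
      then have i: "real i = of_int \<lceil>r * Suc k / real N\<rceil> - 1" by (simp add: i_def)
      have "real i < r * Suc k / real N" "r * Suc k / real N \<le> real i + 1"
        unfolding i by linarith+
      then have "r \<in> J i" using N by (simp add: J_def field_simps)
      moreover have "r * Suc k \<le> real N * Suc k" using r by (intro mult_right_mono) auto
      then have "r * Suc k / real N \<le> Suc k" using N by (simp only: pos_divide_le_eq mult.commute)
      with \<open>real i < _\<close> have "i < Suc k" by linarith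
      ultimately show "w \<in> (\<Union>i\<in>{..<Suc k}. A i)"
        using assms r by (auto simp: A_def ring_time_eq[symmetric] r_def[symmetric])
    qed
    then have "Clk.prob ?E \<le> Clk.prob (\<Union>i\<in>{..<Suc k}. A i)"
      using A by (intro Clk.finite_measure_mono) auto
    also have "\<dots> \<le> (\<Sum>i<Suc k. Clk.prob (A i))"
      using A by (intro measure_UNION_le) auto
    also have "\<dots> \<le> (\<Sum>i<Suc k. (real N / Suc k) * (real N / Suc k))"
    proof (rule sum_mono)
      fix i
      have len: "K.prob {v. ring v l \<in> J i} \<le> real N / Suc k" for l
        using prob_ring_interval[of "real N * i / Suc k" "real N * Suc i / Suc k" l]
        by (simp add: J_def divide_right_mono mult_left_mono diff_divide_distrib[symmetric] algebra_simps)
      have "Clk.prob (A i) =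
          (\<Prod>z\<in>{x, y}. K.prob (if z = x then {v. ring v m \<in> J i} else {v. ring v n \<in> J i}))"
        unfolding A_def by (intro clocks.measure_PiM_Collect sA) auto
      also have "\<dots> = K.prob {v. ring v m \<in> J i} * K.prob {v. ring v n \<in> J i}"
        using assms by simp
      also have "\<dots> \<le> (real N / Suc k) * (real N / Suc k)"
        by (intro mult_mono len) auto
      finally show "Clk.prob (A i) \<le> (real N / Suc k) * (real N / Suc k)" .
    qed
    also have "\<dots> = real N ^ 2 / Suc k" by (simp add: power2_eq_square)
    finally show ?thesis .
  qed
  have "(\<lambda>k. real N ^ 2 / Suc k) \<longlonglongrightarrow> 0"
    by (intro LIMSEQ_Suc lim_const_over_n)
  then have "Clk.prob ?E \<le> 0"
    by (rule LIMSEQ_le_const) (use le in auto)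
  then show ?thesis by (simp add: measure_le_0_iff)
qed

lemma AE_rings_distinct:
  "AE w in clock_measure. \<forall>x y m n. x \<noteq> y \<longrightarrow> 0 < ring_time w x m \<longrightarrow> ring_time w x m \<noteq> ring_time w y n"
proof -
  have "AE w in clock_measure. x \<noteq> y \<longrightarrow> \<not> (ring_time w x m = ring_time w y n \<and> ring_time w x m \<in> {0<..real N})" for x y m n N
  proof (cases "x = y")
    case False
    let ?E = "{w \<in> space clock_measure. ring_time w x m = ring_time w y n \<and> ring_time w x m \<in> {0<..real N}}"
    have "?E \<in> null_sets clock_measure"
      using sets_ring_coincide[of x m y n 0 "real N"] prob_ring_coincide[OF False, of m n N] by (auto simp: null_sets_def Clk.emeasure_eq_measure)
    then show ?thesis by (rule AE_I') auto
  qed auto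
  then have "AE w in clock_measure. \<forall>x y m n N. x \<noteq> y \<longrightarrow> \<not> (ring_time w x m = ring_time w y n \<and> ring_time w x m \<in> {0<..real N})"
    unfolding AE_all_countable by blast
  then show ?thesis
  proof eventually_elim
    case (elim w)
    show ?case
    proof (intro allI impI)
      fix x y m n assume "x \<noteq> y" "0 < ring_time w x m"
      moreover obtain N where "ring_time w x m \<le> real N" using real_arch_simple by blast
      ultimately show "ring_time w x m \<noteq> ring_time w y n"
        using elim unfolding greaterThanAtMost_iff by blast
    qed
  qed
qed

lemma AE_regular_clocks: "AE w in clock_measure. regular_clocks w"
  using AE_site_clock[OF AE_gap_pos] AE_site_clock[OF AE_ring_unbounded] AE_rings_distinct
proof eventually_elim
  case (elim w)
  then show ?case
    using ring_time_pos[of w] unfolding regular_clocks_def ring_time_eq by metis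
qed

lemma AE_no_ring_at: "AE w in clock_measure. \<forall>x n. ring_time w x n \<noteq> T"
proof -
  have "AE v in site_clock. ring v n \<noteq> T" for n
  proof -
    have E: "{v. ring v n = T} \<in> K.events"
      using measurable_sets[OF measurable_ring[of n], of "{T}"] by (simp add: vimage_def)
    have "K.prob {v. ring v n = T} \<le> \<epsilon>" if "\<epsilon> > 0" for \<epsilon>
    proof -
      have "K.prob {v. ring v n = T} \<le> K.prob {v. ring v n \<in> {T - \<epsilon><..T}}"
        using that by (intro K.finite_measure_mono sets_ring_interval) auto
      also have "\<dots> \<le> \<epsilon>" using prob_ring_interval[of "T - \<epsilon>" T n] that by simp
      finally show ?thesis .
    qed
    then have "K.prob {v. ring v n = T} \<le> 0" by (rule field_le_epsilon) simp
    then have "{v. ring v n = T} \<in> null_sets site_clock"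
      using E by (auto simp: null_sets_def K.emeasure_eq_measure measure_le_0_iff)
    then show ?thesis by (rule AE_I') auto
  qed
  then have "AE v in site_clock. \<forall>n. ring v n \<noteq> T" by (simp add: AE_all_countable)
  from AE_site_clock[OF this] show ?thesis by (simp add: ring_time_eq)
qed

section \<open>Counting paths of ringing sites\<close>

fun site_paths :: "nat \<Rightarrow> site \<Rightarrow> site list set" where
  "site_paths 0 x = {[]}"
| "site_paths (Suc n) x = (\<Union>y\<in>{y. neighbor x y}. (#) y ` site_paths n y)"

lemma finite_site_paths: "finite (site_paths n x)"
  by (induction n arbitrary: x) (auto simp: finite_neighbors)

lemma card_neighbors: "card {y. neighbor x y} = 4"
proof -
  obtain a b where x: "x = (a, b)" by (cases x)
  have "{y. neighbor x y} = {(a+1,b), (a-1,b), (a,b+1), (a,b-1)}"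
    by (auto simp: x neighbor_iff' abs_if split: if_splits)
  then show ?thesis by (simp add: card_insert_if)
qed

lemma card_site_paths: "card (site_paths n x) \<le> 4 ^ n"
proof (induction n arbitrary: x)
  case (Suc n)
  have "card (site_paths (Suc n) x) \<le> (\<Sum>y\<in>{y. neighbor x y}. card ((#) y ` site_paths n y))"
    by (simp add: card_UN_le finite_neighbors)
  also have "\<dots> \<le> (\<Sum>y\<in>{y. neighbor x y}. 4 ^ n)"
    using Suc by (intro sum_mono) (simp add: card_image)
  also have "\<dots> \<le> 4 ^ Suc n" using card_neighbors[of x] by simp
  finally show ?case .
qed simp

lemma rtrancl_path_site_paths:
  assumes "rtrancl_path r x xs y" "\<And>a b. r a b \<Longrightarrow> neighbor a b" "n \<le> length xs"
  shows "take n xs \<in> site_paths n x"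
  using assms(1,3)
proof (induction arbitrary: n)
  case (step x y ys z)
  show ?case
  proof (cases n)
    case (Suc m)
    have "neighbor x y" using step.hyps(1) by (rule assms(2))
    moreover have "take m ys \<in> site_paths m y" using step.IH[of m] step.prems Suc by simp
    ultimately show ?thesis
      unfolding Suc site_paths.simps take_Suc_Cons by (intro UN_I[of y] imageI CollectI)
  qed simp
qed simp

lemma rtrancl_path_length:
  assumes "rtrancl_path r x xs y" "\<And>a b. r a b \<Longrightarrow> neighbor a b"
  shows "\<bar>fst y - fst x\<bar> + \<bar>snd y - snd x\<bar> \<le> int (length xs)"
  using assms(1)
proof induction
  case (step x y ys z)
  then show ?case using assms(2)[OF step.hyps(1)] by (auto simp: neighbor_iff')
qed simp

text \<open>The cluster leaves every box around \<open>x\<close>. A path to a site outside has at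
  least \<open>n\<close> steps even after its loops are removed, and the \<open>n\<close> sites that
  follow \<open>x\<close> on it form the list.\<close>

lemma infinite_cluster_path:
  assumes "infinite {y. linked neighbor Z x y}"
  shows "\<exists>p\<in>site_paths n x. distinct p \<and> length p = n \<and> set p \<subseteq> Z"
proof -
  have "\<not> {y. linked neighbor Z x y} \<subseteq> rect (fst x - int n) (fst x + int n) (snd x - int n) (snd x + int n)"
    using assms finite_subset[OF _ finite_rect] by blast
  then obtain y where y: "linked neighbor Z x y"
      "y \<notin> rect (fst x - int n) (fst x + int n) (snd x - int n) (snd x + int n)"
    by blast
  let ?r = "\<lambda>a b. neighbor a b \<and> b \<in> Z"
  have "?r\<^sup>*\<^sup>* x y"
    using y(1) by (induction rule: linked_induct) (auto intro: rtranclp.rtrancl_into_rtrancl)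
  then obtain xs where "rtrancl_path ?r x xs y" by (auto simp: rtranclp_eq_rtrancl_path)
  then obtain xs where xs: "rtrancl_path ?r x xs y" "distinct (x # xs)"
    by (rule rtrancl_path_distinct)
  have len: "n \<le> length xs" using rtrancl_path_length[OF xs(1)] y(2) by auto
  have "set xs \<subseteq> Z"
    using xs(1) by (induction) auto
  then show ?thesis
    using rtrancl_path_site_paths[OF xs(1) _ len] xs(2) len set_take_subset[of n xs]
    by (intro bexI[of _ "take n xs"]) (auto simp: distinct_take)
qed

text \<open>A Peierls argument: there are at most \<open>4 ^ n\<close> paths of \<open>n\<close>
  steps, and by independence the \<open>n\<close> different sites of one of them all ring with
  probability at most \<open>(1/8) ^ n\<close>. Any threshold below \<open>1/4\<close> would
  serve.\<close>

lemma AE_finite_cluster: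
  assumes "K.prob {v. \<exists>n. ring v n \<in> {a<..b}} \<le> 1/8"
  shows "AE w in clock_measure. finite {y. linked neighbor (ringing w a b) x y}"
proof -
  let ?R = "{v. \<exists>n. ring v n \<in> {a<..b}}"
  define E where "E p = {w \<in> space clock_measure. \<forall>z\<in>set p. w z \<in> ?R}" for p :: "site list"
  have E: "E p \<in> Clk.events" for p
    unfolding E_def using measurable_rings_in by measurable
  have mE: "Clk.prob (E p) \<le> (1/8) ^ n" if "distinct p" "length p = n" for p n
  proof -
    have "Clk.prob (E p) = (\<Prod>z\<in>set p. K.prob ?R)"
      unfolding E_def by (intro clocks.measure_PiM_Collect measurable_rings_in) auto
    also have "\<dots> = K.prob ?R ^ n" using that distinct_card[of p] by simp
    also have "\<dots> \<le> (1/8) ^ n" using assms by (intro power_mono) auto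
    finally show ?thesis .
  qed
  define F where "F n = (\<Union>p\<in>{p\<in>site_paths n x. distinct p \<and> length p = n}. E p)" for n
  have finP: "finite {p\<in>site_paths n x. distinct p \<and> length p = n}" for n
    using finite_site_paths by simp
  have F: "F n \<in> Clk.events" for n
    unfolding F_def using E finP by auto
  have mF: "Clk.prob (F n) \<le> (1/2) ^ n" for n
  proof -
    let ?P = "{p\<in>site_paths n x. distinct p \<and> length p = n}"
    have "Clk.prob (F n) \<le> (\<Sum>p\<in>?P. Clk.prob (E p))"
      unfolding F_def using E finP by (intro measure_UNION_le) auto
    also have "\<dots> \<le> (\<Sum>p\<in>?P. (1/8) ^ n)" using mE by (intro sum_mono) auto
    also have "\<dots> = card ?P * (1/8) ^ n" by simp
    also have "\<dots> \<le> 4 ^ n * (1/8) ^ n"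
    proof (rule mult_right_mono)
      have "card ?P \<le> card (site_paths n x)" by (intro card_mono finite_site_paths) auto
      also have "\<dots> \<le> 4 ^ n" by (rule card_site_paths)
      finally have "real (card ?P) \<le> real (4 ^ n)" by (rule of_nat_mono)
      then show "real (card ?P) \<le> 4 ^ n" by simp
    qed simp
    also have "\<dots> = (1/2) ^ n" by (simp add: power_mult_distrib[symmetric])
    finally show ?thesis .
  qed
  have IF: "(\<Inter>n. F n) \<in> Clk.events" using F by auto
  have "Clk.prob (\<Inter>n. F n) \<le> (1/2) ^ n" for n
    using mF[of n] Clk.finite_measure_mono[of "\<Inter>n. F n" "F n"] F[of n] by (meson INF_lower UNIV_I order_trans)
  moreover have "(\<lambda>n. (1/2 :: real) ^ n) \<longlonglongrightarrow> 0" by (intro LIMSEQ_power_zero) auto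
  ultimately have "Clk.prob (\<Inter>n. F n) \<le> 0" by (intro LIMSEQ_le_const) auto
  then have "(\<Inter>n. F n) \<in> null_sets clock_measure"
    using IF by (auto simp: null_sets_def Clk.emeasure_eq_measure measure_le_0_iff)
  then show ?thesis
  proof (rule AE_I')
    show "{w \<in> space clock_measure. \<not> finite {y. linked neighbor (ringing w a b) x y}} \<subseteq> (\<Inter>n. F n)"
    proof
      fix w assume "w \<in> {w \<in> space clock_measure. \<not> finite {y. linked neighbor (ringing w a b) x y}}"
      then have inf: "infinite {y. linked neighbor (ringing w a b) x y}" by simp
      have "w \<in> F n" for n
      proof -
        obtain p where "p \<in> site_paths n x" "distinct p" "length p = n" "set p \<subseteq> ringing w a b"
          using infinite_cluster_path[OF inf, of n] by blast
        then show ?thesis unfolding F_def E_def ringing_def ring_time_eq by auto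
      qed
      then show "w \<in> (\<Inter>n. F n)" by blast
    qed
  qed
qed

text \<open>The smallness of the ringing probability is uniform over short intervals before
  \<open>T\<close>, so one subdivision into pieces of length \<open>T / K\<close> serves all of
  them.\<close>

lemma AE_finite_range:
  assumes "T \<ge> 0"
  shows "\<exists>K>0. AE w in clock_measure. finite_range w T K"
proof -
  obtain \<delta> where \<delta>: "\<delta> > 0" "\<And>a b. a \<le> b \<Longrightarrow> b \<le> T \<Longrightarrow> b - a \<le> \<delta> \<Longrightarrow>
      K.prob {v. \<exists>n. ring v n \<in> {a<..b}} \<le> 1/8"
    using prob_ring_short_interval[of "1/8" T] by auto
  obtain K0 :: nat where K0: "T / \<delta> \<le> real K0" using real_arch_simple by blast
  define K where "K = Suc K0"
  have TK: "T / real K \<le> \<delta>"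
  proof -
    have "T \<le> real K0 * \<delta>" using K0 \<delta>(1) by (simp add: pos_divide_le_eq)
    also have "\<dots> \<le> real K * \<delta>" using \<delta>(1) by (intro mult_right_mono) (auto simp: K_def)
    finally show ?thesis by (simp add: K_def pos_divide_le_eq mult.commute)
  qed
  have "AE w in clock_measure. finite {y. linked neighbor (ringing w (T * k / K) (T * Suc k / K)) x y}" if "k < K" for k x
  proof (intro AE_finite_cluster \<delta>(2))
    show "T * k / K \<le> T * Suc k / K" using assms by (intro divide_right_mono mult_left_mono) auto
    have "T * Suc k / K \<le> T * K / K" using assms that by (intro divide_right_mono mult_left_mono) auto
    then show "T * Suc k / K \<le> T" by (simp add: K_def)
    have "T * Suc k / K - T * k / K = T / K" by (simp add: diff_divide_distrib[symmetric] algebra_simps)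
    then show "T * Suc k / K - T * k / K \<le> \<delta>" using TK by simp
  qed
  then have "AE w in clock_measure. \<forall>k<K. \<forall>x. finite {y. linked neighbor (ringing w (T * k / K) (T * Suc k / K)) x y}"
    by (simp add: AE_all_countable AE_conj_iff) 
  then show ?thesis by (intro exI[of _ K]) (simp add: finite_range_def K_def)
qed

section \<open>Positive association of the discretised chain\<close>

abbreviation "pexp \<equiv> measure_pmf.expectation"

definition spin_configs :: "config set" where
  "spin_configs = {\<eta>. \<forall>x. \<eta> x \<in> {-1, 1}}"

text \<open>Monotonicity is required on genuine spin configurations only, since
  \<open>config\<close> admits arbitrary integer values.\<close>

definition increasing_fun :: "(config \<Rightarrow> real) \<Rightarrow> bool" where
  "increasing_fun f \<longleftrightarrow> (\<forall>\<eta>\<in>spin_configs. \<forall>\<eta>'\<in>spin_configs. \<eta> \<le> \<eta>' \<longrightarrow> f \<eta> \<le> f \<eta>')"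

text \<open>Finite support turns all expectations into finite sums, so no integrability is demanded
  of the test functions.\<close>

definition pos_assoc :: "config pmf \<Rightarrow> bool" where
  "pos_assoc \<mu> \<longleftrightarrow> finite (set_pmf \<mu>) \<and> set_pmf \<mu> \<subseteq> spin_configs \<and>
     (\<forall>f g. increasing_fun f \<longrightarrow> increasing_fun g \<longrightarrow> pexp \<mu> f * pexp \<mu> g \<le> pexp \<mu> (\<lambda>\<eta>. f \<eta> * g \<eta>))"

definition resampling :: "site \<Rightarrow> (config \<Rightarrow> real) \<Rightarrow> (config \<Rightarrow> config pmf) \<Rightarrow> bool" where
  "resampling x \<pi> \<K> \<longleftrightarrow> increasing_fun \<pi> \<and> (\<forall>\<eta>\<in>spin_configs. 0 \<le> \<pi> \<eta> \<and> \<pi> \<eta> \<le> 1 \<and>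
     set_pmf (\<K> \<eta>) \<subseteq> {\<eta>(x := 1), \<eta>(x := -1)} \<and>
     (\<forall>f :: config \<Rightarrow> real. pexp (\<K> \<eta>) f = \<pi> \<eta> * f (\<eta>(x := 1)) + (1 - \<pi> \<eta>) * f (\<eta>(x := -1))))"

lemma spin_configs_upd: "\<eta> \<in> spin_configs \<Longrightarrow> s \<in> {-1, 1} \<Longrightarrow> \<eta>(x := s) \<in> spin_configs"
  by (auto simp: spin_configs_def)

text \<open>The configuration is raised in two stages: first with the weight of \<open>+1\<close>
  kept fixed, then by raising this weight, which favours the larger of the two comparable
  results.\<close>

lemma resampling_increasing:
  assumes "resampling x \<pi> \<K>" "increasing_fun f"
  shows "increasing_fun (\<lambda>\<eta>. pexp (\<K> \<eta>) f)"
  unfolding increasing_fun_def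
proof (intro ballI impI)
  fix \<eta> \<eta>' assume \<eta>: "\<eta> \<in> spin_configs" "\<eta>' \<in> spin_configs" "\<eta> \<le> \<eta>'"
  have f: "f \<zeta> \<le> f \<zeta>'" if "\<zeta> \<in> spin_configs" "\<zeta>' \<in> spin_configs" "\<zeta> \<le> \<zeta>'" for \<zeta> \<zeta>'
    using assms(2) that by (simp add: increasing_fun_def)
  have 1: "f (\<eta>(x := 1)) \<le> f (\<eta>'(x := 1))" "f (\<eta>(x := -1)) \<le> f (\<eta>'(x := -1))"
    "f (\<eta>'(x := -1)) \<le> f (\<eta>'(x := 1))"
    using \<eta> by (auto intro!: f spin_configs_upd simp: le_fun_def)
  have \<pi>: "0 \<le> \<pi> \<eta>" "\<pi> \<eta> \<le> \<pi> \<eta>'" "\<pi> \<eta> \<le> 1" "\<pi> \<eta>' \<le> 1"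
    using assms(1) \<eta> by (auto simp: resampling_def increasing_fun_def)
  have "\<pi> \<eta> * f (\<eta>(x := 1)) + (1 - \<pi> \<eta>) * f (\<eta>(x := -1)) \<le> \<pi> \<eta> * f (\<eta>'(x := 1)) + (1 - \<pi> \<eta>) * f (\<eta>'(x := -1))"
    using 1 \<pi> by (intro add_mono mult_left_mono) auto
  also have "\<dots> = f (\<eta>'(x := -1)) + \<pi> \<eta> * (f (\<eta>'(x := 1)) - f (\<eta>'(x := -1)))" by (simp add: algebra_simps)
  also have "\<dots> \<le> f (\<eta>'(x := -1)) + \<pi> \<eta>' * (f (\<eta>'(x := 1)) - f (\<eta>'(x := -1)))"
    using 1 \<pi> by (intro add_left_mono mult_right_mono) auto
  also have "\<dots> = \<pi> \<eta>' * f (\<eta>'(x := 1)) + (1 - \<pi> \<eta>') * f (\<eta>'(x := -1))" by (simp add: algebra_simps)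
  finally show "pexp (\<K> \<eta>) f \<le> pexp (\<K> \<eta>') f" using assms(1) \<eta> by (simp add: resampling_def)
qed

text \<open>The two possible results of resampling are comparable, so Chebyshev's inequality applies.\<close>

lemma resampling_assoc:
  assumes "resampling x \<pi> \<K>" "increasing_fun f" "increasing_fun g" "\<eta> \<in> spin_configs"
  shows "pexp (\<K> \<eta>) f * pexp (\<K> \<eta>) g \<le> pexp (\<K> \<eta>) (\<lambda>\<zeta>. f \<zeta> * g \<zeta>)"
proof -
  let ?p = "\<pi> \<eta>" and ?u = "\<eta>(x := 1)" and ?d = "\<eta>(x := -1)"
  have "?d \<le> ?u" by (simp add: le_fun_def)
  then have "f ?d \<le> f ?u" "g ?d \<le> g ?u"
    using assms spin_configs_upd[OF assms(4)] by (auto simp: increasing_fun_def)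
  moreover have p: "0 \<le> ?p" "?p \<le> 1" using assms by (auto simp: resampling_def)
  ultimately have "0 \<le> ?p * (1 - ?p) * ((f ?u - f ?d) * (g ?u - g ?d))"
    by (intro mult_nonneg_nonneg) auto
  also have "\<dots> = (?p * (f ?u * g ?u) + (1 - ?p) * (f ?d * g ?d)) -
      (?p * f ?u + (1 - ?p) * f ?d) * (?p * g ?u + (1 - ?p) * g ?d)" by (simp add: algebra_simps)
  finally show ?thesis using assms(1,4) by (simp add: resampling_def)
qed

text \<open>Given the configuration before the update, the inequality is
  \<open>resampling_assoc\<close>. The conditional expectations are again increasing, so association
  of \<mu> applies to their product, and the two inequalities combine.\<close>

lemma pos_assoc_bind:
  assumes \<mu>: "pos_assoc \<mu>" and \<K>: "resampling x \<pi> \<K>"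
  shows "pos_assoc (bind_pmf \<mu> \<K>)"
proof -
  have fin: "finite (set_pmf \<mu>)" "set_pmf \<mu> \<subseteq> spin_configs" using \<mu> by (auto simp: pos_assoc_def)
  have K: "set_pmf (\<K> \<eta>) \<subseteq> {\<eta>(x := 1), \<eta>(x := -1)}" if "\<eta> \<in> set_pmf \<mu>" for \<eta>
    using \<K> fin that by (auto simp: resampling_def)
  then have Kf: "finite (set_pmf (\<K> \<eta>))" if "\<eta> \<in> set_pmf \<mu>" for \<eta>
    using that by (meson finite.emptyI finite.insertI finite_subset)
  have E: "pexp (bind_pmf \<mu> \<K>) f = pexp \<mu> (\<lambda>\<eta>. pexp (\<K> \<eta>) f)" for f :: "config \<Rightarrow> real"
    using pmf_expectation_bind[OF fin(1) Kf subset_refl, where h = f]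
      integral_measure_pmf[OF fin(1), of \<mu> "\<lambda>\<eta>. pexp (\<K> \<eta>) f"] by simp
  show ?thesis
    unfolding pos_assoc_def
  proof (intro conjI allI impI)
    show "finite (set_pmf (bind_pmf \<mu> \<K>))" using fin Kf by (simp add: set_bind_pmf)
    show "set_pmf (bind_pmf \<mu> \<K>) \<subseteq> spin_configs"
    proof
      fix \<zeta> assume "\<zeta> \<in> set_pmf (bind_pmf \<mu> \<K>)"
      then obtain \<eta> where "\<eta> \<in> set_pmf \<mu>" "\<zeta> \<in> set_pmf (\<K> \<eta>)" by (auto simp: set_bind_pmf)
      then show "\<zeta> \<in> spin_configs" using K fin(2) spin_configs_upd[of \<eta> _ x] by blast
    qed
    fix f g :: "config \<Rightarrow> real" assume fg: "increasing_fun f" "increasing_fun g"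
    have "pexp (bind_pmf \<mu> \<K>) f * pexp (bind_pmf \<mu> \<K>) g \<le> pexp \<mu> (\<lambda>\<eta>. pexp (\<K> \<eta>) f * pexp (\<K> \<eta>) g)"
      unfolding E using \<mu> resampling_increasing[OF \<K>] fg by (simp add: pos_assoc_def)
    also have "\<dots> \<le> pexp \<mu> (\<lambda>\<eta>. pexp (\<K> \<eta>) (\<lambda>\<zeta>. f \<zeta> * g \<zeta>))"
      using fin resampling_assoc[OF \<K> fg]
      by (intro integral_mono_AE integrable_measure_pmf_finite) (auto simp: AE_measure_pmf_iff)
    also have "\<dots> = pexp (bind_pmf \<mu> \<K>) (\<lambda>\<eta>. f \<eta> * g \<eta>)" by (rule E[symmetric])
    finally show "pexp (bind_pmf \<mu> \<K>) f * pexp (bind_pmf \<mu> \<K>) g \<le> pexp (bind_pmf \<mu> \<K>) (\<lambda>\<eta>. f \<eta> * g \<eta>)" .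
  qed
qed

section \<open>The update of one spin with a random mark\<close>

definition mark_pmf :: "real \<Rightarrow> bool option pmf" where
  "mark_pmf \<delta> = bind_pmf (bernoulli_pmf (exp (- \<delta>)))
     (\<lambda>b. if b then return_pmf None else map_pmf Some (bernoulli_pmf (1/2)))"

lemma pmf_mark_pmf:
  assumes "\<delta> \<ge> 0"
  shows "pmf (mark_pmf \<delta>) m = mark_weight \<delta> m"
proof -
  have "pmf (map_pmf Some (bernoulli_pmf (1/2))) None = 0"
    by (auto simp: pmf_eq_0_set_pmf)
  moreover have "pmf (map_pmf Some (bernoulli_pmf (1/2))) (Some c) = 1/2" for c
    by (subst pmf_map_inj') auto
  ultimately show ?thesis
    using assms unfolding mark_pmf_def pmf_bind
    by (cases m) (auto simp: mark_weight_def)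
qed

lemma expectation_mark_pmf:
  fixes f :: "bool option \<Rightarrow> real"
  assumes "\<delta> \<ge> 0"
  shows "pexp (mark_pmf \<delta>) f = exp (- \<delta>) * f None + (1 - exp (- \<delta>)) / 2 * (f (Some True) + f (Some False))"
proof -
  have "pexp (mark_pmf \<delta>) f = (\<Sum>m\<in>{None, Some True, Some False}. pmf (mark_pmf \<delta>) m *\<^sub>R f m)"
  proof (rule integral_measure_pmf)
    fix m :: "bool option"
    show "m \<in> {None, Some True, Some False}" by (cases m) auto
  qed simp
  then show ?thesis using assms by (simp add: pmf_mark_pmf mark_weight_def distrib_left add.assoc)
qed

definition flip_prob :: "nat \<Rightarrow> real" where
  "flip_prob k = (if k \<ge> 3 then 1 else if k = 2 then 1/2 else 0)"

text \<open>The probability that the spin is \<open>+1\<close> after one slot when the ring and the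
  coin are both random.\<close>

definition plus_prob :: "real \<Rightarrow> site \<Rightarrow> config \<Rightarrow> real" where
  "plus_prob \<delta> x \<eta> = (let h = (1 - exp (- \<delta>)) * flip_prob (disagreements \<eta> x) in if \<eta> x = 1 then 1 - h else h)"

definition plus_neighbors :: "config \<Rightarrow> site \<Rightarrow> nat" where
  "plus_neighbors \<eta> x = card {y. neighbor x y \<and> \<eta> y = 1}"

lemma plus_neighbors_le: "plus_neighbors \<eta> x \<le> 4"
  unfolding plus_neighbors_def card_neighbors[of x, symmetric]
  by (intro card_mono finite_neighbors) auto

lemma disagreements_eq:
  assumes "\<eta> \<in> spin_configs"
  shows "disagreements \<eta> x = (if \<eta> x = 1 then 4 - plus_neighbors \<eta> x else plus_neighbors \<eta> x)"
proof (cases "\<eta> x = 1")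
  case True
  have "{y. neighbor x y \<and> \<eta> y \<noteq> \<eta> x} = {y. neighbor x y} - {y. neighbor x y \<and> \<eta> y = 1}"
    using True by auto
  moreover have "card \<dots> = 4 - plus_neighbors \<eta> x"
    unfolding plus_neighbors_def card_neighbors[of x, symmetric]
    by (intro card_Diff_subset finite_subset[OF _ finite_neighbors]) auto
  ultimately show ?thesis using True by (simp add: disagreements_def)
next
  case False
  then have "\<eta> x = -1" using assms by (auto simp: spin_configs_def)
  moreover have "\<eta> y \<noteq> -1 \<longleftrightarrow> \<eta> y = 1" for y using assms by (auto simp: spin_configs_def)
  ultimately show ?thesis by (simp add: disagreements_def plus_neighbors_def)
qed

lemma plus_neighbors_mono:
  assumes "\<eta> \<in> spin_configs" "\<eta>' \<in> spin_configs" "\<eta> \<le> \<eta>'"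
  shows "plus_neighbors \<eta> x \<le> plus_neighbors \<eta>' x"
  unfolding plus_neighbors_def
proof (intro card_mono finite_subset[OF _ finite_neighbors] subsetI)
  fix y assume y: "y \<in> {y. neighbor x y \<and> \<eta> y = 1}"
  have "\<eta> y \<le> \<eta>' y" "\<eta>' y \<in> {-1, 1}" using assms by (auto simp: le_fun_def spin_configs_def)
  then show "y \<in> {y. neighbor x y \<and> \<eta>' y = 1}" using y by auto
qed auto

text \<open>The fair coin enters here: a tie is its own complement, which forces the value
  \<open>1/2\<close>.\<close>

lemma flip_prob_compl: "n \<le> 4 \<Longrightarrow> flip_prob n + flip_prob (4 - n) = 1"
  by (auto simp: flip_prob_def)

lemma flip_prob_mono: "m \<le> n \<Longrightarrow> flip_prob m \<le> flip_prob n"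
  by (auto simp: flip_prob_def)

lemma flip_prob_nonneg: "0 \<le> flip_prob n" and flip_prob_le_1: "flip_prob n \<le> 1"
  by (auto simp: flip_prob_def)

text \<open>Averaging over the coin is essential. With the coin fixed to flip, a minus spin at a tie
  becomes plus and a plus spin with the same neighbours becomes minus, which reverses their
  order.\<close>

lemma increasing_plus_prob:
  assumes "\<delta> \<ge> 0"
  shows "increasing_fun (plus_prob \<delta> x)"
  unfolding increasing_fun_def
proof (intro ballI impI)
  fix \<eta> \<eta>' assume \<eta>: "\<eta> \<in> spin_configs" "\<eta>' \<in> spin_configs" "\<eta> \<le> \<eta>'"
  let ?p = "1 - exp (- \<delta>)" and ?n = "plus_neighbors \<eta> x" and ?n' = "plus_neighbors \<eta>' x"
  have p: "0 \<le> ?p" "?p \<le> 1" using assms by auto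
  have n: "?n \<le> ?n'" by (rule plus_neighbors_mono[OF \<eta>])
  have n4: "?n' \<le> 4" by (rule plus_neighbors_le)
  have "\<eta> x \<le> \<eta>' x" "\<eta> x \<in> {-1, 1}" "\<eta>' x \<in> {-1, 1}" using \<eta> by (auto simp: le_fun_def spin_configs_def)
  then consider "\<eta> x = -1" "\<eta>' x = -1" | "\<eta> x = 1" "\<eta>' x = 1" | "\<eta> x = -1" "\<eta>' x = 1" by auto
  then show "plus_prob \<delta> x \<eta> \<le> plus_prob \<delta> x \<eta>'"
  proof cases
    case 1
    then show ?thesis using \<eta> p flip_prob_mono[OF n]
      by (simp add: plus_prob_def disagreements_eq mult_left_mono)
  next
    case 2
    have "flip_prob (4 - ?n') \<le> flip_prob (4 - ?n)" using n by (intro flip_prob_mono) auto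
    then show ?thesis using 2 \<eta> p
      by (simp add: plus_prob_def disagreements_eq mult_left_mono)
  next
    case 3
    \<comment> \<open>The lower spin may turn plus and the higher one minus. The more likely the
      first, the more plus neighbours there are, and the less likely the second.\<close>
    have "flip_prob ?n + flip_prob (4 - ?n') \<le> 1"
      using flip_prob_mono[OF n] flip_prob_compl[OF n4] by simp
    then have "?p * (flip_prob ?n + flip_prob (4 - ?n')) \<le> 1 * 1"
      using p flip_prob_nonneg by (intro mult_mono) (auto intro: add_nonneg_nonneg)
    then show ?thesis using 3 \<eta>
      by (simp add: plus_prob_def disagreements_eq algebra_simps)
  qed
qed

lemma update_fun_upd:
  assumes "\<eta> \<in> spin_configs"
  shows "update x m \<eta> \<in> {\<eta>(x := 1), \<eta>(x := -1)}"
proof -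
  have "\<eta> x = 1 \<or> \<eta> x = -1" using assms by (auto simp: spin_configs_def)
  then show ?thesis
    by (auto simp: update_def updated_spin_def fun_upd_idem split: option.splits)
qed

lemma resampling_update:
  assumes "\<delta> \<ge> 0"
  shows "resampling x (plus_prob \<delta> x) (\<lambda>\<eta>. map_pmf (\<lambda>m. update x m \<eta>) (mark_pmf \<delta>))"
  unfolding resampling_def
proof (intro conjI ballI allI)
  show "increasing_fun (plus_prob \<delta> x)" by (rule increasing_plus_prob[OF assms])
  fix \<eta> assume \<eta>: "\<eta> \<in> spin_configs"
  let ?p = "1 - exp (- \<delta>)" and ?h = "flip_prob (disagreements \<eta> x)"
  have p: "0 \<le> ?p * ?h" "?p * ?h \<le> 1"
    using assms mult_mono[of ?p 1 ?h 1] by (auto simp: flip_prob_nonneg flip_prob_le_1)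
  then show "0 \<le> plus_prob \<delta> x \<eta>" "plus_prob \<delta> x \<eta> \<le> 1"
    by (auto simp: plus_prob_def Let_def)
  show "set_pmf (map_pmf (\<lambda>m. update x m \<eta>) (mark_pmf \<delta>)) \<subseteq> {\<eta>(x := 1), \<eta>(x := -1)}"
    using update_fun_upd[OF \<eta>, of x] by auto
  fix f :: "config \<Rightarrow> real"
  have upd: "update x (Some c) \<eta> = (if disagreements \<eta> x \<ge> 3 \<or> disagreements \<eta> x = 2 \<and> c then \<eta>(x := - \<eta> x) else \<eta>)" for c
    by (simp add: update_def updated_spin_def)
  have "pexp (map_pmf (\<lambda>m. update x m \<eta>) (mark_pmf \<delta>)) f = (1 - ?p * ?h) * f \<eta> + ?p * ?h * f (\<eta>(x := - \<eta> x))"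
    using assms unfolding integral_map_pmf
    by (simp add: expectation_mark_pmf upd flip_prob_def) (simp add: update_def field_simps)
  also have "\<dots> = plus_prob \<delta> x \<eta> * f (\<eta>(x := 1)) + (1 - plus_prob \<delta> x \<eta>) * f (\<eta>(x := -1))"
  proof -
    have "\<eta> x = 1 \<or> \<eta> x = -1" using \<eta> by (auto simp: spin_configs_def)
    then show ?thesis by (auto simp: plus_prob_def Let_def fun_upd_idem)
  qed
  finally show "pexp (map_pmf (\<lambda>m. update x m \<eta>) (mark_pmf \<delta>)) f =
      plus_prob \<delta> x \<eta> * f (\<eta>(x := 1)) + (1 - plus_prob \<delta> x \<eta>) * f (\<eta>(x := -1))" .
qed

section \<open>The discretised chain\<close>

definition init_pmf :: "site set \<Rightarrow> config pmf" where
  "init_pmf \<Lambda> = Pi_pmf \<Lambda> 1 (\<lambda>_. pmf_of_set {-1, 1})"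

definition marks_pmf :: "real \<Rightarrow> (site \<times> nat) set \<Rightarrow> (site \<times> nat \<Rightarrow> bool option) pmf" where
  "marks_pmf \<delta> A = Pi_pmf A None (\<lambda>_. mark_pmf \<delta>)"

definition chain_pmf :: "real \<Rightarrow> site set \<Rightarrow> (site \<times> nat) list \<Rightarrow> config pmf" where
  "chain_pmf \<delta> \<Lambda> L = map_pmf (\<lambda>(\<eta>, Y). run Y L \<eta>) (pair_pmf (init_pmf \<Lambda>) (marks_pmf \<delta> (set L)))"

lemma map_pair_pmf_bind: "map_pmf (\<lambda>(a, b). F a b) (pair_pmf p q) = bind_pmf p (\<lambda>a. map_pmf (F a) q)"
  by (simp add: pair_pmf_def map_bind_pmf map_pmf_def bind_assoc_pmf bind_return_pmf)

lemma map_pair_pmf_bind': "map_pmf (\<lambda>(a, b). F a b) (pair_pmf p q) = bind_pmf q (\<lambda>b. map_pmf (\<lambda>a. F a b) p)"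
  unfolding map_pair_pmf_bind by (simp add: map_pmf_def) (rule bind_commute_pmf)

text \<open>Drawing a new initial spin is a resampling with constant weight \<open>1/2\<close>,
  applied to a configuration that has the default value \<open>1\<close> there.\<close>

lemma pos_assoc_init:
  assumes "finite \<Lambda>"
  shows "pos_assoc (init_pmf \<Lambda>)"
  using assms
proof induction
  case empty
  have "init_pmf {} = return_pmf (\<lambda>_. 1)" by (simp add: init_pmf_def)
  then show ?case by (simp add: pos_assoc_def spin_configs_def)
next
  case (insert x \<Lambda>)
  have eq: "init_pmf (insert x \<Lambda>) = bind_pmf (init_pmf \<Lambda>) (\<lambda>\<eta>. map_pmf (\<lambda>s. \<eta>(x := s)) (pmf_of_set {-1, 1}))"
    unfolding init_pmf_def using insert by (simp add: Pi_pmf_insert map_pair_pmf_bind')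
  have "resampling x (\<lambda>_. 1/2) (\<lambda>\<eta>. map_pmf (\<lambda>s. \<eta>(x := s)) (pmf_of_set {-1, 1}))"
    unfolding resampling_def by (auto simp: increasing_fun_def integral_pmf_of_set field_simps)
  then show ?case unfolding eq using insert by (intro pos_assoc_bind)
qed

lemma run_cong: "(\<And>p. p \<in> set L \<Longrightarrow> Y p = Y' p) \<Longrightarrow> run Y L \<eta> = run Y' L \<eta>"
  unfolding run_def by (intro fold_cong) auto

text \<open>The position \<open>a\<close> is new, so its mark is independent of the others and can
  be drawn after the run over \<open>L\<close>. This exhibits the chain as a sequence of
  resamplings.\<close>

lemma chain_pmf_snoc:
  assumes "a \<notin> set L"
  shows "chain_pmf \<delta> \<Lambda> (L @ [a]) = bind_pmf (chain_pmf \<delta> \<Lambda> L) (\<lambda>\<eta>. map_pmf (\<lambda>m. update (fst a) m \<eta>) (mark_pmf \<delta>))"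
proof -
  have run: "run (Y(a := m)) (L @ [a]) \<eta> = update (fst a) m (run Y L \<eta>)" for Y m \<eta>
  proof -
    have "run (Y(a := m)) L \<eta> = run Y L \<eta>" by (rule run_cong) (use assms in auto)
    then show ?thesis by (simp add: run_def)
  qed
  have marks: "marks_pmf \<delta> (set (L @ [a])) = map_pmf (\<lambda>(m, Y). Y(a := m)) (pair_pmf (mark_pmf \<delta>) (marks_pmf \<delta> (set L)))"
    unfolding marks_pmf_def using assms by (simp add: Pi_pmf_insert)
  have "map_pmf (\<lambda>Y. run Y (L @ [a]) \<eta>) (marks_pmf \<delta> (set (L @ [a]))) =
      map_pmf (\<lambda>(m, Y). update (fst a) m (run Y L \<eta>)) (pair_pmf (mark_pmf \<delta>) (marks_pmf \<delta> (set L)))" for \<eta>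
    unfolding marks pmf.map_comp by (intro map_pmf_cong refl) (auto simp: run)
  then have "chain_pmf \<delta> \<Lambda> (L @ [a]) =
      bind_pmf (init_pmf \<Lambda>) (\<lambda>\<eta>. bind_pmf (marks_pmf \<delta> (set L)) (\<lambda>Y. map_pmf (\<lambda>m. update (fst a) m (run Y L \<eta>)) (mark_pmf \<delta>)))"
    unfolding chain_pmf_def map_pair_pmf_bind[of "\<lambda>\<eta> Y. run Y (L @ [a]) \<eta>"] by (simp only: map_pair_pmf_bind')
  also have "\<dots> = bind_pmf (chain_pmf \<delta> \<Lambda> L) (\<lambda>\<eta>. map_pmf (\<lambda>m. update (fst a) m \<eta>) (mark_pmf \<delta>))"
    unfolding chain_pmf_def map_pair_pmf_bind by (simp add: bind_assoc_pmf bind_map_pmf)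
  finally show ?thesis .
qed

lemma pos_assoc_chain:
  assumes "finite \<Lambda>" "\<delta> \<ge> 0" "distinct L"
  shows "pos_assoc (chain_pmf \<delta> \<Lambda> L)"
  using assms(3)
proof (induction L rule: rev_induct)
  case Nil
  have "chain_pmf \<delta> \<Lambda> [] = init_pmf \<Lambda>"
    by (simp add: chain_pmf_def run_def marks_pmf_def pair_return_pmf2 pmf.map_comp comp_def)
  then show ?case using pos_assoc_init[OF assms(1)] by simp
next
  case (snoc a L)
  then show ?case
    using chain_pmf_snoc[of a L \<delta> \<Lambda>] pos_assoc_bind[OF _ resampling_update[OF assms(2)]] by simp
qed

text \<open>For a random variable with finitely many values it is enough to compare atoms; in this
  way laws are transferred from the continuous model to a \<open>pmf\<close>.\<close>

lemma (in prob_space) prob_eq_pmf: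
  assumes S: "finite S" "\<And>\<omega>. \<omega> \<in> space M \<Longrightarrow> Z \<omega> \<in> S" "set_pmf p \<subseteq> S"
    and Z: "\<And>z. z \<in> S \<Longrightarrow> {\<omega> \<in> space M. Z \<omega> = z} \<in> events"
      "\<And>z. z \<in> S \<Longrightarrow> prob {\<omega> \<in> space M. Z \<omega> = z} = pmf p z"
  shows "{\<omega> \<in> space M. Z \<omega> \<in> B} \<in> events" "prob {\<omega> \<in> space M. Z \<omega> \<in> B} = measure_pmf.prob p B"
proof -
  have eq: "{\<omega> \<in> space M. Z \<omega> \<in> B} = (\<Union>z\<in>S \<inter> B. {\<omega> \<in> space M. Z \<omega> = z})" using S(2) by auto
  show "{\<omega> \<in> space M. Z \<omega> \<in> B} \<in> events" unfolding eq using S(1) Z(1) by auto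
  have "prob {\<omega> \<in> space M. Z \<omega> \<in> B} = (\<Sum>z\<in>S \<inter> B. prob {\<omega> \<in> space M. Z \<omega> = z})"
    unfolding eq using S(1) Z(1)
    by (intro finite_measure_finite_Union) (auto simp: disjoint_family_on_def)
  also have "\<dots> = (\<Sum>z\<in>S \<inter> B. pmf p z)" using Z(2) by auto
  also have "\<dots> = measure_pmf.prob p (S \<inter> B)" using S(1) by (simp add: measure_measure_pmf_finite)
  also have "\<dots> = measure_pmf.prob p B"
    by (rule measure_pmf.finite_measure_eq_AE) (use S(3) in \<open>auto simp: AE_measure_pmf_iff\<close>)
  finally show "prob {\<omega> \<in> space M. Z \<omega> \<in> B} = measure_pmf.prob p B" .
qed

section \<open>Measure-preserving maps\<close>

definition cylinder :: "site set \<Rightarrow> (site \<Rightarrow> int set) \<Rightarrow> (site \<Rightarrow> (nat \<Rightarrow> real \<times> bool) set) \<Rightarrow> (config \<times> clocks) set" where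
  "cylinder F A B = {\<omega> \<in> space ising_measure. \<forall>x\<in>F. fst \<omega> x \<in> A x \<and> snd \<omega> x \<in> B x}"

definition cylinders :: "(config \<times> clocks) set set" where
  "cylinders = {cylinder F A B |F A B. finite F \<and> (\<forall>x\<in>F. A x \<subseteq> {-1, 1} \<and> B x \<in> K.events)}"

lemma space_ising_measure: "space ising_measure = spin_configs \<times> UNIV"
  by (simp add: ising_measure_def space_pair_measure space_bernoulli_initial spin_configs_def)

lemma cylindersE:
  assumes "C \<in> cylinders"
  obtains F A B where "C = cylinder F A B" "finite F" "\<And>x. x \<in> F \<Longrightarrow> A x \<subseteq> {-1, 1}" "\<And>x. x \<in> F \<Longrightarrow> B x \<in> K.events"
  using assms unfolding cylinders_def by blast

lemma cylindersI:
  "finite F \<Longrightarrow> (\<And>x. x \<in> F \<Longrightarrow> A x \<subseteq> {-1, 1}) \<Longrightarrow> (\<And>x. x \<in> F \<Longrightarrow> B x \<in> K.events) \<Longrightarrow>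
    cylinder F A B \<in> cylinders"
  unfolding cylinders_def by blast

lemma measure_cylinder:
  "finite F \<Longrightarrow> (\<And>x. x \<in> F \<Longrightarrow> A x \<subseteq> {-1, 1}) \<Longrightarrow> (\<And>x. x \<in> F \<Longrightarrow> B x \<in> K.events) \<Longrightarrow>
    I.prob (cylinder F A B) = (\<Prod>x\<in>F. measure spin_measure (A x) * K.prob (B x))"
  unfolding cylinder_def by (rule prob_cylinder(2))

lemma cylinders_sets: "C \<in> cylinders \<Longrightarrow> C \<in> I.events"
  by (elim cylindersE) (simp add: cylinder_def prob_cylinder(1))

lemma space_in_cylinders: "space ising_measure \<in> cylinders"
proof -
  have "cylinder {} (\<lambda>_. {}) (\<lambda>_. {}) = space ising_measure" by (simp add: cylinder_def)
  then show ?thesis using cylindersI[of "{}"] by (metis empty_iff finite.emptyI)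
qed

lemma Int_stable_cylinders: "Int_stable cylinders"
proof (rule Int_stableI)
  fix C C' assume "C \<in> cylinders" "C' \<in> cylinders"
  then obtain F A B F' A' B' where C: "C = cylinder F A B" "finite F" "\<And>x. x \<in> F \<Longrightarrow> A x \<subseteq> {-1, 1}" "\<And>x. x \<in> F \<Longrightarrow> B x \<in> K.events"
    and C': "C' = cylinder F' A' B'" "finite F'" "\<And>x. x \<in> F' \<Longrightarrow> A' x \<subseteq> {-1, 1}" "\<And>x. x \<in> F' \<Longrightarrow> B' x \<in> K.events"
    by (elim cylindersE) blast
  define A'' where "A'' x = (if x \<in> F then if x \<in> F' then A x \<inter> A' x else A x else A' x)" for x
  define B'' where "B'' x = (if x \<in> F then if x \<in> F' then B x \<inter> B' x else B x else B' x)" for x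
  have "C \<inter> C' = cylinder (F \<union> F') A'' B''"
    unfolding C(1) C'(1) cylinder_def A''_def B''_def by auto
  moreover have "cylinder (F \<union> F') A'' B'' \<in> cylinders"
    by (rule cylindersI) (use C C' in \<open>auto simp: A''_def B''_def\<close>)
  ultimately show "C \<inter> C' \<in> cylinders" by simp
qed

lemma cylinders_subset: "cylinders \<subseteq> Pow (space ising_measure)"
  unfolding cylinders_def cylinder_def by auto

text \<open>Both projections are measurable for the sigma-algebra generated by the cylinders, hence
  so is the identity into the product space.\<close>

lemma sets_ising_measure: "I.events = sigma_sets (space ising_measure) cylinders"
proof
  let ?N = "sigma (space ising_measure) cylinders"
  have sp: "space ?N = space ising_measure" by (simp add: space_measure_of_conv)
  have sN: "sets ?N = sigma_sets (space ising_measure) cylinders"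
    by (rule sets_measure_of[OF cylinders_subset])
  have fst: "(\<lambda>\<omega>. fst \<omega>) \<in> measurable ?N bernoulli_initial"
    unfolding bernoulli_initial_def
  proof (rule measurable_PiM_Collect)
    show "fst \<in> space ?N \<rightarrow> (\<Pi>\<^sub>E i\<in>UNIV. space spin_measure)"
      unfolding sp by (auto simp: space_ising_measure spin_configs_def space_uniform_count_measure)
    fix X :: "site \<Rightarrow> int set" and J :: "site set" assume J: "finite J" "\<And>i. i \<in> J \<Longrightarrow> X i \<in> sets spin_measure"
    then have "cylinder J X (\<lambda>_. UNIV) \<in> cylinders"
      using sets.top[of site_clock] by (intro cylindersI) (auto simp: sets_uniform_count_measure)
    then show "{\<omega> \<in> space ?N. \<forall>i\<in>J. fst \<omega> i \<in> X i} \<in> sets ?N"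
      unfolding sp sN by (simp add: cylinder_def)
  qed
  have snd: "(\<lambda>\<omega>. snd \<omega>) \<in> measurable ?N clock_measure"
    unfolding clock_measure_eq
  proof (rule measurable_PiM_Collect)
    show "snd \<in> space ?N \<rightarrow> (\<Pi>\<^sub>E i\<in>UNIV. space site_clock)" by auto
    fix X :: "site \<Rightarrow> (nat \<Rightarrow> real \<times> bool) set" and J :: "site set" assume J: "finite J" "\<And>i. i \<in> J \<Longrightarrow> X i \<in> K.events"
    then have "cylinder J (\<lambda>_. {-1, 1}) X \<in> cylinders" by (intro cylindersI) auto
    moreover have "cylinder J (\<lambda>_. {-1, 1}) X = {\<omega> \<in> space ?N. \<forall>i\<in>J. snd \<omega> i \<in> X i}"
      unfolding cylinder_def sp by (auto simp: space_ising_measure spin_configs_def)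
    ultimately show "{\<omega> \<in> space ?N. \<forall>i\<in>J. snd \<omega> i \<in> X i} \<in> sets ?N"
      unfolding sN by simp
  qed
  have id: "(\<lambda>\<omega>. (fst \<omega>, snd \<omega>)) \<in> measurable ?N ising_measure"
    using measurable_Pair[OF fst snd] by (simp only: ising_measure_def[symmetric])
  show "I.events \<subseteq> sigma_sets (space ising_measure) cylinders"
  proof
    fix E assume E: "E \<in> I.events"
    have "(\<lambda>\<omega>. (fst \<omega>, snd \<omega>)) -` E \<inter> space ?N \<in> sets ?N" by (rule measurable_sets[OF id E])
    moreover have "(\<lambda>\<omega>. (fst \<omega>, snd \<omega>)) -` E \<inter> space ?N = E"
      using sets.sets_into_space[OF E] by (auto simp: sp)
    ultimately show "E \<in> sigma_sets (space ising_measure) cylinders" unfolding sN by simp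
  qed
  show "sigma_sets (space ising_measure) cylinders \<subseteq> I.events"
    by (rule sets.sigma_sets_subset) (use cylinders_sets in auto)
qed

definition preserving :: "(config \<times> clocks \<Rightarrow> config \<times> clocks) \<Rightarrow> bool" where
  "preserving \<Theta> \<longleftrightarrow> \<Theta> \<in> measurable ising_measure ising_measure \<and> distr ising_measure ising_measure \<Theta> = ising_measure"

text \<open>Cylinders generate the events and are stable under intersection, so two probability
  measures that agree on them are equal.\<close>

lemma preservingI:
  assumes sp: "\<And>\<omega>. \<omega> \<in> space ising_measure \<Longrightarrow> \<Theta> \<omega> \<in> space ising_measure"
    and cyl: "\<And>C. C \<in> cylinders \<Longrightarrow> \<Theta> -` C \<inter> space ising_measure \<in> cylinders \<and>
      I.prob (\<Theta> -` C \<inter> space ising_measure) = I.prob C"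
  shows "preserving \<Theta>"
proof -
  have m: "\<Theta> \<in> measurable ising_measure ising_measure"
    by (rule measurable_sigma_sets[OF sets_ising_measure cylinders_subset]) (use sp cyl cylinders_sets in auto)
  have "ising_measure = distr ising_measure ising_measure \<Theta>"
  proof (rule measure_eqI_generator_eq[OF Int_stable_cylinders cylinders_subset])
    fix C assume C: "C \<in> cylinders"
    then show "emeasure ising_measure C = emeasure (distr ising_measure ising_measure \<Theta>) C"
      using cyl[OF C] m cylinders_sets by (simp add: emeasure_distr I.emeasure_eq_measure)
  next
    show "range (\<lambda>_::nat. space ising_measure) \<subseteq> cylinders" using space_in_cylinders by auto
    show "emeasure ising_measure (space ising_measure) \<noteq> \<infinity>" by (simp add: I.emeasure_space_1)
  qed (auto simp: sets_ising_measure)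
  then show ?thesis using m by (simp add: preserving_def)
qed

definition relabel :: "(site \<Rightarrow> site) \<Rightarrow> config \<times> clocks \<Rightarrow> config \<times> clocks" where
  "relabel T \<omega> = (fst \<omega> \<circ> T, snd \<omega> \<circ> T)"

lemma relabel_cylinder:
  assumes "bij T"
  shows "relabel T -` cylinder F A B \<inter> space ising_measure = cylinder (T ` F) (A \<circ> inv T) (B \<circ> inv T)"
proof -
  have "inv T (T x) = x" for x using assms by (simp add: bij_is_inj)
  then show ?thesis
    by (auto simp: cylinder_def relabel_def space_ising_measure spin_configs_def)
qed

lemma preserving_relabel:
  assumes T: "bij T"
  shows "preserving (relabel T)"
proof (rule preservingI)
  fix \<omega> assume "\<omega> \<in> space ising_measure"
  then show "relabel T \<omega> \<in> space ising_measure"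
    by (auto simp: relabel_def space_ising_measure spin_configs_def)
next
  fix C assume "C \<in> cylinders"
  then obtain F A B where C: "C = cylinder F A B" "finite F" "\<And>x. x \<in> F \<Longrightarrow> A x \<subseteq> {-1, 1}" "\<And>x. x \<in> F \<Longrightarrow> B x \<in> K.events"
    by (elim cylindersE) blast
  have inv: "inv T (T x) = x" for x using T by (simp add: bij_is_inj)
  have A: "(A \<circ> inv T) y \<subseteq> {-1, 1}" and B: "(B \<circ> inv T) y \<in> K.events" if "y \<in> T ` F" for y
  proof -
    obtain x where "y = T x" "x \<in> F" using \<open>y \<in> T ` F\<close> by blast
    then show "(A \<circ> inv T) y \<subseteq> {-1, 1}" "(B \<circ> inv T) y \<in> K.events"
      using C(3)[of x] C(4)[of x] inv[of x] by simp_all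
  qed
  have 1: "cylinder (T ` F) (A \<circ> inv T) (B \<circ> inv T) \<in> cylinders"
    using C(2) A B by (intro cylindersI finite_imageI)
  have "I.prob (cylinder (T ` F) (A \<circ> inv T) (B \<circ> inv T)) =
      (\<Prod>x\<in>T ` F. measure spin_measure ((A \<circ> inv T) x) * K.prob ((B \<circ> inv T) x))"
    using C(2) A B by (intro measure_cylinder finite_imageI)
  also have "\<dots> = I.prob C"
    using C inj_on_subset[OF bij_is_inj[OF T] subset_UNIV, of F]
    by (subst prod.reindex) (simp_all add: inv measure_cylinder)
  finally show "relabel T -` C \<inter> space ising_measure \<in> cylinders \<and>
      I.prob (relabel T -` C \<inter> space ising_measure) = I.prob C"
    using 1 unfolding C(1) relabel_cylinder[OF T] by simp
qed

definition flip_init :: "config \<times> clocks \<Rightarrow> config \<times> clocks" where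
  "flip_init \<omega> = (\<lambda>x. - fst \<omega> x, snd \<omega>)"

lemma preserving_flip: "preserving flip_init"
proof (rule preservingI)
  fix \<omega> assume "\<omega> \<in> space ising_measure"
  then show "flip_init \<omega> \<in> space ising_measure"
    by (auto simp: flip_init_def space_ising_measure spin_configs_def)
next
  fix C assume "C \<in> cylinders"
  then obtain F A B where C: "C = cylinder F A B" "finite F" "\<And>x. x \<in> F \<Longrightarrow> A x \<subseteq> {-1, 1}" "\<And>x. x \<in> F \<Longrightarrow> B x \<in> K.events"
    by (elim cylindersE) blast
  define A' where "A' x = uminus ` A x" for x
  have A': "s \<in> A' x \<longleftrightarrow> - s \<in> A x" for s x
    unfolding A'_def by (metis imageE image_eqI minus_minus)
  have sub: "A' x \<subseteq> {-1, 1}" if "x \<in> F" for x using C(3)[OF that] by (auto simp: A'_def)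
  have eq: "flip_init -` C \<inter> space ising_measure = cylinder F A' B"
    unfolding C(1) by (auto simp: cylinder_def flip_init_def A' space_ising_measure spin_configs_def)
  have "measure spin_measure (A' x) = measure spin_measure (A x)" if "x \<in> F" for x
    using C(3)[OF that] sub[OF that] by (simp add: measure_uniform_count_measure A'_def card_image)
  then have "I.prob (cylinder F A' B) = I.prob C"
    unfolding C(1) using C(2-4) sub by (simp add: measure_cylinder)
  moreover have "cylinder F A' B \<in> cylinders" using C(2,4) sub by (intro cylindersI)
  ultimately show "flip_init -` C \<inter> space ising_measure \<in> cylinders \<and>
      I.prob (flip_init -` C \<inter> space ising_measure) = I.prob C"
    unfolding eq by simp
qed

text \<open>An automorphism preserves the number of disagreements, so mapping the sites back turns a
  trajectory for the relabelled clocks into one for the original clocks.\<close>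

lemma obeys_clocks_relabel:
  assumes T: "automorphism T" and s: "obeys_clocks (w \<circ> T) s"
  shows "obeys_clocks w (\<lambda>u. s u \<circ> inv T)"
proof -
  have bij: "bij T" using T by (simp add: automorphism_def)
  have inv [simp]: "T (inv T x) = x" "inv T (T x) = x" for x
    using bij by (simp_all add: bij_is_surj surj_f_inv_f bij_is_inj)
  have nb: "neighbor (inv T x) (inv T y) \<longleftrightarrow> neighbor x y" for x y
    using T unfolding automorphism_def by (metis inv(1))
  have rt: "ring_time (w \<circ> T) (inv T x) n = ring_time w x n" "coin (w \<circ> T) (inv T x) n = coin w x n" for x n
    by (simp_all add: ring_time_def coin_def)
  have dis: "disagreements (\<eta> \<circ> inv T) x = disagreements \<eta> (inv T x)" for \<eta> x
  proof -
    have "{y. neighbor x y \<and> (\<eta> \<circ> inv T) y \<noteq> (\<eta> \<circ> inv T) x} = T ` {y. neighbor (inv T x) y \<and> \<eta> y \<noteq> \<eta> (inv T x)}"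
    proof (intro equalityI subsetI)
      fix y assume "y \<in> {y. neighbor x y \<and> (\<eta> \<circ> inv T) y \<noteq> (\<eta> \<circ> inv T) x}"
      then show "y \<in> T ` {y. neighbor (inv T x) y \<and> \<eta> y \<noteq> \<eta> (inv T x)}"
        using nb by (intro image_eqI[of _ _ "inv T y"]) auto
    next
      fix y assume "y \<in> T ` {y. neighbor (inv T x) y \<and> \<eta> y \<noteq> \<eta> (inv T x)}"
      then show "y \<in> {y. neighbor x y \<and> (\<eta> \<circ> inv T) y \<noteq> (\<eta> \<circ> inv T) x}"
        using nb[of x "T z" for z] by auto
    qed
    then show ?thesis
      by (simp add: disagreements_def card_image[OF inj_on_subset[OF bij_is_inj[OF bij] subset_UNIV]])
  qed
  show ?thesis
    unfolding obeys_clocks_def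
  proof (intro conjI allI impI)
    fix x a b assume ab: "0 \<le> a \<and> a \<le> b \<and> (\<forall>n. ring_time w x n \<notin> {a<..b})"
    then have "\<forall>n. ring_time (w \<circ> T) (inv T x) n \<notin> {a<..b}" by (simp add: rt)
    then have "s b (inv T x) = s a (inv T x)"
      using s ab unfolding obeys_clocks_def by blast
    then show "(s b \<circ> inv T) x = (s a \<circ> inv T) x" by simp
  next
    fix x n
    obtain \<eta> where \<eta>: "\<And>y. \<forall>\<^sub>F u in at_left (ring_time w x n). s u y = \<eta> y"
      "s (ring_time w x n) (inv T x) = updated_spin \<eta> (inv T x) (coin w x n)"
      using s[unfolded obeys_clocks_def, THEN conjunct2, rule_format, of "inv T x" n] unfolding rt by blast
    show "\<exists>\<eta>. (\<forall>y. \<forall>\<^sub>F u in at_left (ring_time w x n). (s u \<circ> inv T) y = \<eta> y) \<and>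
        (s (ring_time w x n) \<circ> inv T) x = updated_spin \<eta> x (coin w x n)"
    proof (intro exI[of _ "\<eta> \<circ> inv T"] conjI allI)
      show "\<forall>\<^sub>F u in at_left (ring_time w x n). (s u \<circ> inv T) y = (\<eta> \<circ> inv T) y" for y
        using \<eta>(1)[of "inv T y"] by simp
      show "(s (ring_time w x n) \<circ> inv T) x = updated_spin (\<eta> \<circ> inv T) x (coin w x n)"
        using \<eta>(2) dis[of \<eta> x] by (simp add: updated_spin_def)
    qed
  qed
qed

text \<open>Disagreements do not see a global flip, so the same rings and coins produce the flipped
  trajectory.\<close>

lemma obeys_clocks_flip:
  assumes s: "obeys_clocks w s"
  shows "obeys_clocks w (\<lambda>u x. - s u x)"
  unfolding obeys_clocks_def
proof (intro conjI allI impI)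
  fix x a b assume "0 \<le> a \<and> a \<le> b \<and> (\<forall>n. ring_time w x n \<notin> {a<..b})"
  then show "- s b x = - s a x" using s unfolding obeys_clocks_def by auto
next
  fix x n
  obtain \<eta> where \<eta>: "\<And>y. \<forall>\<^sub>F u in at_left (ring_time w x n). s u y = \<eta> y"
    "s (ring_time w x n) x = updated_spin \<eta> x (coin w x n)"
    using s[unfolded obeys_clocks_def, THEN conjunct2, rule_format, of x n] by blast
  have "disagreements (\<lambda>y. - \<eta> y) x = disagreements \<eta> x" by (simp add: disagreements_def)
  then have "- s (ring_time w x n) x = updated_spin (\<lambda>y. - \<eta> y) x (coin w x n)"
    using \<eta>(2) by (simp add: updated_spin_def)
  then show "\<exists>\<eta>. (\<forall>y. \<forall>\<^sub>F u in at_left (ring_time w x n). - s u y = \<eta> y) \<and>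
      - s (ring_time w x n) x = updated_spin \<eta> x (coin w x n)"
    using \<eta>(1) by (intro exI[of _ "\<lambda>y. - \<eta> y"]) simp
qed

lemma AE_ising_clocks:
  assumes "AE w in clock_measure. P w"
  shows "AE \<omega> in ising_measure. P (snd \<omega>)"
proof -
  obtain N where N: "N \<in> null_sets clock_measure" "{w. \<not> P w} \<subseteq> N"
    using AE_E3[OF assms] by (metis (no_types, lifting) UNIV_I mem_Collect_eq space_clock_measure subsetI Diff_iff) 
  have s: "space bernoulli_initial \<times> N \<in> I.events"
    unfolding ising_measure_def using N(1) by (intro pair_measureI) auto
  have "emeasure ising_measure (space bernoulli_initial \<times> N) = emeasure bernoulli_initial (space bernoulli_initial) * emeasure clock_measure N"
    unfolding ising_measure_def using N(1) by (intro Clk.emeasure_pair_measure_Times) auto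
  also have "\<dots> = 0" using N(1) by (simp add: null_sets_def)
  finally have "space bernoulli_initial \<times> N \<in> null_sets ising_measure" using s by (simp add: null_sets_def)
  then show ?thesis
    by (rule AE_I') (use N(2) in \<open>auto simp: ising_measure_def space_pair_measure\<close>)
qed

section \<open>Uniqueness and symmetries at a fixed time\<close>

locale ising_process =
  fixes \<sigma> :: "real \<Rightarrow> config \<times> clocks \<Rightarrow> config" and t :: real
  assumes ising: "zero_temp_ising \<sigma>" and t: "t \<ge> 0"
begin

lemma measurable_\<sigma>: "\<sigma> t \<in> measurable ising_measure state_space"
  using ising t by (simp add: zero_temp_ising_def)

lemma \<sigma>_spin: "\<omega> \<in> space ising_measure \<Longrightarrow> \<sigma> t \<omega> x \<in> {-1, 1}"
  using measurable_space[OF measurable_\<sigma>] by (auto simp: state_space_def space_PiM PiE_iff)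

lemma sets_\<sigma>_eq: "{\<omega> \<in> space ising_measure. \<sigma> t \<omega> x = s} \<in> I.events"
proof -
  have "(\<lambda>\<omega>. \<sigma> t \<omega> x) \<in> measurable ising_measure (count_space {-1, 1})"
    by (rule measurable_compose[OF measurable_\<sigma>]) (simp add: state_space_def)
  from measurable_sets[OF this, of "{s} \<inter> {-1, 1}"]
  have "(\<lambda>\<omega>. \<sigma> t \<omega> x) -` ({s} \<inter> {-1, 1}) \<inter> space ising_measure \<in> I.events" by simp
  also have "(\<lambda>\<omega>. \<sigma> t \<omega> x) -` ({s} \<inter> {-1, 1}) \<inter> space ising_measure = {\<omega> \<in> space ising_measure. \<sigma> t \<omega> x = s}"
    using \<sigma>_spin[of _ x] by auto
  finally show ?thesis .
qed

lemma AE_dynamics: "AE \<omega> in ising_measure. \<sigma> 0 \<omega> = fst \<omega> \<and> obeys_clocks (snd \<omega>) (\<lambda>u. \<sigma> u \<omega>)"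
  using ising by (simp add: zero_temp_ising_def)

definition good :: "nat \<Rightarrow> clocks \<Rightarrow> bool" where
  "good K w \<longleftrightarrow> regular_clocks w \<and> finite_range w t K \<and> (\<forall>x n. ring_time w x n \<noteq> t)"

lemma AE_good: "\<exists>K>0. AE \<omega> in ising_measure. good K (snd \<omega>)"
proof -
  obtain K where K: "K > 0" "AE w in clock_measure. finite_range w t K"
    using AE_finite_range[OF t] by blast
  have "AE w in clock_measure. good K w"
    using K(2) AE_regular_clocks AE_no_ring_at[of t] by eventually_elim (simp add: good_def)
  from AE_ising_clocks[OF this] show ?thesis using K(1) by blast
qed

lemma trajectory_unique:
  assumes "good K w" "K > 0" "obeys_clocks w s" "obeys_clocks w s'" "s 0 = s' 0"
  shows "s t = s' t"
proof
  fix x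
  obtain \<Lambda> where "\<And>s s'. follows w \<Lambda> t s \<Longrightarrow> follows w \<Lambda> t s' \<Longrightarrow>
    (\<forall>x\<in>\<Lambda>. s 0 x = s' 0 x) \<Longrightarrow> (\<forall>x\<in>{x}. s t x = s' t x)"
    using finite_influence[of w t K "{x}"] assms(1,2) t unfolding good_def by blast
  then show "s t x = s' t x"
    using obeys_clocks_follows[OF assms(3)] obeys_clocks_follows[OF assms(4)] assms(5) by simp
qed

text \<open>The transformed trajectory and the process itself start from \<open>fst \<omega>\<close>
  and obey the same clocks, so they agree at time \<open>t\<close> by uniqueness. Preservation of
  the measure makes the almost sure properties of the process available at
  \<open>\<Theta> \<omega>\<close>.\<close>

lemma AE_equivariant:
  assumes \<Theta>: "preserving \<Theta>"
    and start: "\<And>\<omega>. \<phi> (fst (\<Theta> \<omega>)) = fst \<omega>"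
    and obeys: "\<And>\<omega> s. obeys_clocks (snd (\<Theta> \<omega>)) s \<Longrightarrow> obeys_clocks (snd \<omega>) (\<lambda>u. \<phi> (s u))"
  shows "AE \<omega> in ising_measure. \<phi> (\<sigma> t (\<Theta> \<omega>)) = \<sigma> t \<omega>"
proof -
  obtain K where K: "K > 0" "AE \<omega> in ising_measure. good K (snd \<omega>)" using AE_good by blast
  have m: "\<Theta> \<in> measurable ising_measure ising_measure" "distr ising_measure ising_measure \<Theta> = ising_measure"
    using \<Theta> by (auto simp: preserving_def)
  have "AE \<omega> in distr ising_measure ising_measure \<Theta>. \<sigma> 0 \<omega> = fst \<omega> \<and> obeys_clocks (snd \<omega>) (\<lambda>u. \<sigma> u \<omega>)"
    unfolding m(2) by (rule AE_dynamics)
  then have "AE \<omega> in ising_measure. \<sigma> 0 (\<Theta> \<omega>) = fst (\<Theta> \<omega>) \<and> obeys_clocks (snd (\<Theta> \<omega>)) (\<lambda>u. \<sigma> u (\<Theta> \<omega>))"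
    by (rule AE_distrD[OF m(1)])
  then show ?thesis using AE_dynamics K(2)
  proof eventually_elim
    case (elim \<omega>)
    show ?case
      by (rule trajectory_unique[OF elim(3) K(1), of "\<lambda>u. \<phi> (\<sigma> u (\<Theta> \<omega>))" "\<lambda>u. \<sigma> u \<omega>"])
        (use elim obeys start in auto)
  qed
qed

lemma prob_equivariant:
  assumes "preserving \<Theta>" "AE \<omega> in ising_measure. \<phi> (\<sigma> t (\<Theta> \<omega>)) = \<sigma> t \<omega>"
    and Q: "{\<omega> \<in> space ising_measure. Q (\<sigma> t \<omega>)} \<in> I.events"
    and Q': "{\<omega> \<in> space ising_measure. Q (\<phi> (\<sigma> t \<omega>))} \<in> I.events"
  shows "I.prob {\<omega> \<in> space ising_measure. Q (\<phi> (\<sigma> t \<omega>))} =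
    I.prob {\<omega> \<in> space ising_measure. Q (\<sigma> t \<omega>)}"
proof -
  have m: "\<Theta> \<in> measurable ising_measure ising_measure" "distr ising_measure ising_measure \<Theta> = ising_measure"
    using assms(1) by (auto simp: preserving_def)
  have "I.prob {\<omega> \<in> space ising_measure. Q (\<phi> (\<sigma> t \<omega>))} =
      measure (distr ising_measure ising_measure \<Theta>) {\<omega> \<in> space ising_measure. Q (\<phi> (\<sigma> t \<omega>))}"
    by (simp add: m(2))
  also have "\<dots> = I.prob (\<Theta> -` {\<omega> \<in> space ising_measure. Q (\<phi> (\<sigma> t \<omega>))} \<inter> space ising_measure)"
    by (rule measure_distr[OF m(1) Q'])
  also have "\<dots> = I.prob {\<omega> \<in> space ising_measure. Q (\<sigma> t \<omega>)}"
  proof (rule measure_eq_AE)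
    show "AE \<omega> in ising_measure. \<omega> \<in> \<Theta> -` {\<omega> \<in> space ising_measure. Q (\<phi> (\<sigma> t \<omega>))} \<inter> space ising_measure
        \<longleftrightarrow> \<omega> \<in> {\<omega> \<in> space ising_measure. Q (\<sigma> t \<omega>)}"
      using assms(2) AE_space by eventually_elim (use measurable_space[OF m(1)] in auto)
    show "\<Theta> -` {\<omega> \<in> space ising_measure. Q (\<phi> (\<sigma> t \<omega>))} \<inter> space ising_measure \<in> I.events"
      by (rule measurable_sets[OF m(1) Q'])
  qed (rule Q)
  finally show ?thesis .
qed

lemma AE_relabel:
  assumes "automorphism T"
  shows "AE \<omega> in ising_measure. \<sigma> t (relabel T \<omega>) \<circ> inv T = \<sigma> t \<omega>"
proof (rule AE_equivariant[OF preserving_relabel])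
  show bij: "bij T" using assms by (simp add: automorphism_def)
  then show "fst (relabel T \<omega>) \<circ> inv T = fst \<omega>" for \<omega>
    by (simp add: relabel_def comp_assoc surj_iff[THEN iffD1, OF bij_is_surj])
  show "obeys_clocks (snd \<omega>) (\<lambda>u. s u \<circ> inv T)" if "obeys_clocks (snd (relabel T \<omega>)) s" for \<omega> s
    using obeys_clocks_relabel[OF assms, of "snd \<omega>" s] that by (simp add: relabel_def)
qed

lemma AE_flip: "AE \<omega> in ising_measure. (\<lambda>x. - \<sigma> t (flip_init \<omega>) x) = \<sigma> t \<omega>"
  by (rule AE_equivariant[OF preserving_flip, of "\<lambda>\<eta> x. - \<eta> x"])
    (auto simp: flip_init_def intro: obeys_clocks_flip)

definition plus :: "config \<times> clocks \<Rightarrow> site set" where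
  "plus \<omega> = {x. \<sigma> t \<omega> x = 1}"

end

section \<open>Association, zero-one law and conclusion\<close>

text \<open>Fatou's lemma for events: the sets \<open>H n\<close> increase to the event in question,
  and each is contained in \<open>G n\<close>.\<close>

lemma (in prob_space) prob_eventually_le:
  assumes G: "\<And>i. G i \<in> events" and le: "\<And>i. prob (G i) \<le> c"
  shows "{\<omega> \<in> space M. \<forall>\<^sub>F i in sequentially. \<omega> \<in> G i} \<in> events"
    "prob {\<omega> \<in> space M. \<forall>\<^sub>F i in sequentially. \<omega> \<in> G i} \<le> c"
proof -
  define H where "H n = (\<Inter>i\<in>{n..}. G i)" for n :: nat
  have H: "H n \<in> events" for n unfolding H_def using G by (intro sets.countable_INT) auto
  have eq: "{\<omega> \<in> space M. \<forall>\<^sub>F i in sequentially. \<omega> \<in> G i} = (\<Union>n. H n)"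
    using sets.sets_into_space[OF G] by (fastforce simp: H_def eventually_sequentially)
  show "{\<omega> \<in> space M. \<forall>\<^sub>F i in sequentially. \<omega> \<in> G i} \<in> events" unfolding eq using H by auto
  have "prob (H n) \<le> c" for n
    using finite_measure_mono[of "H n" "G n"] G[of n] le[of n] by (fastforce simp: H_def)
  moreover have "(\<lambda>n. prob (H n)) \<longlonglongrightarrow> prob (\<Union>n. H n)"
    using H by (intro finite_Lim_measure_incseq) (auto simp: incseq_def H_def)
  ultimately show "prob {\<omega> \<in> space M. \<forall>\<^sub>F i in sequentially. \<omega> \<in> G i} \<le> c"
    unfolding eq by (intro LIMSEQ_le_const2) auto
qed

text \<open>If all probabilities were at most \<open>1 - \<epsilon>\<close>, Fatou's lemma applied
  in \<open>i\<close> and then in \<open>L\<close> would contradict the almost sure statement. No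
  uniformity of the inner limit is required.\<close>

lemma (in prob_space) prob_eventually_eventually:
  assumes G: "\<And>L i. G L i \<in> events" "AE \<omega> in M. \<forall>\<^sub>F L in sequentially. \<forall>\<^sub>F i in sequentially. \<omega> \<in> G L i"
    and "\<epsilon> > 0"
  shows "\<exists>L i. prob (G L i) > 1 - \<epsilon>"
proof (rule ccontr)
  assume "\<not> ?thesis"
  then have le: "prob (G L i) \<le> 1 - \<epsilon>" for L i by (auto simp: not_less)
  define A where "A L = {\<omega> \<in> space M. \<forall>\<^sub>F i in sequentially. \<omega> \<in> G L i}" for L
  have A: "A L \<in> events" "prob (A L) \<le> 1 - \<epsilon>" for L
    unfolding A_def using prob_eventually_le[of "G L", OF G(1) le] by auto
  have "AE \<omega> in M. \<omega> \<in> {\<omega> \<in> space M. \<forall>\<^sub>F L in sequentially. \<omega> \<in> A L}"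
    using G(2) AE_space by eventually_elim (auto simp: A_def)
  then have "prob {\<omega> \<in> space M. \<forall>\<^sub>F L in sequentially. \<omega> \<in> A L} = 1"
    using prob_eventually_le(1)[of A, OF A] by (simp add: prob_eq_1)
  then show False using prob_eventually_le(2)[of A, OF A] assms(3) by simp
qed

section \<open>Approximation by discretised chains\<close>

definition site_list :: "nat \<Rightarrow> site list" where
  "site_list L = (SOME xs. set xs = rect (- int L) (int L) (- int L) (int L) \<and> distinct xs)"

lemma site_list: "set (site_list L) = rect (- int L) (int L) (- int L) (int L)" "distinct (site_list L)"
  using someI_ex[OF finite_distinct_list[OF finite_rect]] unfolding site_list_def by blast+

lemma eventually_subset_site_list:
  assumes "finite \<Lambda>"
  shows "\<forall>\<^sub>F L in sequentially. \<Lambda> \<subseteq> set (site_list L)"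
proof -
  have "\<forall>\<^sub>F L in sequentially. \<forall>p\<in>\<Lambda>. p \<in> set (site_list L)"
  proof (intro eventually_ball_finite[OF assms] ballI)
    fix p :: site
    show "\<forall>\<^sub>F L in sequentially. p \<in> set (site_list L)"
      using eventually_ge_at_top[of "nat (\<bar>fst p\<bar> + \<bar>snd p\<bar>)"]
      by eventually_elim (auto simp: site_list)
  qed
  then show ?thesis by eventually_elim auto
qed

text \<open>The value \<open>1\<close> outside the list is the default value in
  \<open>init_pmf\<close>, so that the two laws can be compared configuration by
  configuration.\<close>

definition approx_init :: "site list \<Rightarrow> config \<times> clocks \<Rightarrow> config" where
  "approx_init xs \<omega> = (\<lambda>x. if x \<in> set xs then fst \<omega> x else 1)"

definition approx :: "real \<Rightarrow> site list \<Rightarrow> nat \<Rightarrow> config \<times> clocks \<Rightarrow> config" where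
  "approx \<delta> xs M \<omega> = run (slot_marks (snd \<omega>) \<delta>) (steps xs M) (approx_init xs \<omega>)"

text \<open>The chain is a function of finitely many initial spins and marks. Each value of these
  data is a cylinder, whose probability factorises over the sites and, by
  \<open>prob_slot_marks\<close>, over the slots, exactly as for the product
  \<open>pmf\<close>.\<close>

lemma approx_law:
  assumes xs: "distinct xs" and \<delta>: "\<delta> > 0"
  shows "{\<omega> \<in> space ising_measure. Q (approx \<delta> xs M \<omega>)} \<in> I.events"
    and "I.prob {\<omega> \<in> space ising_measure. Q (approx \<delta> xs M \<omega>)} =
      measure_pmf.prob (chain_pmf \<delta> (set xs) (steps xs M)) {\<eta>. Q \<eta>}"
proof -
  let ?L = "steps xs M"
  \<comment> \<open>Marks off the list are replaced by \<open>None\<close>, the default in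
    \<open>marks_pmf\<close>; this leaves finitely many values and does not affect the run.\<close>
  define Z where "Z \<omega> = (approx_init xs \<omega>, \<lambda>p. if p \<in> set ?L then slot_marks (snd \<omega>) \<delta> p else None)" for \<omega> :: "config \<times> clocks"
  define S where "S = PiE_dflt (set xs) 1 (\<lambda>_. {-1, 1 :: int}) \<times> PiE_dflt (set ?L) None (\<lambda>_. UNIV :: bool option set)"
  define p where "p = pair_pmf (init_pmf (set xs)) (marks_pmf \<delta> (set ?L))"
  have S: "finite S"
    unfolding S_def by (intro finite_cartesian_product finite_PiE_dflt) auto
  have ZS: "Z \<omega> \<in> S" if "\<omega> \<in> space ising_measure" for \<omega>
    using that by (auto simp: Z_def S_def PiE_dflt_def approx_init_def space_ising_measure spin_configs_def)
  have pS: "set_pmf p \<subseteq> S"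
    unfolding p_def S_def init_pmf_def marks_pmf_def by (auto simp: set_Pi_pmf PiE_dflt_def)
  define B where "B = (\<lambda>(z :: config \<times> (site \<times> nat \<Rightarrow> bool option)) x. {v. \<forall>j\<in>{1..M}. slot_mark \<delta> v j = snd z (x, j)})"
  have cyl: "{\<omega> \<in> space ising_measure. Z \<omega> = z} = cylinder (set xs) (\<lambda>x. {fst z x}) (B z)" if "z \<in> S" for z
  proof -
    have z: "fst z x = 1" if "x \<notin> set xs" for x
      using \<open>z \<in> S\<close> that by (auto simp: S_def PiE_dflt_def)
    have z': "snd z q = None" if "q \<notin> set ?L" for q
      using \<open>z \<in> S\<close> that by (auto simp: S_def PiE_dflt_def)
    have "Z \<omega> = z \<longleftrightarrow> (\<forall>x\<in>set xs. fst \<omega> x = fst z x) \<and> (\<forall>q\<in>set ?L. slot_marks (snd \<omega>) \<delta> q = snd z q)" for \<omega>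
      unfolding Z_def prod_eq_iff fst_conv snd_conv fun_eq_iff approx_init_def using z z' by auto
    also have "\<dots> \<omega> \<longleftrightarrow> (\<forall>x\<in>set xs. fst \<omega> x \<in> {fst z x} \<and> snd \<omega> x \<in> B z x)" for \<omega>
      unfolding B_def set_steps slot_marks_def by auto
    finally show ?thesis unfolding cylinder_def by simp
  qed
  have in_spin: "{fst z x} \<subseteq> {-1, 1}" if "z \<in> S" "x \<in> set xs" for z x
    using that by (auto simp: S_def PiE_dflt_def)
  have sB: "B z x \<in> K.events" for z x
    unfolding B_def by (rule sets_slot_marks)
  have ev: "{\<omega> \<in> space ising_measure. Z \<omega> = z} \<in> I.events" if "z \<in> S" for z
    unfolding cyl[OF that] by (intro cylinders_sets cylindersI in_spin[OF that] sB) auto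
  have pr: "I.prob {\<omega> \<in> space ising_measure. Z \<omega> = z} = pmf p z" if "z \<in> S" for z
  proof -
    have "I.prob {\<omega> \<in> space ising_measure. Z \<omega> = z} =
        (\<Prod>x\<in>set xs. measure spin_measure {fst z x} * K.prob (B z x))"
      unfolding cyl[OF that] by (intro measure_cylinder in_spin[OF that] sB) auto
    also have "\<dots> = (\<Prod>x\<in>set xs. 1/2 * (\<Prod>j\<in>{1..M}. mark_weight \<delta> (snd z (x, j))))"
    proof (intro prod.cong refl arg_cong2[where f = "(*)"])
      fix x assume "x \<in> set xs"
      then show "measure spin_measure {fst z x} = 1/2"
        using in_spin[OF that] by (simp add: measure_uniform_count_measure)
      show "K.prob (B z x) = (\<Prod>j\<in>{1..M}. mark_weight \<delta> (snd z (x, j)))"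
        unfolding B_def by (rule prob_slot_marks[OF \<delta>])
    qed
    also have "\<dots> = (\<Prod>x\<in>set xs. 1/2) * (\<Prod>q\<in>set ?L. mark_weight \<delta> (snd z q))"
      by (simp only: set_steps prod.distrib prod.cartesian_product split_def prod.collapse)
    also have "(\<Prod>x\<in>set xs. 1/2) = pmf (init_pmf (set xs)) (fst z)"
      using that in_spin[OF that] unfolding init_pmf_def S_def
      by (subst pmf_Pi') (auto simp: PiE_dflt_def intro!: prod.cong)
    also have "(\<Prod>q\<in>set ?L. mark_weight \<delta> (snd z q)) = pmf (marks_pmf \<delta> (set ?L)) (snd z)"
      using that \<delta> unfolding marks_pmf_def S_def
      by (subst pmf_Pi') (auto simp: PiE_dflt_def pmf_mark_pmf)
    also have "pmf (init_pmf (set xs)) (fst z) * pmf (marks_pmf \<delta> (set ?L)) (snd z) = pmf p z"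
      unfolding p_def by (metis pmf_pair prod.collapse)
    finally show ?thesis .
  qed
  have run: "approx \<delta> xs M \<omega> = (case Z \<omega> of (\<eta>, Y) \<Rightarrow> run Y ?L \<eta>)" for \<omega>
    unfolding approx_def Z_def prod.case by (rule run_cong) simp
  let ?B = "{z. Q (case z of (\<eta>, Y) \<Rightarrow> run Y ?L \<eta>)}"
  note law = I.prob_eq_pmf[OF S ZS pS ev pr, of ?B]
  show "{\<omega> \<in> space ising_measure. Q (approx \<delta> xs M \<omega>)} \<in> I.events"
    using law(1) unfolding run by simp
  show "I.prob {\<omega> \<in> space ising_measure. Q (approx \<delta> xs M \<omega>)} =
      measure_pmf.prob (chain_pmf \<delta> (set xs) ?L) {\<eta>. Q \<eta>}"
    using law(2) unfolding run chain_pmf_def p_def by (simp add: vimage_def)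
qed

definition plus_set :: "config \<Rightarrow> site set" where
  "plus_set \<eta> = {x. \<eta> x = 1}"

lemma approx_association:
  assumes "distinct xs" "\<delta> > 0" and Q: "increasing_event Q" "increasing_event Q'"
  shows "I.prob {\<omega> \<in> space ising_measure. Q (plus_set (approx \<delta> xs M \<omega>))} *
      I.prob {\<omega> \<in> space ising_measure. Q' (plus_set (approx \<delta> xs M \<omega>))} \<le>
    I.prob {\<omega> \<in> space ising_measure. Q (plus_set (approx \<delta> xs M \<omega>)) \<and> Q' (plus_set (approx \<delta> xs M \<omega>))}"
proof -
  let ?\<mu> = "chain_pmf \<delta> (set xs) (steps xs M)"
  let ?f = "\<lambda>Q. indicator {\<eta>. Q (plus_set \<eta>)} :: config \<Rightarrow> real"
  have inc: "increasing_fun (?f Q)" if Q: "increasing_event Q" for Q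
    unfolding increasing_fun_def
  proof (intro ballI impI)
    fix \<eta> \<eta>' assume \<eta>: "\<eta> \<in> spin_configs" "\<eta>' \<in> spin_configs" "\<eta> \<le> \<eta>'"
    have "plus_set \<eta> \<subseteq> plus_set \<eta>'"
    proof
      fix x assume "x \<in> plus_set \<eta>"
      moreover have "\<eta> x \<le> \<eta>' x" "\<eta>' x \<in> {-1, 1}" using \<eta> by (auto simp: le_fun_def spin_configs_def)
      ultimately show "x \<in> plus_set \<eta>'" by (auto simp: plus_set_def)
    qed
    then show "?f Q \<eta> \<le> ?f Q \<eta>'" using Q by (auto simp: increasing_event_def indicator_def)
  qed
  have "pos_assoc ?\<mu>" by (rule pos_assoc_chain) (use assms distinct_steps in auto)
  then have "pexp ?\<mu> (?f Q) * pexp ?\<mu> (?f Q') \<le> pexp ?\<mu> (\<lambda>\<eta>. ?f Q \<eta> * ?f Q' \<eta>)"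
    using inc[OF Q(1)] inc[OF Q(2)] unfolding pos_assoc_def by blast
  also have "(\<lambda>\<eta>. ?f Q \<eta> * ?f Q' \<eta>) = ?f (\<lambda>S. Q S \<and> Q' S)"
    by (auto simp: indicator_def fun_eq_iff)
  finally show ?thesis
    using approx_law(2)[OF assms(1,2), of "\<lambda>\<eta>. Q (plus_set \<eta>)" M]
      approx_law(2)[OF assms(1,2), of "\<lambda>\<eta>. Q' (plus_set \<eta>)" M]
      approx_law(2)[OF assms(1,2), of "\<lambda>\<eta>. Q (plus_set \<eta>) \<and> Q' (plus_set \<eta>)" M]
    by simp
qed

lemma automorphism_inv:
  assumes "automorphism T"
  shows "automorphism (inv T)"
proof -
  have bij: "bij T" using assms by (simp add: automorphism_def)
  have "neighbor (inv T x) (inv T y) \<longleftrightarrow> neighbor x y" for x y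
    using assms surj_f_inv_f[OF bij_is_surj[OF bij]] unfolding automorphism_def by metis
  then show ?thesis using bij_imp_bij_inv[OF bij] by (simp add: automorphism_def)
qed

lemma local_event_vimage:
  assumes "local_event Q" "bij T"
  shows "local_event (\<lambda>S. Q (T -` S))"
proof -
  obtain B where B: "finite B" "\<And>S. Q S \<longleftrightarrow> Q (S \<inter> B)" using assms(1) unfolding local_event_def by metis
  have "T -` (S \<inter> T ` B) = T -` S \<inter> B" for S
    by (simp add: inj_vimage_image_eq[OF bij_is_inj[OF assms(2)]])
  then have "T -` (S \<inter> T ` B) \<inter> B = T -` S \<inter> B" for S by auto
  then have "Q (T -` S) \<longleftrightarrow> Q (T -` (S \<inter> T ` B))" for S
    using B(2)[of "T -` S"] B(2)[of "T -` (S \<inter> T ` B)"] by simp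
  then show ?thesis using B(1) unfolding local_event_def by blast
qed

context ising_process
begin

text \<open>The finite set \<Lambda> that determines \<open>B\<close> depends on the sample, so the
  volume has to grow until it contains \<Lambda>. Only within a fixed volume are there finitely many
  rings, whose order a fine mesh respects; hence the order of the two limits.\<close>

lemma AE_approx:
  assumes B: "finite B"
  shows "AE \<omega> in ising_measure. \<forall>\<^sub>F L in sequentially. \<forall>\<^sub>F i in sequentially.
    \<forall>x\<in>B. approx (1 / Suc i) (site_list L) (nat \<lfloor>t * Suc i\<rfloor>) \<omega> x = \<sigma> t \<omega> x"
proof -
  obtain K where K: "K > 0" "AE \<omega> in ising_measure. good K (snd \<omega>)" using AE_good by blast
  show ?thesis using K(2) AE_dynamics
  proof eventually_elim
    case (elim \<omega>)
    let ?w = "snd \<omega>"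
    have w: "regular_clocks ?w" "finite_range ?w t K" "\<And>x n. ring_time ?w x n \<noteq> t"
      using elim(1) by (auto simp: good_def)
    obtain \<Lambda> where \<Lambda>: "finite \<Lambda>" "\<And>s s'. follows ?w \<Lambda> t s \<Longrightarrow> follows ?w \<Lambda> t s' \<Longrightarrow>
      (\<forall>x\<in>\<Lambda>. s 0 x = s' 0 x) \<Longrightarrow> (\<forall>x\<in>B. s t x = s' t x)"
      using finite_influence[OF w(1,2) K(1) t B] by blast
    show ?case using eventually_subset_site_list[OF \<Lambda>(1)]
    proof eventually_elim
      case (elim L)
      let ?xs = "site_list L"
      let ?s = "finite_volume ?w (set ?xs) t (approx_init ?xs \<omega>)"
      have "\<forall>x\<in>B. \<sigma> t \<omega> x = ?s t x"
      proof (rule \<Lambda>(2)[of "\<lambda>u. \<sigma> u \<omega>" ?s])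
        show "follows ?w \<Lambda> t (\<lambda>u. \<sigma> u \<omega>)"
          using \<open>\<sigma> 0 \<omega> = fst \<omega> \<and> _\<close> by (simp add: obeys_clocks_follows)
        show "follows ?w \<Lambda> t ?s"
          using finite_volume_follows[OF w(1), of "set ?xs" t] follows_subset elim by blast
        show "\<forall>x\<in>\<Lambda>. \<sigma> 0 \<omega> x = ?s 0 x"
          using \<open>\<sigma> 0 \<omega> = fst \<omega> \<and> _\<close> elim finite_volume_start[OF w(1), of "set ?xs"]
          by (auto simp: approx_init_def)
      qed
      then have s: "\<sigma> t \<omega> x = fold (apply_ring ?w) (ring_list ?w (set ?xs) t) (approx_init ?xs \<omega>) x" if "x \<in> B" for x
        using that finite_volume_end[OF w(1), of "set ?xs" t] by simp
      show ?case using eventually_run_eq[OF w(1) site_list(2)[of L] t w(3)]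
        by eventually_elim (use s in \<open>simp add: approx_def\<close>)
    qed
  qed
qed

lemma local_event_sets:
  assumes "local_event Q"
  shows "{\<omega> \<in> space ising_measure. Q (plus \<omega>)} \<in> I.events"
proof -
  obtain B where B: "finite B" "\<And>S. Q S \<longleftrightarrow> Q (S \<inter> B)" using assms unfolding local_event_def by metis
  have "{\<omega> \<in> space ising_measure. Q (plus \<omega>)} =
      (\<Union>A\<in>{A. A \<subseteq> B \<and> Q A}. {\<omega> \<in> space ising_measure. \<forall>x\<in>B. \<sigma> t \<omega> x = (if x \<in> A then 1 else -1)})" (is "_ = ?U")
  proof (intro equalityI subsetI)
    fix \<omega> assume \<omega>: "\<omega> \<in> {\<omega> \<in> space ising_measure. Q (plus \<omega>)}"
    then show "\<omega> \<in> ?U"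
      using B(2)[of "plus \<omega>"] \<sigma>_spin[of \<omega>] by (intro UN_I[of "plus \<omega> \<inter> B"]) (auto simp: plus_def)
  next
    fix \<omega> assume "\<omega> \<in> ?U"
    then obtain A where A: "A \<subseteq> B" "Q A" "\<omega> \<in> space ising_measure"
      "\<And>x. x \<in> B \<Longrightarrow> \<sigma> t \<omega> x = (if x \<in> A then 1 else -1)" by auto
    have "plus \<omega> \<inter> B = A" using A(1) A(4) by (auto simp: plus_def split: if_splits)
    then show "\<omega> \<in> {\<omega> \<in> space ising_measure. Q (plus \<omega>)}" using A B(2)[of "plus \<omega>"] by simp
  qed
  also have "?U \<in> I.events"
    using B(1) by (intro sets.finite_UN sets.sets_Collect_finite_All sets_\<sigma>_eq) auto
  finally show ?thesis .
qed

text \<open>For a suitable pair \<open>L\<close>, \<open>i\<close> the chain and the process agree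
  on \<open>B \<union> B'\<close> except with probability below \<epsilon>, and association passes
  over from the chain.\<close>

lemma association:
  assumes Q: "local_event Q" "local_event Q'" "increasing_event Q" "increasing_event Q'"
  shows "I.prob {\<omega> \<in> space ising_measure. Q (plus \<omega>)} *
      I.prob {\<omega> \<in> space ising_measure. Q' (plus \<omega>)} \<le>
    I.prob {\<omega> \<in> space ising_measure. Q (plus \<omega>) \<and> Q' (plus \<omega>)}"
    (is "?P Q * ?P Q' \<le> ?P (\<lambda>S. Q S \<and> Q' S)")
proof (rule field_le_epsilon)
  fix e :: real assume "e > 0"
  \<comment> \<open>As \<epsilon> \<le> 1, replacing the two factors costs at most
    \<open>3 * \<epsilon>\<close>, and replacing the joint event costs another \<epsilon>.\<close>
  define \<epsilon> where "\<epsilon> = min 1 (e / 4)"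
  have \<epsilon>: "0 < \<epsilon>" "\<epsilon> \<le> 1" "4 * \<epsilon> \<le> e" using \<open>e > 0\<close> by (auto simp: \<epsilon>_def)
  obtain B B' where B: "finite B" "\<And>S. Q S \<longleftrightarrow> Q (S \<inter> B)" "finite B'" "\<And>S. Q' S \<longleftrightarrow> Q' (S \<inter> B')"
    using Q(1,2) unfolding local_event_def by metis
  define C where "C L i = approx (1 / Suc i) (site_list L) (nat \<lfloor>t * Suc i\<rfloor>)" for L i
  define G where "G L i = {\<omega> \<in> space ising_measure. \<forall>x\<in>B \<union> B'. C L i \<omega> x = \<sigma> t \<omega> x}" for L i
  have sets_C: "{\<omega> \<in> space ising_measure. R (C L i \<omega>)} \<in> I.events" for L i R
    unfolding C_def by (rule approx_law(1)[OF site_list(2)]) simp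
  have "{\<omega> \<in> space ising_measure. C L i \<omega> x = \<sigma> t \<omega> x} \<in> I.events" for L i x
  proof -
    have "{\<omega> \<in> space ising_measure. C L i \<omega> x = \<sigma> t \<omega> x} = (\<Union>s\<in>{-1, 1}.
        {\<omega> \<in> space ising_measure. C L i \<omega> x = s} \<inter> {\<omega> \<in> space ising_measure. \<sigma> t \<omega> x = s})"
    proof (intro equalityI subsetI)
      fix \<omega> assume "\<omega> \<in> {\<omega> \<in> space ising_measure. C L i \<omega> x = \<sigma> t \<omega> x}"
      then show "\<omega> \<in> (\<Union>s\<in>{-1, 1}. {\<omega> \<in> space ising_measure. C L i \<omega> x = s} \<inter> {\<omega> \<in> space ising_measure. \<sigma> t \<omega> x = s})"
        using \<sigma>_spin[of \<omega> x] by (intro UN_I[of "\<sigma> t \<omega> x"]) auto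
    qed auto
    also have "\<dots> \<in> I.events"
      using sets_C[of "\<lambda>\<eta>. \<eta> x = _"] sets_\<sigma>_eq by (intro sets.finite_UN sets.Int) auto
    finally show ?thesis .
  qed
  then have G: "G L i \<in> I.events" for L i
    unfolding G_def using B by (intro sets.sets_Collect_finite_All) auto
  have "AE \<omega> in ising_measure. \<forall>\<^sub>F L in sequentially. \<forall>\<^sub>F i in sequentially. \<omega> \<in> G L i"
    using AE_approx[of "B \<union> B'"] B(1,3) AE_space unfolding G_def C_def by auto
  from I.prob_eventually_eventually[OF G this \<epsilon>(1)]
  obtain L i where Li: "I.prob (G L i) > 1 - \<epsilon>" by blast
  let ?C = "\<lambda>R. I.prob {\<omega> \<in> space ising_measure. R (plus_set (C L i \<omega>))}"
  have near: "\<bar>?P R - ?C R\<bar> \<le> \<epsilon>" if R: "\<And>S. R S \<longleftrightarrow> R (S \<inter> (B \<union> B'))" for R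
  proof -
    have locR: "local_event R" unfolding local_event_def using B R by (intro exI[of _ "B \<union> B'"]) auto
    have eq: "R (plus \<omega>) \<longleftrightarrow> R (plus_set (C L i \<omega>))" if "\<omega> \<in> G L i" for \<omega>
    proof -
      have "plus \<omega> \<inter> (B \<union> B') = plus_set (C L i \<omega>) \<inter> (B \<union> B')"
        using that by (auto simp: G_def plus_def plus_set_def)
      then show ?thesis using R by metis
    qed
    note s = local_event_sets[OF locR] sets_C[of "\<lambda>\<eta>. R (plus_set \<eta>)" L i] G[of L i]
    have "I.prob (space ising_measure - G L i) < \<epsilon>"
      using I.prob_compl[OF G[of L i]] Li by simp
    moreover have "?P R \<le> I.prob ({\<omega> \<in> space ising_measure. R (plus_set (C L i \<omega>))} \<union> (space ising_measure - G L i))"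
      using s eq by (intro I.finite_measure_mono) auto
    moreover have "\<dots> \<le> ?C R + I.prob (space ising_measure - G L i)"
      using s by (intro measure_Un_le) auto
    moreover have "?C R \<le> I.prob ({\<omega> \<in> space ising_measure. R (plus \<omega>)} \<union> (space ising_measure - G L i))"
      using s eq by (intro I.finite_measure_mono) auto
    moreover have "\<dots> \<le> ?P R + I.prob (space ising_measure - G L i)"
      using s by (intro measure_Un_le) auto
    ultimately show ?thesis by linarith
  qed
  have loc: "Q S \<longleftrightarrow> Q (S \<inter> (B \<union> B'))" "Q' S \<longleftrightarrow> Q' (S \<inter> (B \<union> B'))" for S
    using B(2)[of S] B(2)[of "S \<inter> (B \<union> B')"] B(4)[of S] B(4)[of "S \<inter> (B \<union> B')"]
    by (simp_all add: Int_assoc Int_absorb1)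
  have "?P Q * ?P Q' \<le> (?C Q + \<epsilon>) * (?C Q' + \<epsilon>)"
    using near[of Q, OF loc(1)] near[of Q', OF loc(2)] by (intro mult_mono) auto
  also have "\<dots> = ?C Q * ?C Q' + \<epsilon> * ?C Q + \<epsilon> * ?C Q' + \<epsilon> * \<epsilon>" by (simp add: algebra_simps)
  also have "\<dots> \<le> ?C (\<lambda>S. Q S \<and> Q' S) + \<epsilon> * 1 + \<epsilon> * 1 + \<epsilon> * 1"
    using \<epsilon> I.prob_le_1 approx_association[OF site_list(2) _ Q(3,4), of "1 / Suc i"]
    unfolding C_def by (intro add_mono mult_left_mono) auto
  also have "\<dots> \<le> ?P (\<lambda>S. Q S \<and> Q' S) + 4 * \<epsilon>"
    using near[of "\<lambda>S. Q S \<and> Q' S"] loc by fastforce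
  finally show "?P Q * ?P Q' \<le> ?P (\<lambda>S. Q S \<and> Q' S) + e" using \<epsilon>(3) by simp
qed

lemma plus_eq: "plus \<omega> = plus_set (\<sigma> t \<omega>)"
  by (simp add: plus_def plus_set_def)

lemma flip_invariance:
  assumes "local_event Q"
  shows "I.prob {\<omega> \<in> space ising_measure. Q (- plus \<omega>)} =
    I.prob {\<omega> \<in> space ising_measure. Q (plus \<omega>)}"
proof -
  have "plus_set (\<lambda>x. - \<sigma> t \<omega> x) = - plus \<omega>" if "\<omega> \<in> space ising_measure" for \<omega>
    using \<sigma>_spin[OF that] by (force simp: plus_set_def plus_def)
  then have eq: "{\<omega> \<in> space ising_measure. Q (- plus \<omega>)} = {\<omega> \<in> space ising_measure. Q (plus_set (\<lambda>x. - \<sigma> t \<omega> x))}"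
    by (intro Collect_cong conj_cong refl) simp
  show ?thesis
    unfolding eq
    using prob_equivariant[OF preserving_flip AE_flip, of "\<lambda>\<eta>. Q (plus_set \<eta>)"]
      local_event_sets[OF assms] local_event_sets[OF local_event_compl[OF assms]]
    by (simp add: plus_eq[symmetric] eq[symmetric])
qed

lemma invariance:
  assumes Q: "local_event Q" and T: "automorphism T"
  shows "I.prob {\<omega> \<in> space ising_measure. Q (T -` plus \<omega>)} =
    I.prob {\<omega> \<in> space ising_measure. Q (plus \<omega>)}"
proof -
  have bij: "bij T" using T by (simp add: automorphism_def)
  have inv: "inv (inv T) = T" by (rule inv_inv_eq[OF bij])
  have eq: "plus_set (\<sigma> t \<omega> \<circ> inv (inv T)) = T -` plus \<omega>" for \<omega>
    unfolding inv by (auto simp: plus_set_def plus_def)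
  have "bij (inv T)" by (rule bij_imp_bij_inv[OF bij])
  from prob_equivariant[OF preserving_relabel[OF this] AE_relabel[OF automorphism_inv[OF T]], of "\<lambda>\<eta>. Q (plus_set \<eta>)"]
  show ?thesis
    using local_event_sets[OF Q] local_event_sets[OF local_event_vimage[OF Q bij]]
    unfolding eq plus_eq[symmetric] by simp
qed

lemma sets_plus: "{\<omega> \<in> space ising_measure. x \<in> plus \<omega>} \<in> I.events"
  unfolding plus_def mem_Collect_eq by (rule sets_\<sigma>_eq)

lemma planar_plus: "planar_random_set ising_measure plus"
  by unfold_locales (rule sets_plus association invariance flip_invariance; assumption)+

text \<open>By flip invariance each local event has the same probability for the complement as for
  the plus set, so all hypotheses carry over.\<close>

lemma planar_minus: "planar_random_set ising_measure (\<lambda>\<omega>. - plus \<omega>)"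
proof unfold_locales
  fix x
  have "{\<omega> \<in> space ising_measure. x \<in> - plus \<omega>} = space ising_measure - {\<omega> \<in> space ising_measure. x \<in> plus \<omega>}" by auto
  then show "{\<omega> \<in> space ising_measure. x \<in> - plus \<omega>} \<in> I.events" using sets_plus[of x] by auto
next
  fix Q Q' assume Q: "local_event Q" "local_event Q'" "increasing_event Q" "increasing_event Q'"
  then show "I.prob {\<omega> \<in> space ising_measure. Q (- plus \<omega>)} * I.prob {\<omega> \<in> space ising_measure. Q' (- plus \<omega>)}
      \<le> I.prob {\<omega> \<in> space ising_measure. Q (- plus \<omega>) \<and> Q' (- plus \<omega>)}"
    using association[OF Q] flip_invariance[of Q] flip_invariance[of Q']
      flip_invariance[OF local_event_conj[OF Q(1,2)]] by simp
next
  fix Q T assume Q: "local_event Q" and T: "automorphism T"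
  have bij: "bij T" using T by (simp add: automorphism_def)
  show "I.prob {\<omega> \<in> space ising_measure. Q (T -` (- plus \<omega>))} =
      I.prob {\<omega> \<in> space ising_measure. Q (- plus \<omega>)}"
    using flip_invariance[OF local_event_vimage[OF Q bij]] invariance[OF Q T] flip_invariance[OF Q] by simp
next
  fix Q assume "local_event Q"
  then show "I.prob {\<omega> \<in> space ising_measure. Q (- (- plus \<omega>))} =
      I.prob {\<omega> \<in> space ising_measure. Q (- plus \<omega>)}"
    using flip_invariance by simp
qed

end

section \<open>Mixing under translations\<close>

definition shift :: "nat \<Rightarrow> site \<Rightarrow> site" where
  "shift n = (\<lambda>(x, y). (x + int n, y + 0))"

lemma automorphism_shift: "automorphism (shift n)"
  unfolding shift_def by (rule automorphisms(1))

lemma bij_shift: "bij (shift n)"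
  using automorphism_shift by (simp add: automorphism_def)

lemma disjoint_cylinders:
  assumes "F \<inter> F' = {}" "finite F" "finite F'"
    and "\<And>x. x \<in> F \<Longrightarrow> A x \<subseteq> {-1, 1}" "\<And>x. x \<in> F \<Longrightarrow> B x \<in> K.events"
    and "\<And>x. x \<in> F' \<Longrightarrow> A' x \<subseteq> {-1, 1}" "\<And>x. x \<in> F' \<Longrightarrow> B' x \<in> K.events"
  shows "I.prob (cylinder F A B \<inter> cylinder F' A' B') =
    I.prob (cylinder F A B) * I.prob (cylinder F' A' B')"
proof -
  define A'' where "A'' x = (if x \<in> F then A x else A' x)" for x
  define B'' where "B'' x = (if x \<in> F then B x else B' x)" for x
  let ?w = "\<lambda>A B x. measure spin_measure (A x) * K.prob (B x)"
  have "cylinder F A B \<inter> cylinder F' A' B' = cylinder (F \<union> F') A'' B''"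
    unfolding cylinder_def A''_def B''_def using assms(1) by auto
  then have "I.prob (cylinder F A B \<inter> cylinder F' A' B') = (\<Prod>x\<in>F \<union> F'. ?w A'' B'' x)"
  proof (simp only:, intro measure_cylinder)
    show "finite (F \<union> F')" using assms(2,3) by simp
    show "A'' x \<subseteq> {-1, 1}" "B'' x \<in> K.events" if "x \<in> F \<union> F'" for x
      using that assms(4)[of x] assms(5)[of x] assms(6)[of x] assms(7)[of x] unfolding A''_def B''_def by auto
  qed
  also have "\<dots> = (\<Prod>x\<in>F. ?w A'' B'' x) * (\<Prod>x\<in>F'. ?w A'' B'' x)"
    using assms(1-3) by (intro prod.union_disjoint)
  also have "(\<Prod>x\<in>F. ?w A'' B'' x) = (\<Prod>x\<in>F. ?w A B x)"
    by (intro prod.cong) (auto simp: A''_def B''_def)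
  also have "(\<Prod>x\<in>F'. ?w A'' B'' x) = (\<Prod>x\<in>F'. ?w A' B' x)"
    using assms(1) by (intro prod.cong) (auto simp: A''_def B''_def)
  finally show ?thesis using assms by (simp add: measure_cylinder)
qed

text \<open>A far translation separates the two finite sets of sites, and cylinders over disjoint
  sets are independent.\<close>

lemma cylinder_mixing:
  assumes "C \<in> cylinders" "C' \<in> cylinders"
  shows "\<forall>\<^sub>F n in sequentially. I.prob (C \<inter> (relabel (shift n) -` C' \<inter> space ising_measure)) =
    I.prob C * I.prob C'"
proof -
  obtain F A B where C: "C = cylinder F A B" "finite F" "\<And>x. x \<in> F \<Longrightarrow> A x \<subseteq> {-1, 1}" "\<And>x. x \<in> F \<Longrightarrow> B x \<in> K.events"
    using assms(1) by (elim cylindersE) blast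
  obtain F' A' B' where C': "C' = cylinder F' A' B'" "finite F'" "\<And>x. x \<in> F' \<Longrightarrow> A' x \<subseteq> {-1, 1}" "\<And>x. x \<in> F' \<Longrightarrow> B' x \<in> K.events"
    using assms(2) by (elim cylindersE) blast
  have "\<forall>\<^sub>F n in sequentially. \<forall>x\<in>F. \<forall>y\<in>F'. x \<noteq> shift n y"
  proof (intro eventually_ball_finite C(2) C'(2) ballI)
    fix x y
    show "\<forall>\<^sub>F n in sequentially. x \<noteq> shift n y"
      using eventually_gt_at_top[of "nat (fst x - fst y)"]
      by eventually_elim (auto simp: shift_def split_def)
  qed
  then show ?thesis
  proof eventually_elim
    case (elim n)
    let ?T = "shift n"
    have inv: "inv ?T (?T x) = x" for x using bij_shift by (simp add: bij_is_inj)
    have A: "(A' \<circ> inv ?T) y \<subseteq> {-1, 1}" and B: "(B' \<circ> inv ?T) y \<in> K.events" if "y \<in> ?T ` F'" for y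
    proof -
      obtain x where "y = ?T x" "x \<in> F'" using \<open>y \<in> ?T ` F'\<close> by blast
      then show "(A' \<circ> inv ?T) y \<subseteq> {-1, 1}" "(B' \<circ> inv ?T) y \<in> K.events"
        using C'(3)[of x] C'(4)[of x] inv[of x] by simp_all
    qed
    have "I.prob (relabel ?T -` C' \<inter> space ising_measure) = measure (distr ising_measure ising_measure (relabel ?T)) C'"
      using preserving_relabel[OF bij_shift, of n] cylinders_sets[OF assms(2)]
      by (subst measure_distr) (auto simp: preserving_def)
    also have "\<dots> = I.prob C'"
      using preserving_relabel[OF bij_shift, of n] by (simp add: preserving_def)
    finally have "I.prob (cylinder (?T ` F') (A' \<circ> inv ?T) (B' \<circ> inv ?T)) = I.prob C'"
      unfolding C'(1) relabel_cylinder[OF bij_shift] .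
    moreover have "I.prob (cylinder F A B \<inter> cylinder (?T ` F') (A' \<circ> inv ?T) (B' \<circ> inv ?T)) =
        I.prob (cylinder F A B) * I.prob (cylinder (?T ` F') (A' \<circ> inv ?T) (B' \<circ> inv ?T))"
      by (rule disjoint_cylinders) (use elim C(2-4) C'(2) A B in blast)+
    ultimately show ?case unfolding C(1) C'(1) relabel_cylinder[OF bij_shift] by simp
  qed
qed

lemma ising_dynkin [consumes 1, case_names cylinder compl union]:
  assumes D: "D \<in> I.events"
    and cyl: "\<And>C. C \<in> cylinders \<Longrightarrow> P C"
    and compl: "\<And>D. D \<in> I.events \<Longrightarrow> P D \<Longrightarrow> P (space ising_measure - D)"
    and union: "\<And>D :: nat \<Rightarrow> _. disjoint_family D \<Longrightarrow> range D \<subseteq> I.events \<Longrightarrow> (\<And>i. P (D i)) \<Longrightarrow> P (\<Union>i. D i)"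
  shows "P D"
proof -
  have "P (space ising_measure)" by (rule cyl[OF space_in_cylinders])
  then have e: "P {}" using compl[OF sets.top] by simp
  show ?thesis
    using Int_stable_cylinders cylinders_subset D[unfolded sets_ising_measure]
    by (rule sigma_sets_induct_disjoint)
      (use cyl e compl union in \<open>auto simp: sets_ising_measure[symmetric]\<close>)
qed

text \<open>The zero-one law compares an invariant event with cylinders, so only one of the two
  events has to be general and a single induction over generated events suffices.\<close>

lemma shift_mixing:
  assumes "D \<in> I.events" "C \<in> cylinders"
  shows "(\<lambda>n. I.prob (D \<inter> (relabel (shift n) -` C \<inter> space ising_measure))) \<longlonglongrightarrow>
    I.prob D * I.prob C"
proof -
  define X where "X n = relabel (shift n) -` C \<inter> space ising_measure" for n
  have pres: "relabel (shift n) \<in> measurable ising_measure ising_measure"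
    "distr ising_measure ising_measure (relabel (shift n)) = ising_measure" for n
    using preserving_relabel[OF bij_shift, of n] by (auto simp: preserving_def)
  have X: "X n \<in> I.events" for n
    unfolding X_def using pres cylinders_sets[OF assms(2)] by (auto intro: measurable_sets)
  have mX: "I.prob (X n) = I.prob C" for n
    using measure_distr[OF pres(1) cylinders_sets[OF assms(2)], of n] pres(2)[of n] by (simp add: X_def)
  from assms(1) have "(\<lambda>n. I.prob (D \<inter> X n)) \<longlonglongrightarrow> I.prob D * I.prob C"
  proof (induction D rule: ising_dynkin)
    case (cylinder C')
    show ?case
      by (rule tendsto_eventually) (use cylinder_mixing[OF cylinder assms(2)] in \<open>simp add: X_def\<close>)
  next
    case (compl D)
    have "I.prob ((space ising_measure - D) \<inter> X n) = I.prob C - I.prob (D \<inter> X n)" for n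
    proof -
      have "(space ising_measure - D) \<inter> X n = X n - D \<inter> X n"
        using sets.sets_into_space[OF X[of n]] by auto
      then show ?thesis
        using I.finite_measure_Diff[of "X n" "D \<inter> X n"] X[of n] compl mX[of n] by auto
    qed
    moreover have "I.prob (space ising_measure - D) * I.prob C =
        I.prob C - I.prob D * I.prob C"
      unfolding I.prob_compl[OF compl(1)] by (simp add: algebra_simps)
    ultimately show ?case using compl(2) by (auto intro!: tendsto_diff)
  next
    case (union D)
    have sums: "(\<lambda>i. I.prob (D i \<inter> X n)) sums I.prob ((\<Union>i. D i) \<inter> X n)" for n
    proof -
      have "(\<lambda>i. I.prob (D i \<inter> X n)) sums I.prob (\<Union>i. D i \<inter> X n)"
        using union(1,2) X by (intro I.finite_measure_UNION) (auto simp: disjoint_family_on_def)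
      then show ?thesis by simp
    qed
    have sumsD: "(\<lambda>i. I.prob (D i)) sums I.prob (\<Union>i. D i)"
      using union(1,2) by (intro I.finite_measure_UNION) auto
    have "I.prob (D i \<inter> X n) \<le> I.prob (D i)" for i n
      using union(2) X by (intro I.finite_measure_mono) auto
    \<comment> \<open>The bound by \<open>I.prob (D i)\<close> is summable in \<open>i\<close> and
      independent of \<open>n\<close>, so Tannery's theorem exchanges the limit with the
      sum.\<close>
    then have bound: "\<forall>\<^sub>F (i, n) in sequentially \<times>\<^sub>F sequentially.
        norm (I.prob (D i \<inter> X n)) \<le> I.prob (D i)"
      by (intro always_eventually) auto
    have "((\<lambda>n. \<Sum>i. I.prob (D i \<inter> X n)) \<longlongrightarrow> (\<Sum>i. I.prob (D i) * I.prob C)) sequentially"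
      using tannerys_theorem[OF union(3) bound sums_summable[OF sumsD]] by simp
    moreover have "(\<Sum>i. I.prob (D i \<inter> X n)) = I.prob ((\<Union>i. D i) \<inter> X n)" for n
      using sums[of n] by (rule sums_unique[symmetric])
    moreover have "(\<Sum>i. I.prob (D i) * I.prob C) = I.prob (\<Union>i. D i) * I.prob C"
      using sums_mult2[OF sumsD] by (rule sums_unique[symmetric])
    ultimately show ?case by simp
  qed
  then show ?thesis by (simp add: X_def)
qed

context ising_process
begin

text \<open>An event that is invariant under translations is independent of every cylinder, by mixing, and
  hence of itself.\<close>

lemma zero_one_law:
  assumes E: "{\<omega> \<in> space ising_measure. V (\<sigma> t \<omega>)} \<in> I.events"
    and V: "\<And>T \<eta>. automorphism T \<Longrightarrow> V (\<eta> \<circ> T) \<longleftrightarrow> V \<eta>"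
  shows "I.prob {\<omega> \<in> space ising_measure. V (\<sigma> t \<omega>)} \<in> {0, 1}"
proof -
  define E where "E = {\<omega> \<in> space ising_measure. V (\<sigma> t \<omega>)}"
  have sE: "E \<in> I.events" using assms(1) by (simp add: E_def)
  have cyl: "I.prob (E \<inter> C) = I.prob E * I.prob C" if C: "C \<in> cylinders" for C
  proof -
    \<comment> \<open>Translating \<open>E \<inter> C\<close> moves only \<open>C\<close>, because
      \<open>E\<close> is invariant almost surely; the sequence in the mixing limit is therefore
      constant.\<close>
    have "I.prob (E \<inter> (relabel (shift n) -` C \<inter> space ising_measure)) = I.prob (E \<inter> C)" for n
    proof -
      have m: "relabel (shift n) \<in> measurable ising_measure ising_measure"
        "distr ising_measure ising_measure (relabel (shift n)) = ising_measure"
        using preserving_relabel[OF bij_shift, of n] by (auto simp: preserving_def)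
      have EC: "E \<inter> C \<in> I.events" using sE cylinders_sets[OF C] by auto
      have "I.prob (E \<inter> C) = measure (distr ising_measure ising_measure (relabel (shift n))) (E \<inter> C)"
        by (simp add: m(2))
      also have "\<dots> = I.prob (relabel (shift n) -` (E \<inter> C) \<inter> space ising_measure)"
        by (rule measure_distr[OF m(1) EC])
      also have "\<dots> = I.prob (E \<inter> (relabel (shift n) -` C \<inter> space ising_measure))"
      proof (rule measure_eq_AE)
        show "AE \<omega> in ising_measure. \<omega> \<in> relabel (shift n) -` (E \<inter> C) \<inter> space ising_measure \<longleftrightarrow>
            \<omega> \<in> E \<inter> (relabel (shift n) -` C \<inter> space ising_measure)"
          using AE_relabel[OF automorphism_shift[of n]] AE_space
        proof eventually_elim
          case (elim \<omega>)
          have "V (\<sigma> t \<omega>) \<longleftrightarrow> V (\<sigma> t (relabel (shift n) \<omega>))"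
            using V[OF automorphism_inv[OF automorphism_shift[of n]], of "\<sigma> t (relabel (shift n) \<omega>)"] elim(1) by simp
          then show ?case using elim(2) measurable_space[OF m(1) elim(2)] by (auto simp: E_def)
        qed
        show "relabel (shift n) -` (E \<inter> C) \<inter> space ising_measure \<in> I.events"
          by (rule measurable_sets[OF m(1) EC])
        show "E \<inter> (relabel (shift n) -` C \<inter> space ising_measure) \<in> I.events"
          using sE measurable_sets[OF m(1) cylinders_sets[OF C]] by auto
      qed
      finally show ?thesis by simp
    qed
    then show ?thesis using shift_mixing[OF sE C] by (simp add: LIMSEQ_const_iff)
  qed
  from sE have "I.prob (E \<inter> E) = I.prob E * I.prob E"
  proof (induction E rule: ising_dynkin[where P = "\<lambda>D. I.prob (E \<inter> D) = I.prob E * I.prob D"])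
    case (cylinder C)
    then show ?case by (rule cyl)
  next
    case (compl D)
    have "E \<inter> (space ising_measure - D) = E - E \<inter> D" using sets.sets_into_space[OF sE] by auto
    moreover have "I.prob (E - E \<inter> D) = I.prob E - I.prob (E \<inter> D)"
      using sE compl(1) by (intro I.finite_measure_Diff) auto
    ultimately show ?case
      unfolding I.prob_compl[OF compl(1)] using compl(2) by (simp add: algebra_simps)
  next
    case (union D)
    have "(\<lambda>i. I.prob (E \<inter> D i)) sums I.prob (\<Union>i. E \<inter> D i)"
      using union(1,2) sE by (intro I.finite_measure_UNION) (auto simp: disjoint_family_on_def)
    then have "(\<lambda>i. I.prob E * I.prob (D i)) sums I.prob (E \<inter> (\<Union>i. D i))"
      using union(3) by simp
    moreover have "(\<lambda>i. I.prob E * I.prob (D i)) sums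
        (I.prob E * I.prob (\<Union>i. D i))"
      using union(1,2) by (intro sums_mult I.finite_measure_UNION) auto
    ultimately show ?case by (rule sums_unique2)
  qed
  then have "I.prob E * (1 - I.prob E) = 0" by (simp add: algebra_simps)
  then show ?thesis unfolding E_def[symmetric] by auto
qed

end

section \<open>Infinite clusters and the conclusion\<close>

lemma linked_vimage:
  assumes T: "automorphism T"
  shows "linked neighbor (T -` S) x y \<longleftrightarrow> linked neighbor S (T x) (T y)"
proof
  have bij: "bij T" using T by (simp add: automorphism_def)
  assume "linked neighbor (T -` S) x y"
  then have "linked neighbor (T ` (T -` S)) (T x) (T y)"
    by (rule linked_image) (use T in \<open>simp add: automorphism_def\<close>)
  then show "linked neighbor S (T x) (T y)" by (rule linked_subset) auto
next
  have bij: "bij T" using T by (simp add: automorphism_def)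
  assume "linked neighbor S (T x) (T y)"
  then have "linked neighbor (inv T ` S) (inv T (T x)) (inv T (T y))"
    by (rule linked_image) (use automorphism_inv[OF T] in \<open>simp add: automorphism_def\<close>)
  moreover have "inv T ` S \<subseteq> T -` S" using bij by (auto simp: bij_is_surj surj_f_inv_f)
  ultimately show "linked neighbor (T -` S) x y"
    using bij by (auto simp: bij_is_inj intro: linked_subset)
qed

lemma surj_image_Collect: "surj f \<Longrightarrow> {y. P y} = f ` {x. P (f x)}"
  by (auto simp: image_iff)

lemma infinite_at_vimage:
  assumes T: "automorphism T"
  shows "infinite_at (T -` S) x \<longleftrightarrow> infinite_at S (T x)"
proof -
  have bij: "bij T" using T by (simp add: automorphism_def)
  have "{y. linked neighbor S (T x) y} = T ` {y. linked neighbor (T -` S) x y}"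
    unfolding linked_vimage[OF T] by (rule surj_image_Collect[OF bij_is_surj[OF bij]])
  then show ?thesis
    unfolding infinite_at_def using finite_image_iff[OF inj_on_subset[OF bij_is_inj[OF bij] subset_UNIV]] by simp
qed

lemma ex_infinite_at_vimage:
  assumes "automorphism T"
  shows "(\<exists>x. infinite_at (T -` S) x) \<longleftrightarrow> (\<exists>x. infinite_at S x)"
proof -
  have "surj T" using assms by (simp add: automorphism_def bij_is_surj)
  then have "\<exists>y. x = T y" for x by (simp add: surj_def)
  then show ?thesis unfolding infinite_at_vimage[OF assms] by metis
qed

text \<open>The part reached from \<open>x\<close> within the sites that share its spin is itself
  connected and constant, and any other such set containing \<open>x\<close> lies in it. Clusters
  thereby become instances of \<open>infinite_at\<close>.\<close>

lemma cluster_eq_linked: "cluster \<eta> x = {y. linked neighbor {z. \<eta> z = \<eta> x} x y}"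
proof (intro equalityI subsetI)
  fix y assume "y \<in> cluster \<eta> x"
  then obtain A where A: "mono_connected_at \<eta> x A" "y \<in> A" by (auto simp: cluster_eq_Union)
  then have "linked neighbor A x y" "A \<subseteq> {z. \<eta> z = \<eta> x}"
    unfolding mono_connected_at_def site_connected_def linked_def by blast+
  then show "y \<in> {y. linked neighbor {z. \<eta> z = \<eta> x} x y}" by (auto intro: linked_subset)
next
  define S where "S = {z. \<eta> z = \<eta> x}"
  define A where "A = {y. linked neighbor S x y}"
  fix y assume "y \<in> {y. linked neighbor {z. \<eta> z = \<eta> x} x y}"
  then have y: "y \<in> A" by (simp add: A_def S_def)
  have x: "x \<in> A" by (auto simp: A_def S_def intro: linked_refl)
  have eq: "\<eta> u = \<eta> x" if "u \<in> A" for u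
    using that linked_end[of neighbor S x u] by (simp add: A_def S_def)
  have "linked neighbor A u v" if "u \<in> A" "v \<in> A" for u v
  proof -
    have S: "linked neighbor S x u" "linked neighbor S x v" using that by (simp_all add: A_def)
    note l = linked_component[OF S(1), folded A_def] linked_component[OF S(2), folded A_def]
    have "linked neighbor A u x" by (rule linked_sym[OF neighbor_sym[THEN iffD1] l(1)])
    then show ?thesis using l(2) by (rule linked_trans)
  qed
  then have "site_connected A" unfolding site_connected_def linked_def by simp
  moreover have "\<eta> u = \<eta> v" if "u \<in> A" "v \<in> A" for u v
    using eq[OF that(1)] eq[OF that(2)] by (rule trans[OF _ sym])
  ultimately have "mono_connected_at \<eta> x A" using x unfolding mono_connected_at_def by blast
  then show "y \<in> cluster \<eta> x" using y unfolding cluster_eq_Union by blast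
qed

theorem proposition3p2:
  fixes \<sigma> :: "real \<Rightarrow> config \<times> clocks \<Rightarrow> config"
  assumes "zero_temp_ising \<sigma>"
  shows "\<forall>t\<ge>0.
    {\<omega> \<in> space ising_measure. infinite (cluster (\<sigma> t \<omega>) (0, 0))} \<in> sets ising_measure \<and>
    measure ising_measure {\<omega> \<in> space ising_measure. infinite (cluster (\<sigma> t \<omega>) (0, 0))} = 0"
proof (intro allI impI)
  fix t :: real assume "t \<ge> 0"
  then interpret ising_process \<sigma> t using assms by unfold_locales
  interpret X: planar_random_set ising_measure plus by (rule planar_plus)
  \<comment> \<open>The locale bounds clusters in the complement of its random set, so the
    complement of \<open>plus\<close> is needed to treat clusters of plus spins.\<close>
  interpret Y: planar_random_set ising_measure "\<lambda>\<omega>. - plus \<omega>" by (rule planar_minus)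
  let ?o = "(0, 0) :: site"
  let ?E = "{\<omega> \<in> space ising_measure. infinite (cluster (\<sigma> t \<omega>) ?o)}"
  let ?N = "{\<omega> \<in> space ising_measure. \<exists>x. infinite_at (- plus \<omega>) x}"
  let ?P = "{\<omega> \<in> space ising_measure. \<exists>x. infinite_at (- (- plus \<omega>)) x}"
  have vim: "plus_set (\<eta> \<circ> T) = T -` plus_set \<eta>" for \<eta> T by (auto simp: plus_set_def)
  have "I.prob ?N \<in> {0, 1}"
    unfolding plus_eq
  proof (rule zero_one_law[of "\<lambda>\<eta>. \<exists>x. infinite_at (- plus_set \<eta>) x"])
    show "{\<omega> \<in> space ising_measure. \<exists>x. infinite_at (- plus_set (\<sigma> t \<omega>)) x} \<in> I.events"
      using X.prob_infinite_cluster_less_1(1) unfolding plus_eq .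
    show "(\<exists>x. infinite_at (- plus_set (\<eta> \<circ> T)) x) \<longleftrightarrow> (\<exists>x. infinite_at (- plus_set \<eta>) x)" if "automorphism T" for T \<eta>
      unfolding vim vimage_Compl[symmetric] by (rule ex_infinite_at_vimage[OF that])
  qed
  then have N: "I.prob ?N = 0" using X.prob_infinite_cluster_less_1(2) by auto
  have "I.prob ?P \<in> {0, 1}"
    unfolding plus_eq
  proof (rule zero_one_law[of "\<lambda>\<eta>. \<exists>x. infinite_at (- (- plus_set \<eta>)) x"])
    show "{\<omega> \<in> space ising_measure. \<exists>x. infinite_at (- (- plus_set (\<sigma> t \<omega>))) x} \<in> I.events"
      using Y.prob_infinite_cluster_less_1(1) unfolding plus_eq .
    show "(\<exists>x. infinite_at (- (- plus_set (\<eta> \<circ> T))) x) \<longleftrightarrow> (\<exists>x. infinite_at (- (- plus_set \<eta>)) x)" if "automorphism T" for T \<eta>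
      unfolding vim double_complement by (rule ex_infinite_at_vimage[OF that])
  qed
  then have P: "I.prob ?P = 0" using Y.prob_infinite_cluster_less_1(2) by auto
  have eq: "?E = {\<omega> \<in> space ising_measure. \<sigma> t \<omega> ?o = 1} \<inter> {\<omega> \<in> space ising_measure. infinite_at (- (- plus \<omega>)) ?o} \<union>
      {\<omega> \<in> space ising_measure. \<sigma> t \<omega> ?o = -1} \<inter> {\<omega> \<in> space ising_measure. infinite_at (- plus \<omega>) ?o}"
  proof -
    have "infinite (cluster (\<sigma> t \<omega>) ?o) \<longleftrightarrow> \<sigma> t \<omega> ?o = 1 \<and> infinite_at (- (- plus \<omega>)) ?o \<or>
        \<sigma> t \<omega> ?o = -1 \<and> infinite_at (- plus \<omega>) ?o" if "\<omega> \<in> space ising_measure" for \<omega>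
    proof -
      have plus: "{z. \<sigma> t \<omega> z = 1} = - (- plus \<omega>)" by (simp add: plus_def)
      have "\<sigma> t \<omega> z = -1 \<longleftrightarrow> \<not> \<sigma> t \<omega> z = 1" for z using \<sigma>_spin[OF that, of z] by fastforce
      then have minus: "{z. \<sigma> t \<omega> z = -1} = - plus \<omega>" by (simp add: plus_def Collect_neg_eq)
      have "infinite (cluster (\<sigma> t \<omega>) ?o) \<longleftrightarrow> infinite_at {z. \<sigma> t \<omega> z = \<sigma> t \<omega> ?o} ?o"
        by (simp add: cluster_eq_linked infinite_at_def)
      moreover have "\<sigma> t \<omega> ?o = 1 \<or> \<sigma> t \<omega> ?o = -1" using \<sigma>_spin[OF that, of ?o] by blast
      ultimately show ?thesis
        by (elim disjE) (simp_all add: plus minus)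
    qed
    then show ?thesis by blast
  qed
  have E: "?E \<in> I.events"
    unfolding eq by (intro sets.Un sets.Int sets_\<sigma>_eq X.sets_infinite_at Y.sets_infinite_at)
  have "I.prob ?E \<le> I.prob (?P \<union> ?N)"
    unfolding eq using X.prob_infinite_cluster_less_1(1) Y.prob_infinite_cluster_less_1(1)
    by (intro I.finite_measure_mono) blast+
  also have "\<dots> \<le> I.prob ?P + I.prob ?N"
    using X.prob_infinite_cluster_less_1(1) Y.prob_infinite_cluster_less_1(1) by (intro measure_Un_le)
  finally show "?E \<in> I.events \<and> I.prob ?E = 0"
    using E N P by (simp add: measure_le_0_iff)
qed

end
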